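(* Let $(x_n)_{n\in\mathbb N}$ be a weakly null sequence in a Banach space $X$ and let $\xi<\omega_1$. Then exactly one of the following holds. (a) For every $M\in[\mathbb N]$ there exists $L\in[M]$ such that for every $P\in[L]$ the sequence $(x_n)_{n\in\mathbb N}$ is $(P,\xi)$ summable. (b) There exists $M\in[\mathbb N]$, $M=(m_i)_{i\in\mathbb N}$, such that $(x_{m_i})_{i\in\mathbb N}$ is an $\ell^1_{\xi+1}$ spreading model.
   Context: Notation: $\mathbb N=\{1,2,\dots\}$. For an infinite $N\subset\mathbb N$, $[N]$ is the set of all infinite subsets of $N$. Writing $M=(m_i)_{i\in\mathbb N}$ means $m_1<m_2<\cdots$ is the increasing enumeration of $M$. For nonempty finite sets, $F<G$ means $\max F<\min G$, and $n\le F$ means $n\le\min F$. Generalized Schreier families $(\mathcal F_\xi)_{\xi<\omega_1}$ of finite subsets of $\mathbb N$: $\mathcal F_0=\{\{n\}:n\in\mathbb N\}\cup\{\emptyset\}$; $\mathcal F_{\zeta+1}$ consists of $\emptyset$ and all sets $\bigcup_{i=1}^nF_i$ with $n\in\mathbb N$, $F_i\in\mathcal F_\zeta$, $n\le F_1<\cdots<F_n$; for a (nonzero) limit ordinal $\xi$ one fixes a strictly increasing sequence $(\xi_n)_{n\in\mathbb N}$ of successor ordinals with $\sup_n\xi_n=\xi$, and $\mathcal F_\xi$ consists of $\emptyset$ and all finite $F$ such that for some $n$, $n\le\min F$ and $F\in\mathcal F_{\xi_n}$. The choices of sequences are fixed throughout. $\ell^1_\xi$ spreading model: for a bounded sequence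 $(x_n)$ and $M=(m_i)$, $(x_{m_i})_{i\in\mathbb N}$ is an $\ell^1_\xi$ spreading model if there is $\varepsilon>0$ such that $\|\sum_{i\in F}a_ix_{m_i}\|\ge\varepsilon\sum_{i\in F}|a_i|$ for all $F\in\mathcal F_\xi$ and all scalars $(a_i)_{i\in F}$. Repeated Averages (RA) Hierarchy: for $M\in[\mathbb N]$ and $\xi<\omega_1$ one defines a sequence $(\xi^M_n)_{n\in\mathbb N}$ of finitely supported elements of the positive part $S^+_{\ell^1}$ of the unit sphere of $\ell^1(\mathbb N)$ (with successive supports whose union is $M$) by induction on $\xi$. Here $(e_n)$ is the unit vector basis. (i) $0^M_n=e_{m_n}$ where $M=(m_n)_{n\in\mathbb N}$. (ii) If $\xi=\zeta+1$: put $k_1=0$, $s_1=\min\operatorname{supp}\zeta^M_1$, and for $n\ge2$ put $k_n=k_{n-1}+s_{n-1}$, $s_n=\min\operatorname{supp}\zeta^M_{k_n+1}$; then $\xi^M_n=\frac1{s_n}\left(\zeta^M_{k_n+1}+\cdots+\zeta^M_{k_n+s_n}\right)$. (iii) If $\xi$ is a limit ordinal and $(\xi_n)$ is the sequence used to define $\mathcal F_\xi$: put $M_1=M$, $n_1=\min M_1$, and inductively $M_{k+1}=M_k\setminus\operatorname{supp}(\xi_{n_k})^{M_k}_1$, $n_{k+1}=\min M_{k+1}$; then $\xi^M_k=(\xi_{n_k})^{M_k}_1$. Summability: for a bounded sequence $H=(x_n)$ in $X$ and $A=(a_n)\in S^+_{\ell^1}$ put $A\cdot H=\sum_na_nx_n$.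 The sequence $H$ is $(M,\xi)$ summable if $(\xi^M_n\cdot H)_{n\in\mathbb N}$ is Cesàro summable, i.e. $\frac1n\sum_{k=1}^n\xi^M_k\cdot H$ converges in norm as $n\to\infty$. *)

theory Defs
  imports "HOL-Analysis.Analysis" "HOL-Library.Countable_Set_Type"
begin

section \<open>The countable ordinals\<close>

text \<open>The elements of \<open>omega1\<close> are the ordinals below the first uncountable ordinal: the order is
  the cardinal successor of the order of the natural numbers.\<close>

unbundle cardinal_syntax

typedef omega1 = "Field (cardSuc natLeq)"
proof -
  have "infinite (Field (cardSuc natLeq))"
    using cardSuc_finite[OF natLeq_Card_order] Field_natLeq by simp
  then show ?thesis using infinite_imp_nonempty by blast
qed

lemma cardSuc_natLeq_Well_order: "Well_order (cardSuc natLeq)"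
  using cardSuc_Card_order[OF natLeq_Card_order] card_order_on_well_order_on by blast

instantiation omega1 :: wellorder
begin

definition less_eq_omega1 :: "omega1 \<Rightarrow> omega1 \<Rightarrow> bool" where
  "a \<le> b \<longleftrightarrow> (Rep_omega1 a, Rep_omega1 b) \<in> cardSuc natLeq"

definition less_omega1 :: "omega1 \<Rightarrow> omega1 \<Rightarrow> bool" where
  "a < b \<longleftrightarrow> a \<le> b \<and> a \<noteq> (b :: omega1)"

instance
proof
  let ?r = "cardSuc natLeq"
  have R: "refl_on (Field ?r) ?r" "trans ?r" "antisym ?r" "total_on (Field ?r) ?r"
      "wf (?r - Id)"
    using cardSuc_natLeq_Well_order
    unfolding well_order_on_def linear_order_on_def partial_order_on_def preorder_on_def by auto
  note Rep = Rep_omega1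
  have anti: "a = b" if "a \<le> b" "b \<le> a" for a b :: omega1
    using that R(3) unfolding less_eq_omega1_def antisym_def by (metis Rep_omega1_inject)
  show "(a < b) = (a \<le> b \<and> \<not> b \<le> a)" for a b :: omega1
    using anti unfolding less_omega1_def by auto
  show "a \<le> a" for a :: omega1
    using R(1) Rep unfolding less_eq_omega1_def refl_on_def by blast
  show "a \<le> c" if "a \<le> b" "b \<le> c" for a b c :: omega1
    using that R(2) unfolding less_eq_omega1_def trans_def by blast
  show "a = b" if "a \<le> b" "b \<le> a" for a b :: omega1 using anti that .
  show lin: "a \<le> b \<or> b \<le> a" for a b :: omega1
    using R(4) R(1) Rep unfolding less_eq_omega1_def total_on_def refl_on_def by metis
  show "P a" if "\<And>x. (\<And>y. y < x \<Longrightarrow> P y) \<Longrightarrow> P x" for P and a :: omega1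
  proof -
    have "{(x, y :: omega1). x < y} = inv_image (?r - Id) Rep_omega1"
      unfolding inv_image_def less_omega1_def less_eq_omega1_def
      by (auto simp: Rep_omega1_inject)
    then have "wf {(x, y :: omega1). x < y}" using R(5) by simp
    then show ?thesis using that by (rule wf_induct_rule) auto
  qed
qed

end

lemma countable_lessThan_omega1: "countable {..<a :: omega1}"
proof -
  let ?r = "cardSuc natLeq"
  have C: "Card_order ?r" by (rule cardSuc_Card_order[OF natLeq_Card_order])
  have "|underS ?r (Rep_omega1 a)| <o ?r"
    by (rule card_of_underS[OF C Rep_omega1])
  then have "|underS ?r (Rep_omega1 a)| \<le>o natLeq"
    using cardSuc_ordLeq_ordLess[OF natLeq_Card_order card_of_Card_order] by blast
  then have "countable (underS ?r (Rep_omega1 a))"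
    by (simp add: countable_card_le_natLeq)
  moreover have "Rep_omega1 ` {..<a} \<subseteq> underS ?r (Rep_omega1 a)"
    by (auto simp: underS_def less_omega1_def less_eq_omega1_def Rep_omega1_inject)
  ultimately have "countable (Rep_omega1 ` {..<a})" using countable_subset by blast
  then show ?thesis
    by (rule countable_image_inj_on) (auto simp: inj_on_def Rep_omega1_inject)
qed

lemma uncountable_omega1: "uncountable (UNIV :: omega1 set)"
proof
  let ?r = "cardSuc natLeq"
  assume "countable (UNIV :: omega1 set)"
  then have "countable (range Rep_omega1)" by simp
  moreover have "range Rep_omega1 = Field ?r"
    using type_definition.Rep_range[OF type_definition_omega1] .
  ultimately have "|Field ?r| \<le>o natLeq" by (simp add: countable_card_le_natLeq)
  then have "?r \<le>o natLeq"
    using card_of_Field_ordIso[OF cardSuc_Card_order[OF natLeq_Card_order]]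
      ordIso_ordLeq_trans ordIso_symmetric by blast
  then show False
    using cardSuc_greater[OF natLeq_Card_order] not_ordLess_ordLeq by blast
qed

unbundle no cardinal_syntax

lemma omega1_no_max: "\<exists>b. (a :: omega1) < b"
proof (rule ccontr)
  assume "\<not> ?thesis"
  then have "(UNIV :: omega1 set) = insert a {..<a}" by (auto simp: not_less order.order_iff_strict)
  then show False
    using uncountable_omega1 countable_lessThan_omega1[of a] by (metis countable_insert)
qed

instantiation omega1 :: zero
begin
definition zero_omega1 :: omega1 where "0 = (LEAST a :: omega1. True)"
instance ..
end

lemma zero_le_omega1 [simp]: "0 \<le> (a :: omega1)"
  unfolding zero_omega1_def by (rule Least_le) simp

definition osuc :: "omega1 \<Rightarrow> omega1" where
  "osuc a = (LEAST b. a < b)"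

lemma less_osuc: "a < osuc a"
  unfolding osuc_def using omega1_no_max[of a] by (metis LeastI_ex)

lemma osuc_leI: "a < b \<Longrightarrow> osuc a \<le> b"
  unfolding osuc_def by (rule Least_le)

lemma osuc_inject [simp]: "osuc a = osuc b \<longleftrightarrow> a = b"
  by (metis less_osuc osuc_leI linorder_neqE leD)

lemma osuc_neq_0 [simp]: "osuc a \<noteq> 0"
  by (metis less_osuc zero_le_omega1 leD)

definition is_succ :: "omega1 \<Rightarrow> bool" where
  "is_succ a \<longleftrightarrow> (\<exists>b. a = osuc b)"

definition opred :: "omega1 \<Rightarrow> omega1" where
  "opred a = (THE b. a = osuc b)"

lemma opred_osuc [simp]: "opred (osuc a) = a"
  unfolding opred_def by simp

lemma is_succ_osuc [simp]: "is_succ (osuc a)"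
  unfolding is_succ_def by blast

lemma not_is_succ_0 [simp]: "\<not> is_succ 0"
  unfolding is_succ_def by (metis osuc_neq_0)

lemma opred_less: "is_succ a \<Longrightarrow> opred a < a"
  unfolding is_succ_def using less_osuc by auto

definition is_limit :: "omega1 \<Rightarrow> bool" where
  "is_limit a \<longleftrightarrow> a \<noteq> 0 \<and> \<not> is_succ a"

lemma osuc_less_limit: "is_limit a \<Longrightarrow> b < a \<Longrightarrow> osuc b < a"
  using osuc_leI[of b a] unfolding is_limit_def is_succ_def by (auto simp: order.order_iff_strict)

section \<open>Subsets and sequences of positive integers\<close>

text \<open>Here the natural numbers start with 1, whence sets of them are subsets of \<open>{1..}\<close>, sequences
  are functions on \<open>nat\<close> whose value at 0 is irrelevant, and \<open>elt M i\<close> is the \<open>i\<close>-th element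
  of \<open>M\<close> in increasing order, counted from 1 (\<open>enumerate\<close> counts from 0).\<close>

definition infinite_subsets :: "nat set \<Rightarrow> nat set set" where
  "infinite_subsets N = {M. M \<subseteq> N \<and> infinite M}"

definition elt :: "nat set \<Rightarrow> nat \<Rightarrow> nat" where
  "elt M i = enumerate M (i - 1)"

definition supp :: "(nat \<Rightarrow> real) \<Rightarrow> nat set" where
  "supp a = {i. a i \<noteq> 0}"

section \<open>Building blocks of the repeated averages\<close>

text \<open>The successor step: \<open>z\<close> stands for the sequence given by the preceding ordinal.\<close>

fun avg_start :: "(nat \<Rightarrow> nat \<Rightarrow> real) \<Rightarrow> nat \<Rightarrow> nat" where
  "avg_start z 0 = 0"
| "avg_start z (Suc 0) = 0"
| "avg_start z (Suc (Suc n)) =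
     avg_start z (Suc n) + Min (supp (z (avg_start z (Suc n) + 1)))"

definition avg_length :: "(nat \<Rightarrow> nat \<Rightarrow> real) \<Rightarrow> nat \<Rightarrow> nat" where
  "avg_length z n = Min (supp (z (avg_start z n + 1)))"

definition avg_succ :: "(nat \<Rightarrow> nat \<Rightarrow> real) \<Rightarrow> nat \<Rightarrow> nat \<Rightarrow> real" where
  "avg_succ z n = (\<lambda>i. 1 / real (avg_length z n) *
     (\<Sum>j = 1..avg_length z n. z (avg_start z n + j) i))"

text \<open>The limit step: \<open>G n N\<close> stands for the first term of the sequence given by the set \<open>N\<close> and the
  \<open>n\<close>-th ordinal of the sequence chosen for the limit ordinal. The minimum of an infinite
  set is written as \<open>Inf\<close>, since \<open>Min\<close> is meaningful for finite sets only.\<close>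

fun avg_rest :: "(nat \<Rightarrow> nat set \<Rightarrow> nat \<Rightarrow> real) \<Rightarrow> nat set \<Rightarrow> nat \<Rightarrow> nat set" where
  "avg_rest G M 0 = M"
| "avg_rest G M (Suc 0) = M"
| "avg_rest G M (Suc (Suc k)) =
     avg_rest G M (Suc k) - supp (G (Inf (avg_rest G M (Suc k))) (avg_rest G M (Suc k)))"

definition avg_limit :: "(nat \<Rightarrow> nat set \<Rightarrow> nat \<Rightarrow> real) \<Rightarrow> nat set \<Rightarrow> nat \<Rightarrow> nat \<Rightarrow> real" where
  "avg_limit G M k = G (Inf (avg_rest G M k)) (avg_rest G M k)"

section \<open>Schreier families, repeated averages, summability, spreading models\<close>

text \<open>The sequence chosen for the limit ordinal \<open>a\<close> is \<open>c a 1, c a 2, \<dots>\<close>; by \<open>ladder_less\<close> and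
  \<open>ladder_cofinal\<close> its supremum is \<open>a\<close>. The value \<open>c a 0\<close> is not used; that \<open>ladder_less\<close> bounds it
  as well is no restriction and only makes the recursions below terminate.\<close>

locale ladder_system =
  fixes c :: "omega1 \<Rightarrow> nat \<Rightarrow> omega1"
  assumes ladder_succ: "is_limit a \<Longrightarrow> 1 \<le> n \<Longrightarrow> is_succ (c a n)"
    and ladder_strict: "is_limit a \<Longrightarrow> 1 \<le> m \<Longrightarrow> m < n \<Longrightarrow> c a m < c a n"
    and ladder_less: "is_limit a \<Longrightarrow> c a n < a"
    and ladder_cofinal: "is_limit a \<Longrightarrow> b < a \<Longrightarrow> \<exists>n\<ge>1. b < c a n"
begin

function schreier :: "omega1 \<Rightarrow> nat set set" where
  "schreier a =
    (if a = 0 then insert {} {{n} |n. 1 \<le> n}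
     else if is_succ a then
       insert {} {\<Union>(F ` {1..n}) |n F. 1 \<le> n \<and>
         (\<forall>i\<in>{1..n}. F i \<in> schreier (opred a) \<and> F i \<noteq> {}) \<and>
         n \<le> Min (F 1) \<and> (\<forall>i\<in>{1..<n}. Max (F i) < Min (F (i + 1)))}
     else insert {} {F. finite F \<and> F \<noteq> {} \<and> F \<subseteq> {1..} \<and>
         (\<exists>n\<ge>1. n \<le> Min F \<and> F \<in> schreier (c a n))})"
  by pat_completeness auto
termination
  by (relation "{(x, y). x < y}")
    (auto simp: wf opred_less ladder_less is_limit_def)

function RA :: "omega1 \<Rightarrow> nat set \<Rightarrow> nat \<Rightarrow> nat \<Rightarrow> real" where
  "RA a M =
    (if a = 0 then (\<lambda>n i. if i = elt M n then 1 else 0)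
     else if is_succ a then avg_succ (RA (opred a) M)
     else avg_limit (\<lambda>n N. RA (c a n) N 1) M)"
  by pat_completeness auto
termination
  by (relation "inv_image {(x, y). x < y} fst")
    (auto simp: wf opred_less ladder_less is_limit_def)

declare schreier.simps [simp del] RA.simps [simp del]

lemma schreier_0: "schreier 0 = insert {} {{n} |n. 1 \<le> n}"
  by (simp add: schreier.simps[of 0])

lemma schreier_osuc:
  "schreier (osuc b) = insert {} {\<Union>(F ` {1..n}) |n F. 1 \<le> n \<and>
     (\<forall>i\<in>{1..n}. F i \<in> schreier b \<and> F i \<noteq> {}) \<and>
     n \<le> Min (F 1) \<and> (\<forall>i\<in>{1..<n}. Max (F i) < Min (F (i + 1)))}"
  by (simp add: schreier.simps[of "osuc b"])

lemma schreier_limit: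
  "is_limit a \<Longrightarrow> schreier a = insert {} {F. finite F \<and> F \<noteq> {} \<and> F \<subseteq> {1..} \<and>
     (\<exists>n\<ge>1. n \<le> Min F \<and> F \<in> schreier (c a n))}"
  by (simp add: is_limit_def schreier.simps[of a])

lemma RA_0: "RA 0 M n = (\<lambda>i. if i = elt M n then 1 else 0)"
  by (simp add: RA.simps[of 0])

lemma RA_osuc: "RA (osuc b) M = avg_succ (RA b M)"
  by (simp add: RA.simps[of "osuc b"])

lemma RA_limit: "is_limit a \<Longrightarrow> RA a M = avg_limit (\<lambda>n N. RA (c a n) N 1) M"
  by (simp add: is_limit_def RA.simps[of a])

definition summable_RA :: "nat set \<Rightarrow> omega1 \<Rightarrow> (nat \<Rightarrow> 'a::real_normed_vector) \<Rightarrow> bool" where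
  "summable_RA M a x \<longleftrightarrow>
     convergent (\<lambda>n. (1 / real n) *\<^sub>R (\<Sum>k = 1..n. \<Sum>i. RA a M k i *\<^sub>R x i))"

definition l1_spreading_model ::
    "omega1 \<Rightarrow> nat set \<Rightarrow> (nat \<Rightarrow> 'a::real_normed_vector) \<Rightarrow> bool" where
  "l1_spreading_model a M x \<longleftrightarrow>
     (\<exists>\<epsilon>>0. \<forall>F\<in>schreier a. \<forall>t :: nat \<Rightarrow> real.
        \<epsilon> * (\<Sum>i\<in>F. \<bar>t i\<bar>) \<le> norm (\<Sum>i\<in>F. t i *\<^sub>R x (elt M i)))"

end

lemma ladder_system_exists: "\<exists>c. ladder_system c"
proof -
  have "\<exists>d :: nat \<Rightarrow> omega1. (\<forall>n. is_succ (d n)) \<and> (\<forall>n. d n < d (Suc n)) \<and> (\<forall>n. d n < a)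
          \<and> (\<forall>b<a. \<exists>n. b < d n)" if a: "is_limit a" for a
  proof -
    have "0 < a" using a le_neq_trans[of 0 a] by (simp add: is_limit_def)
    then have "{..<a} \<noteq> {}" by auto
    then obtain f :: "nat \<Rightarrow> omega1" where f: "range f = {..<a}"
      using countable_lessThan_omega1[of a] by (metis range_from_nat_into)
    define d where "d = rec_nat (osuc 0) (\<lambda>n r. osuc (max r (f n)))"
    have d0: "d 0 = osuc 0" and dS: "d (Suc n) = osuc (max (d n) (f n))" for n
      by (simp_all add: d_def)
    have 1: "is_succ (d n)" for n by (cases n) (simp_all add: d0 dS)
    have 2: "d n < d (Suc n)" for n
      unfolding dS using less_osuc max.cobounded1 by (rule le_less_trans[rotated])
    have 3: "d n < a" for n
      using \<open>0 < a\<close> f by (induction n) (auto simp: d0 dS intro!: osuc_less_limit[OF a])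
    have 4: "\<exists>n. b < d n" if "b < a" for b
    proof -
      from that obtain n where "b = f n" using f by blast
      then have "b < d (Suc n)"
        unfolding dS using less_osuc max.cobounded2 by (metis le_less_trans)
      then show ?thesis ..
    qed
    show ?thesis using 1 2 3 4 by blast
  qed
  then obtain d :: "omega1 \<Rightarrow> nat \<Rightarrow> omega1" where d:
    "\<And>a n. is_limit a \<Longrightarrow> is_succ (d a n)" "\<And>a n. is_limit a \<Longrightarrow> d a n < d a (Suc n)"
    "\<And>a n. is_limit a \<Longrightarrow> d a n < a" "\<And>a b. is_limit a \<Longrightarrow> b < a \<Longrightarrow> \<exists>n. b < d a n"
    by metis
  have "ladder_system d"
  proof
    show "d a m < d a n" if "is_limit a" "m < n" for a m n
      using lift_Suc_mono_less[of "d a"] d(2) that by blast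
    show "\<exists>n\<ge>1. b < d a n" if "is_limit a" "b < a" for a b
      using d(2,4)[OF that(1)] that(2) by (metis less_trans le_add1 plus_1_eq_Suc)
  qed (use d in auto)
  then show ?thesis by blast
qed

definition weakly_null :: "(nat \<Rightarrow> 'a::real_normed_vector) \<Rightarrow> bool" where
  "weakly_null x \<longleftrightarrow> (\<forall>f :: 'a \<Rightarrow> real. bounded_linear f \<longrightarrow> (\<lambda>n. f (x n)) \<longlonglongrightarrow> 0)"

end

theory Submission
  imports Defs "HOL-Complex_Analysis.Great_Picard"
begin

text \<open>
  The first average of order \<open>\<xi> + 1\<close> of a set
  with minimum \<open>p\<close> is the mean of \<open>p\<close> averages of order \<open>\<xi>\<close>. Since averages of order \<open>\<xi>\<close> may be
  regrouped freely, smallness of all first averages of order \<open>\<xi> + 1\<close> bounds the mean over every late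
  window of a fixed length \<open>p - 1\<close>, and so gives Cesaro convergence to 0. By Galvin's form of the
  Nash-Williams theorem, failure of this smallness yields a set on all of whose subsets these averages
  have norm greater than some \<open>\<epsilon>\<close>.

  In the latter case the sets \<open>G\<close> on which some functional of norm at most 1 is at least \<open>\<epsilon> / 2\<close> carry a
  fixed proportion of the mass of each average. By transfinite induction on the order, with the Ramsey
  theorem at each step, a hereditary family of this kind contains all sets \<open>{n\<^sub>i | i \<in> F}\<close> with \<open>F\<close> in
  the Schreier family, for a suitable set of \<open>n\<^sub>i\<close>. After a further thinning the functional can be
  chosen to be small on the remaining points of any finite set, which gives lower \<open>\<ell>\<^sup>1\<close> estimates for
  coefficients of arbitrary signs.

  Conversely, a spreading model of order \<open>\<xi> + 1\<close> bounds the mean of the averages \<open>n + 1, \<dots>, 2 n\<close> of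
  order \<open>\<xi>\<close> of a sparse set from below, whereas these means converge weakly to 0.
\<close>

section \<open>Ramsey theory of infinite sets\<close>

text \<open>Two scales have to be kept apart. The averages and the Schreier condition on their
  supports refer to the elements of a set, whereas an embedded Schreier family, like a spreading
  model, refers to positions in it. Passing to a subset moves positions to the right, which
  spreading families tolerate; this is why the fusion records cardinalities. In the converse
  direction the shift goes the wrong way, since a position never exceeds the element at it. A sparse
  set repairs this at the price of one point.

  The induction on the order runs over all hereditary families at once, because blocks of averages
  are treated through links of the family. Its conclusion does not mention the proportion of mass,
  so the factor 2 lost at a stage is harmless even along a transfinite induction.

  A weakly null sequence may fail to be unconditional, so a functional that is large on a set says
  nothing about signed sums. The thinning replaces unconditionality by one-sided smallness off the
  set, which is enough because one of the two signs carries at least half of the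
  coefficients.\<close>

definition beyond :: "nat set \<Rightarrow> nat set \<Rightarrow> nat set" where
  "beyond s N = {n \<in> N. \<forall>a\<in>s. a < n}"

lemma beyond_subset: "beyond s N \<subseteq> N"
  by (auto simp: beyond_def)

lemma infinite_beyond:
  assumes "finite s" "infinite N"
  shows "infinite (beyond s N)"
proof
  assume "finite (beyond s N)"
  then have "finite (beyond s N \<union> (\<Union>a\<in>s. {..a}))" using assms by auto
  moreover have "N \<subseteq> beyond s N \<union> (\<Union>a\<in>s. {..a})" by (auto simp: beyond_def not_less)
  ultimately show False using assms finite_subset by blast
qed

lemma initial_enumerate:
  fixes N :: "nat set"
  assumes "infinite N"
  shows "N \<inter> {..<enumerate N k} = enumerate N ` {..<k}"
proof -
  have "n \<in> enumerate N ` {..<k}" if "n \<in> N" "n < enumerate N k" for n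
    using that enumerate_Ex[OF assms that(1)] assms by (metis enumerate_mono_iff image_eqI lessThan_iff)
  then show ?thesis using assms by (auto simp: enumerate_in_set)
qed

lemma card_initial_enumerate:
  fixes N :: "nat set"
  assumes "infinite N"
  shows "card (N \<inter> {..<enumerate N k}) = k"
  using assms by (simp add: initial_enumerate card_image inj_enumerate inj_on_subset[OF inj_enumerate])

text \<open>A fusion meets infinitely many requirements, but only finitely many at each stage;
  heredity allows these to be met one after another.\<close>

lemma finite_refine:
  assumes "finite \<S>"
    and ex: "\<And>s N. s \<in> \<S> \<Longrightarrow> infinite N \<Longrightarrow> N \<subseteq> M \<Longrightarrow> \<exists>N'\<subseteq>N. infinite N' \<and> Q s N'"
    and her: "\<And>s N N'. Q s N \<Longrightarrow> N' \<subseteq> N \<Longrightarrow> infinite N' \<Longrightarrow> Q s N'"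
    and N: "infinite N" "N \<subseteq> M"
  shows "\<exists>N'\<subseteq>N. infinite N' \<and> (\<forall>s\<in>\<S>. Q s N')"
  using assms(1) ex
proof (induction rule: finite_induct)
  case empty
  then show ?case using N by auto
next
  case (insert s \<S>)
  obtain N1 where N1: "N1 \<subseteq> N" "infinite N1" "\<forall>s\<in>\<S>. Q s N1"
    using insert.IH insert.prems by (metis insertI2)
  obtain N2 where "N2 \<subseteq> N1" "infinite N2" "Q s N2"
    using insert.prems[of s N1] N1 N by auto
  then show ?case using N1 her by (intro exI[of _ N2]) blast
qed

text \<open>The bound on cardinalities says that the part of \<open>L\<close> above \<open>s\<close> sits in \<open>N\<close> at positions that are
  at least as large as in \<open>L\<close>.\<close>

lemma fusion:
  fixes Q :: "nat set \<Rightarrow> nat set \<Rightarrow> bool"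
  assumes M: "infinite M"
    and ex: "\<And>s N. finite s \<Longrightarrow> infinite N \<Longrightarrow> N \<subseteq> M \<Longrightarrow> \<exists>N'\<subseteq>N. infinite N' \<and> Q s N'"
    and her: "\<And>s N N'. Q s N \<Longrightarrow> N' \<subseteq> N \<Longrightarrow> infinite N' \<Longrightarrow> Q s N'"
  obtains L where "infinite L" "L \<subseteq> M"
    "\<And>s. finite s \<Longrightarrow> s \<subseteq> L \<Longrightarrow> \<exists>N\<subseteq>M. infinite N \<and> Q s N \<and>
       (\<forall>n\<in>beyond s L. n \<in> N \<and> card (L \<inter> {..<n}) \<le> card (N \<inter> {..<n}))"
proof -
  obtain N0 where N0: "N0 \<subseteq> M" "infinite N0" "Q {} N0"
    using ex[of "{}" M] M by auto
  define P where "P n p = (case p of (N, l) \<Rightarrow> N \<subseteq> N0 \<and> infinite N \<and> l \<in> N \<and>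
      (n = 0 \<longrightarrow> l = enumerate N 0))" for n :: nat and p :: "nat set \<times> nat"
  \<comment> \<open>\<open>Q\<close> is imposed for all subsets of \<open>{..l}\<close>, so the pair
    carries no record of the points chosen before. The next point has index \<open>Suc l\<close> in
    \<open>N'\<close>: exactly l + 1 elements of \<open>N'\<close> lie below it, and at most that
    many of \<open>L\<close>, since the earlier points are at most l.\<close>
  define R where "R n p p' = (case p of (N, l) \<Rightarrow> case p' of (N', l') \<Rightarrow> N' \<subseteq> N \<and>
      (\<forall>s\<in>Pow {..l}. Q s N') \<and> l' = enumerate N' (Suc l))" for n :: nat and p p' :: "nat set \<times> nat"
  have "\<exists>f. \<forall>n. P n (f n) \<and> R n (f n) (f (Suc n))"
  proof (rule dependent_nat_choice)
    show "\<exists>x. P 0 x"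
      unfolding P_def using N0 by (intro exI[of _ "(N0, enumerate N0 0)"]) (auto simp: enumerate_in_set)
    fix x n assume "P n x"
    then obtain N l where x: "x = (N, l)" "N \<subseteq> N0" "infinite N" "l \<in> N" unfolding P_def by auto
    have "\<exists>N'\<subseteq>N. infinite N' \<and> (\<forall>s\<in>Pow {..l}. Q s N')"
    proof (rule finite_refine[where M = M])
      show "\<exists>N'\<subseteq>N. infinite N' \<and> Q s N'" if "s \<in> Pow {..l}" "infinite N" "N \<subseteq> M" for s N
        using that ex finite_subset[of s "{..l}"] by auto
      show "Q s N'" if "Q s N" "N' \<subseteq> N" "infinite N'" for s N N' using that her by blast
    qed (use x N0 in auto)
    then obtain N' where N': "N' \<subseteq> N" "infinite N'" "\<forall>s\<in>Pow {..l}. Q s N'" by blast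
    then show "\<exists>y. P (Suc n) y \<and> R n x y"
      unfolding P_def R_def using x
      by (intro exI[of _ "(N', enumerate N' (Suc l))"]) (auto simp: enumerate_in_set)
  qed
  then obtain f where f: "\<And>n. P n (f n)" "\<And>n. R n (f n) (f (Suc n))" by blast
  define N l where "N n = fst (f n)" and "l n = snd (f n)" for n
  have N: "N n \<subseteq> N0" "infinite (N n)" "l n \<in> N n" for n
    using f(1)[of n] unfolding P_def N_def l_def by (auto split: prod.splits)
  have l0: "l 0 = enumerate (N 0) 0"
    using f(1)[of 0] unfolding P_def N_def l_def by (auto split: prod.splits)
  have S: "N (Suc n) \<subseteq> N n" "\<And>s. s \<subseteq> {..l n} \<Longrightarrow> Q s (N (Suc n))"
    "l (Suc n) = enumerate (N (Suc n)) (Suc (l n))" for n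
    using f(2)[of n] unfolding R_def N_def l_def by (auto split: prod.splits)
  have dec: "m \<le> n \<Longrightarrow> N n \<subseteq> N m" for m n
    using lift_Suc_antimono_le[of N] S(1) by blast
  have "l n < l (Suc n)" for n
    unfolding S(3) using le_enumerate[OF N(2)] Suc_le_eq by blast
  then have sm: "strict_mono l" by (simp add: strict_mono_Suc_iff)
  define L where "L = range l"
  have cardL: "card (L \<inter> {..<l n}) \<le> card (N n \<inter> {..<l n})" for n
  proof (cases n)
    case 0
    have "L \<inter> {..<l 0} = {}" using sm by (auto simp: L_def strict_mono_less)
    then show ?thesis using 0 by simp
  next
    case (Suc m)
    have "L \<inter> {..<l (Suc m)} \<subseteq> {..l m}"
      using sm by (auto simp: L_def strict_mono_less strict_mono_less_eq less_Suc_eq_le)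
    then have "card (L \<inter> {..<l (Suc m)}) \<le> Suc (l m)"
      using card_mono[of "{..l m}"] by fastforce
    also have "\<dots> = card (N (Suc m) \<inter> {..<l (Suc m)})"
      unfolding S(3) using card_initial_enumerate[OF N(2)] by simp
    finally show ?thesis using Suc by simp
  qed
  have key: "n \<in> N m \<and> card (L \<inter> {..<n}) \<le> card (N m \<inter> {..<n})" if "n = l k" "m \<le> k" for n m k
  proof
    show "n \<in> N m" using that N(3)[of k] dec[of m k] by auto
    have "card (L \<inter> {..<n}) \<le> card (N k \<inter> {..<n})" using cardL[of k] that by simp
    also have "\<dots> \<le> card (N m \<inter> {..<n})" using dec[OF that(2)] by (intro card_mono) auto
    finally show "card (L \<inter> {..<n}) \<le> card (N m \<inter> {..<n})" .
  qed
  show ?thesis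
  proof
    show "infinite L" unfolding L_def using sm by (simp add: range_inj_infinite strict_mono_imp_inj_on)
    show "L \<subseteq> M" unfolding L_def using N N0 by blast
    fix s assume s: "finite s" "s \<subseteq> L"
    show "\<exists>N\<subseteq>M. infinite N \<and> Q s N \<and>
       (\<forall>n\<in>beyond s L. n \<in> N \<and> card (L \<inter> {..<n}) \<le> card (N \<inter> {..<n}))"
    proof (cases "s = {}")
      case True
      have "n \<in> N 0 \<and> card (L \<inter> {..<n}) \<le> card (N 0 \<inter> {..<n})" if "n \<in> L" for n
        using that key unfolding L_def by blast
      moreover have "Q s (N 0)" using N0(3) N her True by blast
      ultimately show ?thesis using N[of 0] N0 by (intro exI[of _ "N 0"]) (auto simp: beyond_def)
    next
      case False
      obtain k where k: "Max s = l k" using s False Max_in[of s] unfolding L_def by blast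
      have "Q s (N (Suc k))" using s k S(2) by (metis Max_ge atMost_iff subsetI)
      moreover have "n \<in> N (Suc k) \<and> card (L \<inter> {..<n}) \<le> card (N (Suc k) \<inter> {..<n})"
        if n: "n \<in> beyond s L" for n
      proof -
        obtain j where j: "n = l j" using n unfolding beyond_def L_def by blast
        have "l k < l j" using n j k Max_in[OF s(1) False] unfolding beyond_def by auto
        then show ?thesis using j key[of n j "Suc k"] sm by (simp add: strict_mono_less)
      qed
      ultimately show ?thesis using N[of "Suc k"] N0 by (intro exI[of _ "N (Suc k)"]) auto
    qed
  qed
qed

lemma fusion_beyond:
  fixes Q :: "nat set \<Rightarrow> nat set \<Rightarrow> bool"
  assumes M: "infinite M"
    and ex: "\<And>s N. finite s \<Longrightarrow> infinite N \<Longrightarrow> N \<subseteq> M \<Longrightarrow> \<exists>N'\<subseteq>N. infinite N' \<and> Q s N'"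
    and her: "\<And>s N N'. Q s N \<Longrightarrow> N' \<subseteq> N \<Longrightarrow> infinite N' \<Longrightarrow> Q s N'"
  obtains L where "infinite L" "L \<subseteq> M" "\<And>s. finite s \<Longrightarrow> s \<subseteq> L \<Longrightarrow> Q s (beyond s L)"
proof (rule fusion[where Q = Q, OF M ex her])
  fix L
  assume L: "infinite L" "L \<subseteq> M"
    "\<And>s. finite s \<Longrightarrow> s \<subseteq> L \<Longrightarrow> \<exists>N\<subseteq>M. infinite N \<and> Q s N \<and>
       (\<forall>n\<in>beyond s L. n \<in> N \<and> card (L \<inter> {..<n}) \<le> card (N \<inter> {..<n}))"
  have "Q s (beyond s L)" if s: "finite s" "s \<subseteq> L" for s
  proof -
    obtain N where "Q s N" "beyond s L \<subseteq> N" using L(3)[OF s] by blast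
    then show ?thesis using her infinite_beyond s L by blast
  qed
  then show thesis using that L by blast
qed

text \<open>Combinatorial forcing, with \<open>acc s N\<close> for acceptance of \<open>s\<close> by
  \<open>N\<close>. A first fusion makes \<open>L\<close> decide every finite subset. If
  \<open>L\<close> rejects the empty set, a second fusion makes rejection pass from a set to its end
  extensions by one point, hence to all finite subsets, and a set in \<open>B\<close> is never
  rejected.\<close>

lemma galvin:
  fixes B :: "nat set \<Rightarrow> bool"
  assumes M: "infinite M"
  obtains N where "infinite N" "N \<subseteq> M" "\<And>s. finite s \<Longrightarrow> s \<subseteq> N \<Longrightarrow> \<not> B s"
  | N where "infinite N" "N \<subseteq> M" "\<And>P. infinite P \<Longrightarrow> P \<subseteq> N \<Longrightarrow> \<exists>n. B (P \<inter> {..<n})"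
proof -
  define acc where "acc s N \<longleftrightarrow>
      (\<forall>P. infinite P \<and> P \<subseteq> beyond s N \<longrightarrow> (\<exists>n. B ((s \<union> P) \<inter> {..<n})))" for s N :: "nat set"
  have acc_mono: "acc s N'" if "acc s N" "beyond s N' \<subseteq> N" for s N N'
    using that unfolding acc_def beyond_def by blast
  define D where "D s N \<longleftrightarrow> acc s N \<or> (\<forall>N'\<subseteq>N. infinite N' \<longrightarrow> \<not> acc s N')" for s N :: "nat set"
  obtain L where L: "infinite L" "L \<subseteq> M" "\<And>s. finite s \<Longrightarrow> s \<subseteq> L \<Longrightarrow> D s (beyond s L)"
  proof (rule fusion_beyond[where Q = D, OF M])
    show "\<exists>N'\<subseteq>N. infinite N' \<and> D s N'" if "infinite N" for s N
      using that unfolding D_def by (metis order_refl subset_trans)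
    show "D s N'" if "D s N" "N' \<subseteq> N" for s N N'
      using that acc_mono beyond_subset unfolding D_def by (meson subset_trans)
  qed auto
  have dec: "\<not> acc s N" if "\<not> acc s L" "finite s" "s \<subseteq> L" "N \<subseteq> L" "infinite N" for s N
  proof
    assume "acc s N"
    then have "acc s (beyond s N)" using acc_mono beyond_subset by (meson subset_trans)
    moreover have "beyond s N \<subseteq> beyond s L" using that by (auto simp: beyond_def)
    ultimately have "acc s (beyond s L)"
      using L(3)[OF that(2,3)] infinite_beyond[OF that(2,5)] unfolding D_def by blast
    then show False using that(1) acc_mono[of s "beyond s L" L] by simp
  qed
  show ?thesis
  proof (cases "acc {} L")
    case True
    then show ?thesis using that(2)[OF L(1,2)] unfolding acc_def beyond_def by auto
  next
    case False
    define Q where "Q s N \<longleftrightarrow> (s \<subseteq> L \<and> \<not> acc s L \<longrightarrow>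
        (\<forall>n\<in>beyond s N. \<not> acc (insert n s) L))" for s N :: "nat set"
    obtain N where N: "infinite N" "N \<subseteq> L" "\<And>s. finite s \<Longrightarrow> s \<subseteq> N \<Longrightarrow> Q s (beyond s N)"
    proof (rule fusion_beyond[where Q = Q, OF L(1)])
      show "Q s N'" if "Q s N" "N' \<subseteq> N" for s N N'
        using that unfolding Q_def beyond_def by blast
      fix s N :: "nat set" assume s: "finite s" and N: "infinite N" "N \<subseteq> L"
      show "\<exists>N'\<subseteq>N. infinite N' \<and> Q s N'"
      proof (cases "s \<subseteq> L \<and> \<not> acc s L")
        case True
        define I where "I = {n \<in> beyond s N. acc (insert n s) L}"
        \<comment> \<open>If infinitely many \<open>n\<close> had \<open>insert n s\<close>
          accepted, these would form a set accepting \<open>s\<close>: any \<open>P\<close> in it is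
          split at its minimum \<open>n\<close>, and \<open>P - {n}\<close> is a continuation of
          \<open>insert n s\<close>.\<close>
        have "finite I"
        proof (rule ccontr)
          assume I: "infinite I"
          have "acc s I" unfolding acc_def
          proof (intro allI impI, elim conjE)
            fix P assume P: "infinite P" "P \<subseteq> beyond s I"
            define n where "n = Inf P"
            have n: "n \<in> P" using P Inf_nat_def1[of P] unfolding n_def by auto
            then have "acc (insert n s) L" using P unfolding I_def beyond_def by auto
            moreover have "infinite (P - {n})" "P - {n} \<subseteq> beyond (insert n s) L"
              using P N cInf_lower[of _ P] unfolding beyond_def n_def I_def
              by (auto simp: nat_less_le subset_iff)
            ultimately have "\<exists>m. B ((insert n s \<union> (P - {n})) \<inter> {..<m})" unfolding acc_def by blast
            moreover have "insert n s \<union> (P - {n}) = s \<union> P" using n by auto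
            ultimately show "\<exists>m. B ((s \<union> P) \<inter> {..<m})" by simp
          qed
          moreover have "I \<subseteq> L" using N unfolding I_def beyond_def by auto
          ultimately show False using dec[of s I] True s I by blast
        qed
        then show ?thesis using N unfolding Q_def I_def
          by (intro exI[of _ "N - I"]) (auto simp: I_def beyond_def)
      qed (use N in \<open>auto simp: Q_def\<close>)
    qed auto
    have rej: "\<not> acc s L" if "finite s" "s \<subseteq> N" for s
      using that
    proof (induction s rule: finite_linorder_max_induct)
      case empty
      then show ?case using False by simp
    next
      case (insert b A)
      then have "Q A (beyond A N)" using N(3) by auto
      then show ?case using insert N unfolding Q_def beyond_def by auto
    qed
    show ?thesis
    proof (rule that(1))
      fix s assume s: "finite s" "s \<subseteq> N"
      show "\<not> B s"
      proof
        assume B: "B s"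
        \<comment> \<open>Cutting \<open>s \<union> P\<close> at the minimum of \<open>P\<close>
          leaves \<open>s\<close> itself.\<close>
        have "acc s L" unfolding acc_def
        proof (intro allI impI, elim conjE)
          fix P assume P: "infinite P" "P \<subseteq> beyond s L"
          obtain n where n: "n \<in> P" using P by fastforce
          have "(s \<union> P) \<inter> {..<Inf P} = s"
            using P n Inf_nat_def1[of P] cInf_lower[of _ P] by (auto simp: beyond_def) (metis leD)
          then show "\<exists>n. B ((s \<union> P) \<inter> {..<n})" using B by metis
        qed
        then show False using rej s by blast
      qed
    qed (use N L in auto)
  qed
qed

section \<open>Schreier families\<close>

definition spread :: "nat set \<Rightarrow> nat set \<Rightarrow> bool" where
  "spread F F' \<longleftrightarrow> (\<exists>h. strict_mono_on F h \<and> (\<forall>i\<in>F. i \<le> h i) \<and> F' = h ` F)"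

lemma elt_in: "infinite N \<Longrightarrow> elt N i \<in> N"
  by (simp add: elt_def enumerate_in_set)

lemma elt_less: "infinite N \<Longrightarrow> 1 \<le> i \<Longrightarrow> i < j \<Longrightarrow> elt N i < elt N j"
  by (simp add: elt_def diff_less_mono)

lemma elt_less_iff: "infinite N \<Longrightarrow> 1 \<le> i \<Longrightarrow> 1 \<le> j \<Longrightarrow> elt N i < elt N j \<longleftrightarrow> i < j"
  by (metis elt_less linorder_neqE_nat not_less_iff_gr_or_eq)

lemma inj_on_elt: "infinite N \<Longrightarrow> F \<subseteq> {1..} \<Longrightarrow> inj_on (elt N) F"
  by (intro inj_onI) (metis atLeast_iff elt_less_iff nat_neq_iff subsetD)

lemma card_below_elt: "infinite N \<Longrightarrow> card (N \<inter> {..<elt N i}) = i - 1"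
  by (simp add: elt_def card_initial_enumerate)

lemma elt_Suc_card:
  assumes "infinite N" "n \<in> N"
  shows "elt N (Suc (card (N \<inter> {..<n}))) = n"
proof -
  obtain k where "enumerate N k = n" using enumerate_Ex assms by blast
  then show ?thesis using assms card_initial_enumerate[of N k] by (simp add: elt_def)
qed

text \<open>The new index of the i-th point of \<open>L\<close> is its position in \<open>N\<close>,
  which is at least i because \<open>N\<close> has no fewer points below it. The points indexed by
  \<open>F\<close> alone are compared, the form in which \<open>fusion\<close> delivers
  them.\<close>

lemma elt_image_spread:
  assumes N: "infinite N" and L: "infinite L" and F: "F \<subseteq> {1..}"
    and pos: "\<And>i. i \<in> F \<Longrightarrow>
      elt L i \<in> N \<and> card (L \<inter> {..<elt L i}) \<le> card (N \<inter> {..<elt L i})"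
  obtains F' where "spread F F'" "elt L ` F = elt N ` F'"
proof -
  define h where "h i = Suc (card (N \<inter> {..<elt L i}))" for i
  have "strict_mono_on F h"
  proof (rule strict_mono_onI)
    fix i j assume ij: "i \<in> F" "j \<in> F" "i < j"
    then have "elt L i < elt L j" using elt_less[OF L] F by auto
    then have "N \<inter> {..<elt L i} \<subset> N \<inter> {..<elt L j}" using pos[OF ij(1)] by auto
    then show "h i < h j" unfolding h_def using psubset_card_mono by (metis Suc_mono finite_Int finite_lessThan)
  qed
  moreover have "i \<le> h i" if "i \<in> F" for i
    using pos[OF that] card_below_elt[OF L, of i] unfolding h_def by linarith
  ultimately have "spread F (h ` F)" unfolding spread_def by blast
  moreover have "elt L ` F = elt N ` (h ` F)"
    using elt_Suc_card[OF N] pos unfolding h_def image_image by (intro image_cong) auto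
  ultimately show ?thesis using that by blast
qed

lemma elt_image_spread_subset:
  assumes "infinite N" "infinite L" "L \<subseteq> N" "F \<subseteq> {1..}"
  obtains F' where "spread F F'" "elt L ` F = elt N ` F'"
proof (rule elt_image_spread[OF assms(1,2,4)])
  show "elt L i \<in> N \<and> card (L \<inter> {..<elt L i}) \<le> card (N \<inter> {..<elt L i})" for i
    using assms elt_in by (auto intro!: card_mono)
qed

text \<open>Empty pieces are allowed, so for a family containing the empty set these are the unions
  of at most n successive members. This keeps the notion closed under subsets, and the recursion
  splits off the first piece, as the induction on the number of averages does.\<close>

fun blocks :: "nat set set \<Rightarrow> nat \<Rightarrow> nat set set" where
  "blocks \<S> 0 = {{}}"
| "blocks \<S> (Suc n) = {A \<union> B |A B. A \<in> \<S> \<and> B \<in> blocks \<S> n \<and> (\<forall>a\<in>A. \<forall>b\<in>B. a < b)}"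

lemma blocks_subset_closed:
  assumes "\<And>F G. F \<in> \<S> \<Longrightarrow> G \<subseteq> F \<Longrightarrow> G \<in> \<S>"
  shows "F \<in> blocks \<S> n \<Longrightarrow> G \<subseteq> F \<Longrightarrow> G \<in> blocks \<S> n"
proof (induction n arbitrary: F G)
  case (Suc n)
  then obtain A B where AB: "F = A \<union> B" "A \<in> \<S>" "B \<in> blocks \<S> n" "\<forall>a\<in>A. \<forall>b\<in>B. a < b"
    by auto
  have "G = (G \<inter> A) \<union> (G \<inter> B)" "G \<inter> A \<in> \<S>" "G \<inter> B \<in> blocks \<S> n"
    "\<forall>a\<in>G \<inter> A. \<forall>b\<in>G \<inter> B. a < b"
    using AB Suc.prems Suc.IH[OF AB(3)] assms[OF AB(2)] by auto
  then show ?case unfolding blocks.simps by blast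
qed auto

lemma blocks_spread_closed:
  assumes "\<And>F G. F \<in> \<S> \<Longrightarrow> spread F G \<Longrightarrow> G \<in> \<S>"
  shows "F \<in> blocks \<S> n \<Longrightarrow> spread F G \<Longrightarrow> G \<in> blocks \<S> n"
proof (induction n arbitrary: F G)
  case 0
  then show ?case by (auto simp: spread_def)
next
  case (Suc n)
  then obtain A B where AB: "F = A \<union> B" "A \<in> \<S>" "B \<in> blocks \<S> n" "\<forall>a\<in>A. \<forall>b\<in>B. a < b"
    by auto
  obtain h where h: "strict_mono_on F h" "\<forall>i\<in>F. i \<le> h i" "G = h ` F"
    using Suc.prems unfolding spread_def by blast
  have sub: "spread A (h ` A)" "spread B (h ` B)"
    using h AB(1) unfolding spread_def by (auto intro!: exI[of _ h] simp: strict_mono_on_def)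
  have "G = h ` A \<union> h ` B" using h AB by auto
  moreover have "\<forall>a\<in>h ` A. \<forall>b\<in>h ` B. a < b" using h(1) AB unfolding strict_mono_on_def by auto
  ultimately show ?case
    using assms[OF AB(2) sub(1)] Suc.IH[OF AB(3) sub(2)] unfolding blocks.simps by blast
qed

lemma blocks_finite:
  assumes "\<And>F. F \<in> \<S> \<Longrightarrow> finite F \<and> F \<subseteq> {1..}"
  shows "F \<in> blocks \<S> n \<Longrightarrow> finite F \<and> F \<subseteq> {1..}"
proof (induction n arbitrary: F)
  case (Suc n)
  then obtain A B where "F = A \<union> B" "A \<in> \<S>" "B \<in> blocks \<S> n" by auto
  then show ?case using assms Suc.IH by simp
qed auto

lemma Union_in_blocks:
  assumes "\<And>i. i \<in> {1..n} \<Longrightarrow> F i \<in> \<S> \<and> F i \<noteq> {} \<and> finite (F i)"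
    and "\<And>i. i \<in> {1..<n} \<Longrightarrow> Max (F i) < Min (F (i + 1))"
  shows "\<Union>(F ` {1..n}) \<in> blocks \<S> n \<and> (\<forall>x\<in>\<Union>(F ` {1..n}). Min (F 1) \<le> x)"
  using assms
proof (induction n arbitrary: F)
  case (Suc n)
  define G where "G = (\<lambda>i. F (Suc i))"
  have IH: "\<Union>(G ` {1..n}) \<in> blocks \<S> n \<and> (\<forall>x\<in>\<Union>(G ` {1..n}). Min (G 1) \<le> x)"
    by (rule Suc.IH) (use Suc.prems in \<open>auto simp: G_def\<close>)
  have "{1..Suc n} = insert 1 (Suc ` {1..n})"
    by (simp add: atLeastAtMost_insertL[symmetric] image_Suc_atLeastAtMost)
  then have U: "\<Union>(F ` {1..Suc n}) = F 1 \<union> \<Union>(G ` {1..n})"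
    by (simp only: image_insert Union_insert image_image G_def)
  have 1: "F 1 \<in> \<S>" "F 1 \<noteq> {}" "finite (F 1)" using Suc.prems(1)[of 1] by auto
  have lt: "a < b" if "a \<in> F 1" "b \<in> \<Union>(G ` {1..n})" for a b
  proof -
    have "1 \<le> n" using that by (cases n) auto
    then have "Max (F 1) < Min (G 1)" using Suc.prems(2)[of 1] by (simp add: G_def)
    moreover have "a \<le> Max (F 1)" "Min (G 1) \<le> b" using that 1 IH by auto
    ultimately show ?thesis by linarith
  qed
  have "\<forall>x\<in>\<Union>(F ` {1..Suc n}). Min (F 1) \<le> x"
    unfolding U using 1 lt[of "Min (F 1)"] Min_in[OF 1(3,2)] by (metis Min_le UnE less_imp_le)
  moreover have "\<Union>(F ` {1..Suc n}) \<in> blocks \<S> (Suc n)"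
    unfolding U blocks.simps using 1 IH lt by blast
  ultimately show ?case by blast
qed auto

lemma blocks_imp_Union:
  assumes "F \<in> blocks \<S> n" "\<And>F. F \<in> \<S> \<Longrightarrow> finite F"
  shows "\<exists>k G. k \<le> n \<and> F = \<Union>(G ` {1..k}) \<and> (\<forall>i\<in>{1..k}. G i \<in> \<S> \<and> G i \<noteq> {}) \<and>
    (\<forall>i\<in>{1..<k}. Max (G i) < Min (G (i + 1)))"
  using assms(1)
proof (induction n arbitrary: F)
  case 0
  then show ?case by auto
next
  case (Suc n)
  then obtain A B where AB: "F = A \<union> B" "A \<in> \<S>" "B \<in> blocks \<S> n" "\<forall>a\<in>A. \<forall>b\<in>B. a < b"
    by auto
  obtain k G where G: "k \<le> n" "B = \<Union>(G ` {1..k})" "\<forall>i\<in>{1..k}. G i \<in> \<S> \<and> G i \<noteq> {}"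
    "\<forall>i\<in>{1..<k}. Max (G i) < Min (G (i + 1))"
    using Suc.IH[OF AB(3)] by blast
  show ?case
  proof (cases "A = {}")
    case True
    then show ?thesis using AB G by (intro exI[of _ k] exI[of _ G]) auto
  next
    case False
    define H where "H i = (if i = 1 then A else G (i - 1))" for i :: nat
    have "{1..Suc k} = insert 1 (Suc ` {1..k})"
      by (simp add: atLeastAtMost_insertL[symmetric] image_Suc_atLeastAtMost)
    then have "\<Union>(H ` {1..Suc k}) = H 1 \<union> (\<Union>i\<in>{1..k}. H (Suc i))"
      by (simp only: image_insert Union_insert image_image)
    then have "F = \<Union>(H ` {1..Suc k})" unfolding AB(1) G(2) by (simp add: H_def)
    moreover have "H i \<in> \<S> \<and> H i \<noteq> {}" if "i \<in> {1..Suc k}" for i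
    proof (cases "i = 1")
      case False
      then have "i - 1 \<in> {1..k}" using that by auto
      then show ?thesis using G(3) False unfolding H_def by simp
    qed (use False AB in \<open>simp add: H_def\<close>)
    moreover have "Max (H i) < Min (H (i + 1))" if i: "i \<in> {1..<Suc k}" for i
    proof (cases "i = 1")
      case True
      then have "G 1 \<in> \<S>" "G 1 \<noteq> {}" "G 1 \<subseteq> B" using G i by auto
      then have "Max A < Min (G 1)" using AB False assms(2) by (simp add: subset_iff)
      then show ?thesis using True by (simp add: H_def)
    next
      case False
      then have "i - 1 \<in> {1..<k}" using i by auto
      then have "Max (G (i - 1)) < Min (G (i - 1 + 1))" using G(4) by blast
      then show ?thesis using False i by (auto simp: H_def)
    qed
    ultimately show ?thesis using G(1) by (intro exI[of _ "Suc k"] exI[of _ H]) auto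
  qed
qed

section \<open>Heredity, spreading and comparison of Schreier families\<close>

lemma omega1_cases:
  obtains "a = 0" | b where "a = osuc b" | "is_limit a"
  unfolding is_limit_def is_succ_def by blast

context ladder_system
begin

lemma empty_in_schreier: "{} \<in> schreier a"
  by (cases a rule: omega1_cases) (simp_all add: schreier_0 schreier_osuc schreier_limit)

lemma schreier_finite: "F \<in> schreier a \<Longrightarrow> finite F \<and> F \<subseteq> {1..}"
proof (induction a arbitrary: F rule: less_induct)
  case (less a)
  show ?case
  proof (cases a rule: omega1_cases)
    case 1
    then show ?thesis using less.prems by (auto simp: schreier_0)
  next
    case (2 b)
    then show ?thesis
      using less.prems less.IH[OF less_osuc[of b, folded 2]] by (auto simp: schreier_osuc; blast)
  next
    case 3
    then show ?thesis using less.prems by (auto simp: schreier_limit)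
  qed
qed

text \<open>Discarding empty pieces only lowers their number, so the bound of this number by the
  minimum survives. All later arguments about successors use this form.\<close>

lemma schreier_osuc_blocks:
  "F \<in> schreier (osuc b) \<longleftrightarrow> F = {} \<or> (\<exists>n\<ge>1. F \<in> blocks (schreier b) n \<and> (\<forall>i\<in>F. n \<le> i))"
  (is "_ \<longleftrightarrow> ?R")
proof
  assume "F \<in> schreier (osuc b)"
  then consider "F = {}" | n G where "F = \<Union>(G ` {1..n})" "1 \<le> n"
      "\<forall>i\<in>{1..n}. G i \<in> schreier b \<and> G i \<noteq> {}" "n \<le> Min (G 1)"
      "\<forall>i\<in>{1..<n}. Max (G i) < Min (G (i + 1))"
    unfolding schreier_osuc by blast
  then show ?R
  proof cases
    case 2
    have "\<Union>(G ` {1..n}) \<in> blocks (schreier b) n \<and> (\<forall>x\<in>\<Union>(G ` {1..n}). Min (G 1) \<le> x)"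
      by (rule Union_in_blocks) (use 2 schreier_finite[of _ b] in auto)
    then show ?thesis using 2 by (auto intro!: exI[of _ n] order_trans[OF 2(4)])
  qed simp
next
  assume ?R
  moreover have "F \<in> schreier (osuc b)"
    if F: "F \<noteq> {}" "n \<ge> 1" "F \<in> blocks (schreier b) n" "\<forall>i\<in>F. n \<le> i" for n
  proof -
    obtain k G where G: "k \<le> n" "F = \<Union>(G ` {1..k})" "\<forall>i\<in>{1..k}. G i \<in> schreier b \<and> G i \<noteq> {}"
      "\<forall>i\<in>{1..<k}. Max (G i) < Min (G (i + 1))"
      using blocks_imp_Union[OF F(3)] schreier_finite by metis
    have k: "1 \<le> k" using F(1) G(2) by (cases k) auto
    then have "G 1 \<in> schreier b" "G 1 \<noteq> {}" using G(3) by auto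
    then have "Min (G 1) \<in> G 1" using schreier_finite Min_in by blast
    then have "Min (G 1) \<in> F" using G(2) k by auto
    then have "k \<le> Min (G 1)" using F(4) G(1) by auto
    then show ?thesis using G k unfolding schreier_osuc by blast
  qed
  ultimately show "F \<in> schreier (osuc b)" using empty_in_schreier by blast
qed

lemma schreier_limit_iff:
  assumes "is_limit a"
  shows "F \<in> schreier a \<longleftrightarrow> F = {} \<or> (\<exists>n\<ge>1. F \<in> schreier (c a n) \<and> (\<forall>i\<in>F. n \<le> i))"
proof -
  have "n \<le> Min F \<longleftrightarrow> (\<forall>i\<in>F. n \<le> i)" if "F \<in> schreier (c a n)" "F \<noteq> {}" for n
    using that schreier_finite by (simp add: Min_ge_iff)
  then show ?thesis unfolding schreier_limit[OF assms] using schreier_finite by blast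
qed

lemma schreier_subset: "F \<in> schreier a \<Longrightarrow> G \<subseteq> F \<Longrightarrow> G \<in> schreier a"
proof (induction a arbitrary: F G rule: less_induct)
  case (less a)
  show ?case
  proof (cases a rule: omega1_cases)
    case 1
    then show ?thesis using less.prems by (auto simp: schreier_0)
  next
    case (2 b)
    then show ?thesis
      using less.prems less.IH[OF less_osuc[of b, folded 2]] blocks_subset_closed[of "schreier b" F]
      unfolding 2 schreier_osuc_blocks by blast
  next
    case 3
    then show ?thesis
      using less.prems less.IH[OF ladder_less[OF 3]] unfolding schreier_limit_iff[OF 3] by blast
  qed
qed

lemma schreier_spread: "F \<in> schreier a \<Longrightarrow> spread F G \<Longrightarrow> G \<in> schreier a"
proof (induction a arbitrary: F G rule: less_induct)
  case (less a)
  have G: "(F = {} \<longrightarrow> G = {}) \<and> ((\<forall>i\<in>F. n \<le> i) \<longrightarrow> (\<forall>i\<in>G. n \<le> i))" for n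
    using less.prems unfolding spread_def by (auto intro: order_trans)
  show ?case
  proof (cases a rule: omega1_cases)
    case 1
    then show ?thesis using less.prems by (auto simp: schreier_0 spread_def)
  next
    case (2 b)
    then show ?thesis
      using less.prems less.IH[OF less_osuc[of b, folded 2]] blocks_spread_closed[of "schreier b" F]
      using G unfolding 2 schreier_osuc_blocks by blast
  next
    case 3
    then show ?thesis
      using less.prems less.IH[OF ladder_less[OF 3]] G unfolding schreier_limit_iff[OF 3] by blast
  qed
qed

text \<open>At a successor a single block suffices. At a limit, membership through
  \<open>c b m\<close> needs a minimum of at least m, whence the threshold in the inclusion.\<close>

lemma schreier_eventually_subset:
  "a \<le> b \<Longrightarrow> \<exists>n. \<forall>F\<in>schreier a. (\<forall>i\<in>F. n \<le> i) \<longrightarrow> F \<in> schreier b"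
proof (induction b rule: less_induct)
  case (less b)
  show ?case
  proof (cases "a = b")
    case False
    then have ab: "a < b" using less.prems by simp
    show ?thesis
    proof (cases b rule: omega1_cases)
      case 1
      then show ?thesis using ab by (metis leD zero_le_omega1)
    next
      case (2 d)
      then have "a \<le> d" using ab osuc_leI[of d a] by (metis leD not_le_imp_less)
      then obtain n where n: "\<forall>F\<in>schreier a. (\<forall>i\<in>F. n \<le> i) \<longrightarrow> F \<in> schreier d"
        using less.IH[of d] less_osuc 2 by blast
      have "F \<in> schreier b" if "F \<in> schreier d" for F
      proof -
        have "F \<in> blocks (schreier d) 1" using that by auto
        then show ?thesis unfolding 2 schreier_osuc_blocks using schreier_finite[OF that] by fastforce
      qed
      then show ?thesis using n by blast
    next
      case 3
      then obtain m where m: "m \<ge> 1" "a < c b m" using ladder_cofinal ab by blast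
      then obtain n where n: "\<forall>F\<in>schreier a. (\<forall>i\<in>F. n \<le> i) \<longrightarrow> F \<in> schreier (c b m)"
        using less.IH[OF ladder_less[OF 3, of m]] less_imp_le by blast
      show ?thesis
        unfolding schreier_limit_iff[OF 3] using n m by (intro exI[of _ "max m n"]) auto
    qed
  qed blast
qed

end

section \<open>Repeated averages\<close>

definition initial :: "nat set \<Rightarrow> nat set \<Rightarrow> bool" where
  "initial s N \<longleftrightarrow> s \<subseteq> N \<and> (\<forall>n\<in>N - s. \<forall>a\<in>s. a < n)"

lemma Inf_initial:
  assumes "initial s N" "s \<noteq> {}"
  shows "Inf N = Inf s"
proof -
  have "Inf s \<in> s" using assms Inf_nat_def1 by blast
  moreover have "Inf s \<le> n" if "n \<in> N" for n
    using assms that cInf_lower[of n s] \<open>Inf s \<in> s\<close> unfolding initial_def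
    by (cases "n \<in> s") (auto intro: less_imp_le)
  ultimately show ?thesis using assms unfolding initial_def by (intro cInf_eq_minimum) auto
qed

lemma initial_Int_lessThan: "initial (N \<inter> {..<n}) N"
  by (auto simp: initial_def)

text \<open>\<open>avg_start\<close> recurses at its last step. Splitting off the first step instead
  shows that dropping the first average of a sequence amounts to averaging its tail.\<close>

lemma avg_start_shift:
  assumes "s = Min (supp (z 1))" "\<And>j. 1 \<le> j \<Longrightarrow> z' j = z (s + j)" "1 \<le> k"
  shows "avg_start z (Suc k) = s + avg_start z' k"
  using assms(3)
proof (induction k rule: dec_induct)
  case base
  then show ?case using assms(1) by simp
next
  case (step k)
  then obtain m where m: "k = Suc m" by (cases k) auto
  have "avg_start z (Suc (Suc k)) = avg_start z (Suc k) + Min (supp (z (avg_start z (Suc k) + 1)))"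
    by (simp only: avg_start.simps)
  also have "\<dots> = s + (avg_start z' k + Min (supp (z (s + (avg_start z' k + 1)))))"
    by (simp only: step.IH add.assoc)
  also have "z (s + (avg_start z' k + 1)) = z' (avg_start z' k + 1)" using assms(2) by simp
  also have "avg_start z' k + Min (supp (z' (avg_start z' k + 1))) = avg_start z' (Suc k)"
    unfolding m by (simp only: avg_start.simps)
  finally show ?case .
qed

lemma avg_succ_shift:
  assumes "s = Min (supp (z 1))" "\<And>j. 1 \<le> j \<Longrightarrow> z' j = z (s + j)" "1 \<le> k"
  shows "avg_succ z (Suc k) = avg_succ z' k"
proof -
  have "avg_length z (Suc k) = avg_length z' k"
    using assms(2)[of "avg_start z' k + 1"] avg_start_shift[OF assms] by (simp add: avg_length_def)
  moreover have "z (s + avg_start z' k + j) = z' (avg_start z' k + j)" if "1 \<le> j" for j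
    using assms(2) that by (simp add: add.assoc)
  ultimately show ?thesis using avg_start_shift[OF assms] by (simp add: avg_succ_def)
qed

lemma avg_rest_shift:
  "1 \<le> k \<Longrightarrow> avg_rest G M (Suc k) = avg_rest G (M - supp (G (Inf M) M)) k"
proof (induction k rule: dec_induct)
  case (step k)
  then obtain m where "k = Suc m" by (cases k) auto
  then show ?case using step by simp
qed simp

section \<open>The structure of a sequence of averages\<close>

context ladder_system
begin

abbreviation front :: "omega1 \<Rightarrow> nat set \<Rightarrow> nat set" where
  "front a M \<equiv> supp (RA a M 1)"

fun rest :: "omega1 \<Rightarrow> nat set \<Rightarrow> nat \<Rightarrow> nat set" where
  "rest a M 0 = M"
| "rest a M (Suc k) = rest a M k - front a (rest a M k)"

text \<open>The clauses are bundled because the successor step uses all of them for the preceding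
  order. The clause on \<open>N\<close> says that the support alone determines the first average;
  this is the continuity that Galvin's theorem requires.\<close>

definition RA_good :: "omega1 \<Rightarrow> bool" where
  "RA_good a \<longleftrightarrow> (\<forall>M\<in>infinite_subsets {1..}.
     finite (front a M) \<and> front a M \<noteq> {} \<and> initial (front a M) M \<and> front a M \<in> schreier a \<and>
     (\<forall>i. 0 \<le> RA a M 1 i) \<and> (\<Sum>i\<in>front a M. RA a M 1 i) = 1 \<and>
     (\<forall>N\<in>infinite_subsets {1..}. initial (front a M) N \<longrightarrow> RA a N 1 = RA a M 1) \<and>
     (\<forall>k\<ge>1. RA a M (Suc k) = RA a (M - front a M) k))"

lemma RA_goodD:
  assumes "RA_good a" "M \<in> infinite_subsets {1..}"
  shows "finite (front a M)" "front a M \<noteq> {}" "initial (front a M) M" "front a M \<in> schreier a"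
    "0 \<le> RA a M 1 i" "(\<Sum>i\<in>front a M. RA a M 1 i) = 1"
    "N \<in> infinite_subsets {1..} \<Longrightarrow> initial (front a M) N \<Longrightarrow> RA a N 1 = RA a M 1"
    "1 \<le> k \<Longrightarrow> RA a M (Suc k) = RA a (M - front a M) k"
  using assms unfolding RA_good_def by blast+

lemma rest_add: "rest a M (j + k) = rest a (rest a M j) k"
  by (induction k) auto

lemma rest_Suc': "rest a M (Suc k) = rest a (M - front a M) k"
  using rest_add[of a M 1 k] by simp

lemma rest_subset: "rest a M k \<subseteq> M"
  by (induction k) auto

lemma rest_mono: "j \<le> k \<Longrightarrow> rest a M k \<subseteq> rest a M j"
  using rest_add[of a M j "k - j"] rest_subset by auto

lemma good_rest:
  assumes "RA_good a" "M \<in> infinite_subsets {1..}"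
  shows "rest a M k \<in> infinite_subsets {1..}"
proof (induction k)
  case (Suc k)
  then show ?case using RA_goodD(1)[OF assms(1) Suc] by (auto simp: infinite_subsets_def)
qed (use assms in simp)

lemma good_finite_diff_rest:
  assumes "RA_good a" "M \<in> infinite_subsets {1..}"
  shows "finite (M - rest a M k)"
proof (induction k)
  case (Suc k)
  have "M - rest a M (Suc k) \<subseteq> (M - rest a M k) \<union> front a (rest a M k)" by auto
  then show ?case
    using Suc RA_goodD(1)[OF assms(1) good_rest[OF assms]] finite_subset by blast
qed simp

lemma good_initial_rest:
  assumes "RA_good a" "M \<in> infinite_subsets {1..}"
  shows "initial (M - rest a M k) M"
proof (induction k)
  case (Suc k)
  have "initial (front a (rest a M k)) (rest a M k)"
    using RA_goodD(3)[OF assms(1) good_rest[OF assms]] .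
  then show ?case using Suc rest_subset unfolding initial_def rest.simps by blast
qed (simp add: initial_def)

lemma good_RA_rest:
  assumes "RA_good a" "M \<in> infinite_subsets {1..}"
  shows "RA a M (Suc k) = RA a (rest a M k) 1"
  using assms(2)
proof (induction k arbitrary: M)
  case (Suc k)
  have "RA a M (Suc (Suc k)) = RA a (M - front a M) (Suc k)"
    using RA_goodD(8)[OF assms(1) Suc.prems] by simp
  also have "\<dots> = RA a (rest a (M - front a M) k) 1"
    using Suc.IH[of "M - front a M"] good_rest[OF assms(1) Suc.prems, of 1] by simp
  finally show ?case by (simp only: rest_Suc')
qed simp

lemma good_RA_add:
  assumes "RA_good a" "M \<in> infinite_subsets {1..}" "1 \<le> j"
  shows "RA a M (k + j) = RA a (rest a M k) j"
proof -
  obtain i where "j = Suc i" using assms(3) by (cases j) auto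
  then show ?thesis
    using good_RA_rest[OF assms(1,2), of "k + i"] good_RA_rest[OF assms(1) good_rest[OF assms(1,2)]]
    by (simp add: rest_add)
qed

lemma good_diff_rest:
  assumes "RA_good a" "M \<in> infinite_subsets {1..}"
  shows "M - rest a M k = (\<Union>j\<in>{1..k}. supp (RA a M j))"
proof (induction k)
  case (Suc k)
  have "front a (rest a M k) \<subseteq> rest a M k"
    using RA_goodD(3)[OF assms(1) good_rest[OF assms]] by (simp add: initial_def)
  then have "M - rest a M (Suc k) = (M - rest a M k) \<union> front a (rest a M k)"
    using rest_subset[of a M k] by auto
  also have "\<dots> = (\<Union>j\<in>{1..Suc k}. supp (RA a M j))"
    unfolding Suc good_RA_rest[OF assms, symmetric] by (auto simp: atLeastAtMostSuc_conv)
  finally show ?case .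
qed simp

text \<open>Continuity for the first k averages. The finite set \<open>M - rest a M k\<close>, the
  union of their supports, later serves as the code of \<open>M\<close> in
  \<open>RA_dichotomy\<close>.\<close>

lemma good_initial_cong:
  assumes a: "RA_good a" and M: "M \<in> infinite_subsets {1..}" and N: "N \<in> infinite_subsets {1..}"
    and "initial (M - rest a M k) N"
  shows "N - rest a N k = M - rest a M k \<and> (\<forall>j\<in>{1..k}. RA a N j = RA a M j)"
  using assms(4)
proof (induction k)
  case (Suc k)
  have fr: "front a (rest a M k) \<subseteq> rest a M k"
    using RA_goodD(3)[OF a good_rest[OF a M]] by (simp add: initial_def)
  have T: "M - rest a M (Suc k) = (M - rest a M k) \<union> front a (rest a M k)"
    using rest_subset[of a M k] fr by auto
  have "initial (M - rest a M k) N"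
    using Suc.prems good_initial_rest[OF a M, of k] fr rest_subset[of a M k]
    unfolding T initial_def by blast
  from Suc.IH[OF this] have IH: "N - rest a N k = M - rest a M k" "\<forall>j\<in>{1..k}. RA a N j = RA a M j"
    by auto
  have rN: "rest a N k = N - (M - rest a M k)" using IH(1) rest_subset[of a N k] by auto
  have "initial (front a (rest a M k)) (rest a N k)"
    using Suc.prems fr unfolding rN T initial_def by blast
  then have eq: "RA a (rest a N k) 1 = RA a (rest a M k) 1"
    using RA_goodD(7)[OF a good_rest[OF a M] good_rest[OF a N]] by blast
  then have "RA a N (Suc k) = RA a M (Suc k)"
    using good_RA_rest[OF a M] good_RA_rest[OF a N] by simp
  then have "\<forall>j\<in>{1..Suc k}. RA a N j = RA a M j" using IH by (auto simp: le_Suc_eq)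
  moreover have "N - rest a N (Suc k) = M - rest a M (Suc k)"
    unfolding T unfolding rest.simps eq using IH(1) rN fr Suc.prems unfolding T initial_def by blast
  ultimately show ?case by blast
qed auto

lemma good_diff_rest_blocks:
  assumes "RA_good a" "M \<in> infinite_subsets {1..}"
  shows "M - rest a M k \<in> blocks (schreier a) k"
  using assms(2)
proof (induction k arbitrary: M)
  case (Suc k)
  let ?M' = "M - front a M"
  have M': "?M' \<in> infinite_subsets {1..}" using good_rest[OF assms(1) Suc.prems, of 1] by simp
  have ini: "initial (front a M) M" using RA_goodD(3)[OF assms(1) Suc.prems] .
  have "M - rest a M (Suc k) = front a M \<union> (?M' - rest a ?M' k)"
    unfolding rest_Suc' using ini rest_subset[of a ?M' k] by (auto simp: initial_def)
  moreover have "\<forall>x\<in>front a M. \<forall>y\<in>?M' - rest a ?M' k. x < y"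
    using ini unfolding initial_def by blast
  ultimately show ?case
    using Suc.IH[OF M'] RA_goodD(4)[OF assms(1) Suc.prems] unfolding blocks.simps by blast
qed simp

lemma good_RA_nonneg:
  assumes "RA_good a" "M \<in> infinite_subsets {1..}" "1 \<le> j"
  shows "0 \<le> RA a M j i"
  using RA_goodD(5)[OF assms(1) good_rest[OF assms(1,2)]] good_RA_rest[OF assms(1,2), of "j - 1"] assms(3)
  by simp

lemma good_Min_front:
  assumes "RA_good a" "M \<in> infinite_subsets {1..}"
  shows "Min (front a M) = Inf M"
  using RA_goodD(1,2,3)[OF assms] Inf_initial by (simp add: cInf_eq_Min)

lemma Inf_ge_1: "M \<in> infinite_subsets {1..} \<Longrightarrow> 1 \<le> Inf M \<and> Inf M \<in> M"
  unfolding infinite_subsets_def using Inf_nat_def1[of M] by auto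

lemma RA_osuc_first:
  assumes "RA_good b" "M \<in> infinite_subsets {1..}"
  shows "RA (osuc b) M 1 i = 1 / real (Inf M) * (\<Sum>j = 1..Inf M. RA b M j i)"
  using good_Min_front[OF assms] by (simp add: RA_osuc avg_succ_def avg_length_def)

lemma RA_good_0: "RA_good 0"
  unfolding RA_good_def
proof
  fix M assume M: "M \<in> infinite_subsets {1..}"
  have e: "elt N 1 = Inf N" for N by (simp add: elt_def enumerate_0 Inf_nat_def)
  have f: "front 0 N = {Inf N}" for N by (auto simp: RA_0 supp_def e[simplified])
  have ini: "initial {Inf M} M"
    using Inf_ge_1[OF M] cInf_lower[of _ M] by (auto simp: initial_def nat_less_le)
  have R1: "RA 0 N 1 = (\<lambda>i. if i = Inf N then 1 else 0)" for N
    by (simp add: RA_0 e[simplified])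
  have "elt M (Suc k) = elt (M - {Inf M}) k" if "1 \<le> k" for k
    using that enumerate_Suc[of M "k - 1"] by (simp add: elt_def Inf_nat_def)
  then have "\<forall>k\<ge>1. RA 0 M (Suc k) = RA 0 (M - {Inf M}) k" by (simp add: RA_0)
  moreover have "RA 0 N 1 = RA 0 M 1" if "initial {Inf M} N" for N
    using Inf_initial[OF that] unfolding R1 by simp
  moreover have "(\<Sum>i\<in>{Inf M}. RA 0 M 1 i) = 1" "\<And>i. 0 \<le> RA 0 M 1 i"
    unfolding R1 by simp_all
  moreover have "{Inf M} \<in> schreier 0" using Inf_ge_1[OF M] by (auto simp: schreier_0)
  ultimately show "finite (front 0 M) \<and> front 0 M \<noteq> {} \<and> initial (front 0 M) M \<and>
     front 0 M \<in> schreier 0 \<and> (\<forall>i. 0 \<le> RA 0 M 1 i) \<and> (\<Sum>i\<in>front 0 M. RA 0 M 1 i) = 1 \<and>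
     (\<forall>N\<in>infinite_subsets {1..}. initial (front 0 M) N \<longrightarrow> RA 0 N 1 = RA 0 M 1) \<and>
     (\<forall>k\<ge>1. RA 0 M (Suc k) = RA 0 (M - front 0 M) k)"
    unfolding f using ini by blast
qed

lemma RA_good_osuc:
  assumes b: "RA_good b"
  shows "RA_good (osuc b)"
  unfolding RA_good_def
proof (intro ballI conjI allI impI)
  fix M assume M: "M \<in> infinite_subsets {1..}"
  define s where "s = Inf M"
  have s: "1 \<le> s" "s \<in> M" using Inf_ge_1[OF M] by (auto simp: s_def)
  have first: "RA (osuc b) M 1 i = 1 / real s * (\<Sum>j = 1..s. RA b M j i)" for i
    using RA_osuc_first[OF b M] by (simp add: s_def)
  have nn: "1 \<le> j \<Longrightarrow> 0 \<le> RA b M j i" for i j using good_RA_nonneg[OF b M] .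
  \<comment> \<open>Nonnegativity excludes cancellation, so the support of the mean is the union of
    the supports.\<close>
  have "(\<Sum>j = 1..s. RA b M j i) = 0 \<longleftrightarrow> (\<forall>j\<in>{1..s}. RA b M j i = 0)" for i
    by (intro sum_nonneg_eq_0_iff) (use nn in auto)
  then have "RA (osuc b) M 1 i \<noteq> 0 \<longleftrightarrow> (\<exists>j\<in>{1..s}. RA b M j i \<noteq> 0)" for i
    unfolding first using s by simp
  then have fr: "front (osuc b) M = M - rest b M s"
    unfolding good_diff_rest[OF b M] by (auto simp: supp_def)
  show "finite (front (osuc b) M)" unfolding fr using good_finite_diff_rest[OF b M] .
  show ini: "initial (front (osuc b) M) M" unfolding fr using good_initial_rest[OF b M] .
  have "front b M \<subseteq> M - rest b M s"
    unfolding good_diff_rest[OF b M] using s by auto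
  then show ne: "front (osuc b) M \<noteq> {}" unfolding fr using RA_goodD(2)[OF b M] by blast
  have "\<forall>i\<in>M - rest b M s. s \<le> i" unfolding s_def by (auto intro: cInf_lower)
  then show "front (osuc b) M \<in> schreier (osuc b)"
    unfolding fr schreier_osuc_blocks using good_diff_rest_blocks[OF b M] s by blast
  show "0 \<le> RA (osuc b) M 1 i" for i
    unfolding first by (intro mult_nonneg_nonneg sum_nonneg nn) auto
  have "(\<Sum>i\<in>M - rest b M s. RA b M j i) = 1" if j: "j \<in> {1..s}" for j
  proof -
    have "(\<Sum>i\<in>M - rest b M s. RA b M j i) = (\<Sum>i\<in>supp (RA b M j). RA b M j i)"
    proof (rule sum.mono_neutral_right[OF good_finite_diff_rest[OF b M]])
      show "supp (RA b M j) \<subseteq> M - rest b M s" unfolding good_diff_rest[OF b M] using j by blast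
    qed (simp add: supp_def)
    also have "\<dots> = 1"
      using good_RA_rest[OF b M, of "j - 1"] RA_goodD(6)[OF b good_rest[OF b M, of "j - 1"]] j by simp
    finally show ?thesis .
  qed
  then show "(\<Sum>i\<in>front (osuc b) M. RA (osuc b) M 1 i) = 1"
    unfolding first fr sum_distrib_left[symmetric] using s by (subst sum.swap) simp
  show "RA (osuc b) N 1 = RA (osuc b) M 1"
    if N: "N \<in> infinite_subsets {1..}" "initial (front (osuc b) M) N" for N
  proof -
    \<comment> \<open>Even the number of terms in the mean is read off from the initial segment,
      being its minimum.\<close>
    have "Inf N = s" using Inf_initial[OF N(2) ne] Inf_initial[OF ini ne] by (simp add: s_def)
    moreover have "\<forall>j\<in>{1..s}. RA b N j = RA b M j"
      using good_initial_cong[OF b M N(1)] N(2) unfolding fr by blast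
    ultimately show ?thesis
      by (intro ext) (simp only: first RA_osuc_first[OF b N(1)], simp)
  qed
  fix k :: nat assume k: "1 \<le> k"
  show "RA (osuc b) M (Suc k) = RA (osuc b) (M - front (osuc b) M) k"
  proof -
    have "M - front (osuc b) M = rest b M s" using fr rest_subset[of b M s] by auto
    then show ?thesis
      unfolding RA_osuc using good_Min_front[OF b M] good_RA_add[OF b M, of _ s] k
      by (intro trans[OF avg_succ_shift[of s _ "RA b (rest b M s)"]]) (auto simp: s_def)
  qed
qed

text \<open>The order \<open>c a (Inf M)\<close> of the first average depends on the minimum only,
  which belongs to the support; so a set beginning with this support selects the same order. The
  same minimum is the witness for membership in the Schreier family of a limit order.\<close>

lemma RA_good_limit:
  assumes a: "is_limit a" and IH: "\<And>n. RA_good (c a n)"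
  shows "RA_good a"
  unfolding RA_good_def
proof
  fix M assume M: "M \<in> infinite_subsets {1..}"
  have first: "RA a N 1 = RA (c a (Inf N)) N 1" for N
    by (simp add: RA_limit[OF a] avg_limit_def)
  let ?b = "c a (Inf M)"
  note G = RA_goodD[OF IH[of "Inf M"] M]
  have "\<forall>i\<in>front ?b M. Inf M \<le> i" using G(3) by (auto simp: initial_def intro: cInf_lower)
  then have "front ?b M \<in> schreier a"
    unfolding schreier_limit_iff[OF a] using Inf_ge_1[OF M] G(4) by blast
  moreover have "RA a N 1 = RA ?b M 1" if "N \<in> infinite_subsets {1..}" "initial (front ?b M) N" for N
    using Inf_initial[OF that(2) G(2)] Inf_initial[OF G(3,2)] G(7)[OF that] first by simp
  moreover have "RA a M (Suc k) = RA a (M - front ?b M) k" if "1 \<le> k" for k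
    using that by (simp add: RA_limit[OF a] avg_limit_def avg_rest_shift)
  ultimately show "finite (front a M) \<and> front a M \<noteq> {} \<and> initial (front a M) M \<and>
     front a M \<in> schreier a \<and> (\<forall>i. 0 \<le> RA a M 1 i) \<and> (\<Sum>i\<in>front a M. RA a M 1 i) = 1 \<and>
     (\<forall>N\<in>infinite_subsets {1..}. initial (front a M) N \<longrightarrow> RA a N 1 = RA a M 1) \<and>
     (\<forall>k\<ge>1. RA a M (Suc k) = RA a (M - front a M) k)"
    unfolding first[of M] using G by blast
qed

lemma RA_good: "RA_good a"
proof (induction a rule: less_induct)
  case (less a)
  then show ?case
    by (cases a rule: omega1_cases) (auto intro: RA_good_0 RA_good_osuc RA_good_limit less_osuc ladder_less)
qed

end

section \<open>Regrouping of averages and Ramsey dichotomies for them\<close>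

lemma infinite_subsets_trans:
  "L \<in> infinite_subsets N \<Longrightarrow> N \<in> infinite_subsets M \<Longrightarrow> L \<in> infinite_subsets M"
  by (auto simp: infinite_subsets_def)

lemma initial_Un_beyond: "\<forall>a\<in>s. \<forall>n\<in>P. a < n \<Longrightarrow> initial s (s \<union> P)"
  by (auto simp: initial_def)

context ladder_system
begin

lemmas RA_front = RA_goodD[OF RA_good]
  and rest_infinite = good_rest[OF RA_good]
  and RA_rest = good_RA_rest[OF RA_good]
  and RA_nonneg = good_RA_nonneg[OF RA_good]

lemma front_subset: "M \<in> infinite_subsets {1..} \<Longrightarrow> front a M \<subseteq> M"
  using RA_front(3) by (auto simp: initial_def)

lemma RA_front_Un:
  assumes M: "M \<in> infinite_subsets {1..}" and P: "P \<in> infinite_subsets {1..}"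
    and lt: "\<forall>x\<in>front a M. \<forall>n\<in>P. x < n"
  shows "front a M \<union> P \<in> infinite_subsets {1..}" "RA a (front a M \<union> P) 1 = RA a M 1"
    "1 \<le> j \<Longrightarrow> RA a (front a M \<union> P) (Suc j) = RA a P j"
proof -
  show 1: "front a M \<union> P \<in> infinite_subsets {1..}"
    using M P front_subset[OF M] by (auto simp: infinite_subsets_def)
  show 2: "RA a (front a M \<union> P) 1 = RA a M 1"
    using RA_front(7)[OF M 1] initial_Un_beyond[OF lt] .
  have "front a M \<union> P - front a M = P" using lt by auto
  then show "1 \<le> j \<Longrightarrow> RA a (front a M \<union> P) (Suc j) = RA a P j"
    using RA_front(8)[OF 1] 2 by simp
qed

text \<open>The union of the selected supports works. Each of them is an initial segment of its
  union with the later ones, hence it is recovered as the first support there, with the same average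
  on it.\<close>

lemma RA_subselect:
  assumes P: "P \<in> infinite_subsets {1..}" and r: "strict_mono r"
  obtains N where "N \<in> infinite_subsets P" "\<And>k. RA a N (Suc k) = RA a P (Suc (r k))"
proof -
  define A where "A k = front a (rest a P (r k))" for k
  have R: "rest a P k \<in> infinite_subsets {1..}" for k using rest_infinite[OF P] .
  have AR: "A k \<subseteq> rest a P (r k)" "A k \<noteq> {}" for k
    using front_subset[OF R] RA_front(2)[OF R] by (auto simp: A_def)
  have lt: "x < y" if "j < k" "x \<in> A j" "y \<in> A k" for j k x y
  proof -
    have "rest a P (r k) \<subseteq> rest a P (Suc (r j))"
      using that(1) r by (intro rest_mono) (simp add: strict_mono_less Suc_le_eq)
    then have "y \<in> rest a P (r j) - front a (rest a P (r j))" using that AR(1) by auto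
    then show ?thesis using RA_front(3)[OF R, of a "r j"] that(2) by (auto simp: A_def initial_def)
  qed
  define T where "T k = (\<Union>j\<in>{k..}. A j)" for k
  have AP: "A k \<subseteq> P" for k using AR rest_subset by blast
  have T: "T k \<in> infinite_subsets {1..}" for k
  proof -
    define f where "f j = Inf (A (k + j))" for j
    have f: "f j \<in> A (k + j)" for j using AR(2) Inf_nat_def1 by (simp add: f_def)
    have "f j < f (Suc j)" for j using lt[OF _ f f[of "Suc j"]] by simp
    then have "strict_mono f" by (simp add: strict_mono_Suc_iff)
    then have "infinite (range f)" using range_inj_infinite strict_mono_imp_inj_on by blast
    moreover have "range f \<subseteq> T k" unfolding T_def using f le_add1 by blast
    ultimately have "infinite (T k)" using finite_subset by blast
    then show ?thesis using AP P by (fastforce simp: T_def infinite_subsets_def)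
  qed
  have TS: "T k = A k \<union> T (Suc k)" for k
  proof -
    have "{k..} = insert k {Suc k..}" by auto
    then show ?thesis by (simp add: T_def)
  qed
  have lt': "\<forall>x\<in>A k. \<forall>y\<in>T (Suc k). x < y" for k
    using lt by (auto simp: T_def Suc_le_eq)
  have T1: "RA a (T k) 1 = RA a P (Suc (r k))" for k
    using RA_front_Un(2)[OF R T lt'[of k, unfolded A_def]]
    unfolding RA_rest[OF P] TS[of k] A_def .
  have Trest: "rest a (T 0) k = T k" for k
  proof (induction k)
    case (Suc k)
    have "front a (T k) = A k" unfolding T1 by (simp add: A_def RA_rest[OF P, simplified])
    then show ?case using TS[of k] lt'[of k] unfolding rest.simps Suc by fastforce
  qed simp
  show ?thesis
  proof
    show "T 0 \<in> infinite_subsets P" using T[of 0] AP by (auto simp: infinite_subsets_def T_def)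
    show "RA a (T 0) (Suc k) = RA a P (Suc (r k))" for k
      by (simp only: RA_rest[OF T[of 0], of a k] Trest T1)
  qed
qed

text \<open>A property of the first k averages depends on a finite initial segment, so Galvin's
  theorem applies to the codes \<open>P - rest a P k\<close> of the sets with this property. Either
  no code lies in \<open>N\<close>, or every subset of \<open>N\<close> begins with a code and the
  property is transferred by \<open>cong\<close>.\<close>

lemma RA_dichotomy:
  assumes M: "M \<in> infinite_subsets {1..}"
    and cong: "\<And>P P'. P \<in> infinite_subsets {1..} \<Longrightarrow> P' \<in> infinite_subsets {1..} \<Longrightarrow>
      \<forall>j\<in>{1..k}. RA a P' j = RA a P j \<Longrightarrow> \<phi> P \<Longrightarrow> \<phi> P'"
  shows "\<exists>N\<in>infinite_subsets M.
    (\<forall>P\<in>infinite_subsets N. \<phi> P) \<or> (\<forall>P\<in>infinite_subsets N. \<not> \<phi> P)"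
proof -
  define B where "B s \<longleftrightarrow> (\<exists>P\<in>infinite_subsets {1..}. s = P - rest a P k \<and> \<phi> P)" for s
  have "infinite M" using M by (simp add: infinite_subsets_def)
  then show ?thesis
  proof (rule galvin[of M B])
    fix N assume N: "infinite N" "N \<subseteq> M" "\<And>s. finite s \<Longrightarrow> s \<subseteq> N \<Longrightarrow> \<not> B s"
    have "\<not> \<phi> P" if P: "P \<in> infinite_subsets N" for P
    proof
      assume "\<phi> P"
      have P': "P \<in> infinite_subsets {1..}" using P N M by (auto simp: infinite_subsets_def)
      have "P - rest a P k \<subseteq> N" using P by (auto simp: infinite_subsets_def)
      then have "\<not> B (P - rest a P k)" using N(3) good_finite_diff_rest[OF RA_good P'] by blast
      then show False using \<open>\<phi> P\<close> P' unfolding B_def by blast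
    qed
    then show ?thesis using N by (intro bexI[of _ N]) (auto simp: infinite_subsets_def)
  next
    fix N assume N: "infinite N" "N \<subseteq> M" "\<And>P. infinite P \<Longrightarrow> P \<subseteq> N \<Longrightarrow> \<exists>n. B (P \<inter> {..<n})"
    have "\<phi> P" if P: "P \<in> infinite_subsets N" for P
    proof -
      obtain n where "B (P \<inter> {..<n})" using N(3) P by (auto simp: infinite_subsets_def)
      then obtain P1 where P1: "P1 \<in> infinite_subsets {1..}" "P \<inter> {..<n} = P1 - rest a P1 k" "\<phi> P1"
        unfolding B_def by blast
      have P': "P \<in> infinite_subsets {1..}" using P N M by (auto simp: infinite_subsets_def)
      have "initial (P1 - rest a P1 k) P" using initial_Int_lessThan P1(2) by metis
      then show ?thesis using cong[OF P1(1) P'] good_initial_cong[OF RA_good P1(1) P'] P1(3) by blast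
    qed
    then show ?thesis using N by (intro bexI[of _ N]) (auto simp: infinite_subsets_def)
  qed
qed

text \<open>The alternatives are tried one at a time; one that fails on all subsets of some set is
  removed from the list.\<close>

lemma RA_uniformize:
  assumes "finite \<A>" and M: "M \<in> infinite_subsets {1..}"
    and cong: "\<And>X P P'. P \<in> infinite_subsets {1..} \<Longrightarrow> P' \<in> infinite_subsets {1..} \<Longrightarrow>
      \<forall>j\<in>{1..k}. RA a P' j = RA a P j \<Longrightarrow> \<phi> X P \<Longrightarrow> \<phi> X P'"
    and "\<forall>P\<in>infinite_subsets M. \<exists>X\<in>\<A>. \<phi> X P"
  shows "\<exists>X\<in>\<A>. \<exists>N\<in>infinite_subsets M. \<forall>P\<in>infinite_subsets N. \<phi> X P"
  using assms(1,2,4)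
proof (induction \<A> arbitrary: M rule: finite_induct)
  case empty
  then have "M \<in> infinite_subsets M" by (simp add: infinite_subsets_def)
  then show ?case using empty by blast
next
  case (insert X \<A>)
  obtain N where N: "N \<in> infinite_subsets M"
    "(\<forall>P\<in>infinite_subsets N. \<phi> X P) \<or> (\<forall>P\<in>infinite_subsets N. \<not> \<phi> X P)"
    using RA_dichotomy[OF insert.prems(1), of k a "\<phi> X"] cong by metis
  from N(2) show ?case
  proof
    assume "\<forall>P\<in>infinite_subsets N. \<phi> X P"
    then show ?thesis using N(1) by blast
  next
    assume neg: "\<forall>P\<in>infinite_subsets N. \<not> \<phi> X P"
    have "\<exists>X\<in>\<A>. \<phi> X P" if P: "P \<in> infinite_subsets N" for P
      using insert.prems(2) infinite_subsets_trans[OF P N(1)] neg P by auto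
    then obtain Y N' where "Y \<in> \<A>" "N' \<in> infinite_subsets N" "\<forall>P\<in>infinite_subsets N'. \<phi> Y P"
      using insert.IH[OF infinite_subsets_trans[OF N(1) insert.prems(1)]] by blast
    then show ?thesis using infinite_subsets_trans[OF _ N(1)] by blast
  qed
qed

section \<open>Large families contain Schreier families\<close>

definition hereditary :: "nat set set \<Rightarrow> bool" where
  "hereditary \<G> \<longleftrightarrow> (\<forall>G\<in>\<G>. finite G \<and> (\<forall>H\<subseteq>G. H \<in> \<G>))"

definition large :: "omega1 \<Rightarrow> real \<Rightarrow> nat \<Rightarrow> nat set set \<Rightarrow> nat set \<Rightarrow> bool" where
  "large a \<delta> k \<G> P \<longleftrightarrow> (\<exists>G\<in>\<G>. \<forall>j\<in>{1..k}. \<delta> \<le> (\<Sum>i\<in>G. RA a P j i))"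

definition embeds :: "nat set set \<Rightarrow> nat set \<Rightarrow> nat set set \<Rightarrow> bool" where
  "embeds \<S> N \<G> \<longleftrightarrow> (\<forall>F\<in>\<S>. elt N ` F \<in> \<G>)"

definition spreading :: "nat set set \<Rightarrow> bool" where
  "spreading \<S> \<longleftrightarrow> (\<forall>F\<in>\<S>. F \<subseteq> {1..} \<and> (\<forall>F'. spread F F' \<longrightarrow> F' \<in> \<S>))"

lemma spreading_schreier: "spreading (schreier a)"
  using schreier_finite schreier_spread by (auto simp: spreading_def)

lemma spreading_blocks: "spreading (blocks (schreier a) k)"
  unfolding spreading_def
proof (intro ballI conjI allI impI)
  fix F F' assume F: "F \<in> blocks (schreier a) k"
  show "F \<subseteq> {1..}" using blocks_finite[OF _ F] schreier_finite by metis
  show "F' \<in> blocks (schreier a) k" if "spread F F'"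
    using schreier_spread F that by (rule blocks_spread_closed)
qed

lemma embeds_subset:
  assumes "embeds \<S> N \<G>" "spreading \<S>" "L \<subseteq> N" "infinite L"
  shows "embeds \<S> L \<G>"
  unfolding embeds_def
proof
  fix F assume F: "F \<in> \<S>"
  have "infinite N" using assms finite_subset by blast
  then obtain F' where "spread F F'" "elt L ` F = elt N ` F'"
    using elt_image_spread_subset[of N L F] assms F by (auto simp: spreading_def)
  then show "elt L ` F \<in> \<G>" using assms F by (auto simp: spreading_def embeds_def)
qed

text \<open>This diagonalization reproduces the condition that n is at most the minimum of
  \<open>F\<close>. The first n - 1 points of \<open>L\<close> form a set \<open>s\<close> with
  \<open>Suc (card s) = n\<close>, so the points of \<open>L\<close> indexed by \<open>F\<close> lie
  in a set that embeds \<open>\<S> n\<close>, at positions that have only moved to the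
  right.\<close>

lemma embeds_fusion:
  assumes "infinite M" and sp: "\<And>n. spreading (\<S> n)"
    and ex: "\<And>n N. 1 \<le> n \<Longrightarrow> infinite N \<Longrightarrow> N \<subseteq> M \<Longrightarrow>
      \<exists>N'\<subseteq>N. infinite N' \<and> embeds (\<S> n) N' \<G>"
  obtains L where "infinite L" "L \<subseteq> M"
    "\<And>n F. 1 \<le> n \<Longrightarrow> F \<in> \<S> n \<Longrightarrow> \<forall>i\<in>F. n \<le> i \<Longrightarrow> elt L ` F \<in> \<G>"
proof (rule fusion[where Q = "\<lambda>s N. embeds (\<S> (Suc (card s))) N \<G>", OF assms(1)])
  fix L
  assume L: "infinite L" "L \<subseteq> M"
    "\<And>s. finite s \<Longrightarrow> s \<subseteq> L \<Longrightarrow> \<exists>N\<subseteq>M. infinite N \<and> embeds (\<S> (Suc (card s))) N \<G> \<and>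
       (\<forall>n\<in>beyond s L. n \<in> N \<and> card (L \<inter> {..<n}) \<le> card (N \<inter> {..<n}))"
  have "elt L ` F \<in> \<G>" if F: "1 \<le> n" "F \<in> \<S> n" "\<forall>i\<in>F. n \<le> i" for n F
  proof -
    define s where "s = elt L ` {1..<n}"
    have s: "finite s" "s \<subseteq> L" "card s = n - 1"
      using elt_in[OF L(1)] card_image[OF inj_on_elt[OF L(1)], of "{1..<n}"] by (fastforce simp: s_def)+
    then obtain N where N: "infinite N" "embeds (\<S> (Suc (card s))) N \<G>"
      "\<forall>n\<in>beyond s L. n \<in> N \<and> card (L \<inter> {..<n}) \<le> card (N \<inter> {..<n})"
      using L(3) by blast
    have F1: "F \<subseteq> {1..}" using sp F(2) by (auto simp: spreading_def)
    have "elt L i \<in> beyond s L" if "i \<in> F" for i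
      using that F elt_in[OF L(1)] elt_less[OF L(1), of _ i] by (fastforce simp: beyond_def s_def)
    then obtain F' where "spread F F'" "elt L ` F = elt N ` F'"
      using elt_image_spread[OF N(1) L(1) F1] N(3) by blast
    then show ?thesis using N(2) s(3) F sp by (auto simp: spreading_def embeds_def)
  qed
  then show thesis using that L by blast
qed (use ex embeds_subset[OF _ sp] in auto)

text \<open>Deleting the first points of \<open>N\<close> makes all positions at least n, where the
  two families compare. Cutting at index \<open>Suc n\<close> keeps the index positive even for n =
  0.\<close>

lemma embeds_beyond:
  assumes "embeds \<S> N \<G>" "infinite N" "spreading \<T>"
    and ev: "\<forall>F\<in>\<T>. (\<forall>i\<in>F. n \<le> i) \<longrightarrow> F \<in> \<S>"
  obtains N' where "N' \<subseteq> N" "infinite N'" "embeds \<T> N' \<G>"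
proof
  let ?N' = "beyond {elt N (Suc n)} N"
  show sub: "?N' \<subseteq> N" "infinite ?N'" using infinite_beyond assms by (auto simp: beyond_subset)
  show "embeds \<T> ?N' \<G>" unfolding embeds_def
  proof
    fix F assume F: "F \<in> \<T>"
    then obtain F' where F': "spread F F'" "elt ?N' ` F = elt N ` F'"
      using elt_image_spread_subset[OF assms(2) sub(2,1), of F] assms(3) by (auto simp: spreading_def)
    have "F' \<in> \<T>" "F' \<subseteq> {1..}" using F F'(1) assms(3) by (auto simp: spreading_def)
    moreover have "n \<le> i" if "i \<in> F'" for i
    proof -
      have "elt N i \<in> elt ?N' ` F" using F'(2) that by simp
      then obtain j where "elt N i = elt ?N' j" by blast
      then have "elt N (Suc n) < elt N i" using elt_in[OF sub(2), of j] by (auto simp: beyond_def)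
      then show ?thesis using elt_less_iff[OF assms(2), of "Suc n" i] that calculation by auto
    qed
    ultimately show "elt ?N' ` F \<in> \<G>" using ev assms(1) F'(2) by (auto simp: embeds_def)
  qed
qed

lemma large_cong:
  "\<forall>j\<in>{1..k}. RA a P' j = RA a P j \<Longrightarrow> large a \<delta> k \<G> P \<Longrightarrow> large a \<delta> k \<G> P'"
  by (simp add: large_def)

lemma large_dichotomy:
  assumes "M \<in> infinite_subsets {1..}"
  shows "\<exists>N\<in>infinite_subsets M.
    (\<forall>P\<in>infinite_subsets N. large a \<delta> k \<G> P) \<or> (\<forall>P\<in>infinite_subsets N. \<not> large a \<delta> k \<G> P)"
  by (rule RA_dichotomy[OF assms]) (rule large_cong)

lemma RA_mass_le_1:
  assumes M: "M \<in> infinite_subsets {1..}" and "1 \<le> j" "finite G"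
  shows "(\<Sum>i\<in>G. RA a M j i) \<le> 1"
proof -
  let ?R = "rest a M (j - 1)"
  have R: "?R \<in> infinite_subsets {1..}" using rest_infinite[OF M] .
  have e: "RA a M j = RA a ?R 1" using RA_rest[OF M, of a "j - 1"] assms(2) by simp
  have "(\<Sum>i\<in>G. RA a ?R 1 i) = (\<Sum>i\<in>G \<inter> front a ?R. RA a ?R 1 i)"
    using assms by (intro sum.mono_neutral_right) (auto simp: supp_def)
  also have "\<dots> \<le> (\<Sum>i\<in>front a ?R. RA a ?R 1 i)"
    using RA_front(1,5)[OF R] by (intro sum_mono2) auto
  also have "\<dots> = 1" using RA_front(6)[OF R] .
  finally show ?thesis unfolding e .
qed

text \<open>A Markov argument: the average is a mean of \<open>Inf P\<close> terms, and
  \<open>G\<close> has mass at most 1 in each. If it has mass \<delta> in the mean, at least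
  \<open>Inf P * \<delta> / 2\<close> of the terms give it mass \<open>\<delta> / 2\<close> or more,
  and these may be selected.\<close>

lemma large_osuc_blocks:
  assumes P: "P \<in> infinite_subsets {1..}" and "large (osuc b) \<delta> 1 \<G> P" "hereditary \<G>"
    and \<delta>: "0 < \<delta>" and k: "real k \<le> real (Inf P) * \<delta> / 2"
  obtains P' where "P' \<in> infinite_subsets P" "large b (\<delta> / 2) k \<G> P'"
proof -
  obtain G where G: "G \<in> \<G>" "\<delta> \<le> (\<Sum>i\<in>G. RA (osuc b) P 1 i)" "finite G"
    using assms by (auto simp: large_def hereditary_def)
  define s where "s = Inf P"
  have s: "1 \<le> s" using Inf_ge_1[OF P] by (simp add: s_def)
  define \<mu> where "\<mu> j = (\<Sum>i\<in>G. RA b P (Suc j) i)" for j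
  have \<mu>: "\<mu> j \<le> 1" for j using RA_mass_le_1[OF P _ G(3)] by (simp add: \<mu>_def)
  define J where "J = {j \<in> {..<s}. \<delta> / 2 \<le> \<mu> j}"
  have "(\<Sum>i\<in>G. RA (osuc b) P 1 i) = 1 / real s * (\<Sum>j = 1..s. \<Sum>i\<in>G. RA b P j i)"
    unfolding RA_osuc_first[OF RA_good P] s_def[symmetric] sum_distrib_left[symmetric]
    by (subst sum.swap) simp
  also have "(\<Sum>j = 1..s. \<Sum>i\<in>G. RA b P j i) = (\<Sum>j<s. \<mu> j)"
    unfolding \<mu>_def using sum.atLeast1_atMost_eq[of "\<lambda>j. sum (RA b P j) G" s] by simp
  finally have "(\<Sum>j<s. \<mu> j) = real s * (\<Sum>i\<in>G. RA (osuc b) P 1 i)" using s by simp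
  then have "real s * \<delta> \<le> (\<Sum>j<s. \<mu> j)" using G(2) by (simp add: mult_left_mono)
  also have "\<dots> \<le> (\<Sum>j<s. of_bool (j \<in> J) + \<delta> / 2)"
    using \<mu> \<delta> by (intro sum_mono) (auto simp: J_def intro: add_increasing2)
  also have "\<dots> = real (card ({..<s} \<inter> {j. j \<in> J})) + real s * \<delta> / 2"
    by (simp add: sum.distrib)
  also have "{..<s} \<inter> {j. j \<in> J} = J" by (auto simp: J_def)
  finally have kJ: "k \<le> card J" using k by (simp add: s_def)
  \<comment> \<open>\<open>J\<close> is padded to an infinite set, as \<open>RA_subselect\<close>
    asks for an infinite selection; the first k selected indices still come from
    \<open>J\<close>.\<close>
  define X where "X = J \<union> {s..}"
  have X: "infinite X" by (simp add: X_def infinite_Ici)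
  have JX: "enumerate X i \<in> J" if "i < k" for i
  proof (rule ccontr)
    assume "enumerate X i \<notin> J"
    then have "s \<le> enumerate X i" using enumerate_in_set[OF X, of i] by (auto simp: X_def)
    then have "J \<subseteq> X \<inter> {..<enumerate X i}" by (auto simp: X_def J_def)
    then have "card J \<le> i" using card_mono[of "X \<inter> {..<enumerate X i}" J] card_initial_enumerate[OF X]
      by simp
    then show False using kJ that by simp
  qed
  obtain P' where P': "P' \<in> infinite_subsets P"
    "\<And>j. RA b P' (Suc j) = RA b P (Suc (enumerate X j))"
    using RA_subselect[OF P strict_mono_enumerate[OF X]] by blast
  have "\<delta> / 2 \<le> (\<Sum>i\<in>G. RA b P' j i)" if "j \<in> {1..k}" for j
    using JX[of "j - 1"] P'(2)[of "j - 1"] that by (auto simp: J_def \<mu>_def)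
  then have "large b (\<delta> / 2) k \<G> P'" unfolding large_def using G(1) by blast
  then show ?thesis using P'(1) that by blast
qed

definition large_embeds :: "omega1 \<Rightarrow> bool" where
  "large_embeds a \<longleftrightarrow> (\<forall>\<delta>>0. \<forall>\<G> M. hereditary \<G> \<longrightarrow> M \<in> infinite_subsets {1..} \<longrightarrow>
     (\<forall>P\<in>infinite_subsets M. large a \<delta> 1 \<G> P) \<longrightarrow>
     (\<exists>N\<in>infinite_subsets M. embeds (schreier a) N \<G>))"

lemma hereditary_link: "hereditary \<G> \<Longrightarrow> hereditary {H. A \<union> H \<in> \<G>}"
  unfolding hereditary_def by (auto, meson Un_mono order_refl)

text \<open>For a given first support \<open>A\<close>, uniformization fixes the trace \<open>A'\<close> on \<open>A\<close> of the member of \<open>\<G>\<close>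
  that is large, and the induction hypothesis applies to the link of \<open>A'\<close>. The traces \<open>A'\<close> form the
  family \<open>\<G>1\<close>, which is large for the first averages alone.\<close>

lemma large_embeds_blocks:
  assumes a: "large_embeds a" and \<delta>: "0 < \<delta>"
  shows "hereditary \<G> \<Longrightarrow> M \<in> infinite_subsets {1..} \<Longrightarrow> \<forall>P\<in>infinite_subsets M. large a \<delta> k \<G> P \<Longrightarrow>
    \<exists>N\<in>infinite_subsets M. embeds (blocks (schreier a) k) N \<G>"
proof (induction k arbitrary: \<G> M)
  case 0
  then obtain G where "G \<in> \<G>" by (auto simp: large_def infinite_subsets_def)
  then have "{} \<in> \<G>" using 0 by (auto simp: hereditary_def)
  then have "embeds (blocks (schreier a) 0) M \<G>" by (simp add: embeds_def)
  then show ?case using 0 by (auto simp: infinite_subsets_def)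
next
  case (Suc k)
  let ?U = "blocks (schreier a) k"
  have M: "infinite M" "M \<subseteq> {1..}" using Suc.prems by (auto simp: infinite_subsets_def)
  \<comment> \<open>For a finite set that is not the first support of any \<open>P\<close> the
    condition is vacuous, so the fusion can treat all finite sets alike.\<close>
  define Q where "Q A N \<longleftrightarrow> (\<forall>P\<in>infinite_subsets M. front a P = A \<longrightarrow>
      (\<exists>A'\<subseteq>A. \<delta> \<le> (\<Sum>i\<in>A'. RA a P 1 i) \<and> embeds ?U N {H. A' \<union> H \<in> \<G>}))" for A N
  have Q_her: "Q A N'" if "Q A N" "N' \<subseteq> N" "infinite N'" for A N N'
    using that(1) embeds_subset[OF _ spreading_blocks that(2,3)] unfolding Q_def by metis
  have Q_ex: "\<exists>N'\<subseteq>N. infinite N' \<and> Q A N'" if A: "finite A" and N: "infinite N" "N \<subseteq> M" for A N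
  proof (cases "\<exists>P\<in>infinite_subsets M. front a P = A")
    case True
    then obtain P0 where P0: "P0 \<in> infinite_subsets M" "front a P0 = A" by blast
    have P0': "P0 \<in> infinite_subsets {1..}" using infinite_subsets_trans[OF P0(1)] Suc.prems(2) by blast
    define \<phi> where "\<phi> A' P \<longleftrightarrow> \<delta> \<le> (\<Sum>i\<in>A'. RA a P0 1 i) \<and> large a \<delta> k {H. A' \<union> H \<in> \<G>} P" for A' P
    let ?N1 = "beyond A N"
    have N1: "?N1 \<in> infinite_subsets {1..}"
      using infinite_beyond[OF A N(1)] N M by (auto simp: infinite_subsets_def beyond_def)
    \<comment> \<open>\<open>A \<union> P\<close> has first support \<open>A\<close>, followed by
      the averages of \<open>P\<close>, which live beyond \<open>A\<close>. A member
      \<open>G\<close> that is large for it splits into the trace \<open>G \<inter> A\<close> and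
      the member \<open>G - A\<close> of the link.\<close>
    have "\<exists>A'\<in>Pow A. \<phi> A' P" if P: "P \<in> infinite_subsets ?N1" for P
    proof -
      have lt: "\<forall>x\<in>front a P0. \<forall>n\<in>P. x < n"
        using P P0 by (auto simp: infinite_subsets_def beyond_def)
      have P': "P \<in> infinite_subsets {1..}" using infinite_subsets_trans[OF P N1] .
      note R = RA_front_Un[OF P0' P' lt, unfolded P0(2)]
      have "A \<union> P \<in> infinite_subsets M"
        using front_subset[OF P0', of a] P0 P N by (auto simp: infinite_subsets_def beyond_def)
      then obtain G where G: "G \<in> \<G>" "\<forall>j\<in>{1..Suc k}. \<delta> \<le> (\<Sum>i\<in>G. RA a (A \<union> P) j i)"
        using Suc.prems(3) by (auto simp: large_def)
      have fG: "finite G" using G Suc.prems(1) by (simp add: hereditary_def)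
      have "\<delta> \<le> (\<Sum>i\<in>G. RA a P0 1 i)" using bspec[OF G(2), of 1] unfolding R(2) by simp
      also have "\<dots> = (\<Sum>i\<in>G \<inter> A. RA a P0 1 i)"
        using fG P0(2) by (intro sum.mono_neutral_right) (auto simp: supp_def)
      finally have "\<delta> \<le> (\<Sum>i\<in>G \<inter> A. RA a P0 1 i)" .
      moreover have "\<delta> \<le> (\<Sum>i\<in>G - A. RA a P j i)" if j: "j \<in> {1..k}" for j
      proof -
        have "RA a P j = RA a (rest a P (j - 1)) 1" using RA_rest[OF P', of a "j - 1"] j by simp
        then have sp: "supp (RA a P j) \<subseteq> P"
          using front_subset[OF rest_infinite[OF P']] rest_subset by (metis subset_trans)
        have "\<delta> \<le> (\<Sum>i\<in>G. RA a P j i)" using bspec[OF G(2), of "Suc j"] R(3)[of j] j by simp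
        also have "\<dots> = (\<Sum>i\<in>G - A. RA a P j i)"
          using sp lt P0(2) fG by (intro sum.mono_neutral_right) (auto simp: supp_def)
        finally show ?thesis .
      qed
      moreover have "G \<inter> A \<union> (G - A) = G" by auto
      ultimately have "\<phi> (G \<inter> A) P" unfolding \<phi>_def large_def using G(1)
        by (intro conjI bexI[of _ "G - A"]) auto
      then show ?thesis by blast
    qed
    then have "\<exists>A'\<in>Pow A. \<exists>N'\<in>infinite_subsets ?N1. \<forall>P\<in>infinite_subsets N'. \<phi> A' P"
      using A N1 by (intro RA_uniformize[where k = k and a = a]) (auto simp: \<phi>_def intro: large_cong)
    then obtain A' N2 where A': "A' \<subseteq> A" "N2 \<in> infinite_subsets ?N1"
      "\<forall>P\<in>infinite_subsets N2. \<phi> A' P" by auto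
    have N2: "N2 \<in> infinite_subsets {1..}" using infinite_subsets_trans[OF A'(2) N1] .
    have N22: "N2 \<in> infinite_subsets N2" using N2 by (simp add: infinite_subsets_def)
    obtain N3 where N3: "N3 \<in> infinite_subsets N2" "embeds ?U N3 {H. A' \<union> H \<in> \<G>}"
      using Suc.IH[OF hereditary_link[OF Suc.prems(1)] N2] A'(3) by (auto simp: \<phi>_def)
    have w: "\<delta> \<le> (\<Sum>i\<in>A'. RA a P0 1 i)" using A'(3) N22 by (auto simp: \<phi>_def)
    have "Q A N3" unfolding Q_def
    proof (intro ballI impI)
      fix P assume P: "P \<in> infinite_subsets M" "front a P = A"
      have P': "P \<in> infinite_subsets {1..}" using infinite_subsets_trans[OF P(1) Suc.prems(2)] .
      have "RA a P 1 = RA a P0 1"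
        using RA_front(7)[OF P0' P'] RA_front(3)[OF P', of a] P P0 by simp
      then show "\<exists>A'\<subseteq>A. \<delta> \<le> (\<Sum>i\<in>A'. RA a P 1 i) \<and> embeds ?U N3 {H. A' \<union> H \<in> \<G>}"
        using w A'(1) N3(2) by auto
    qed
    then show ?thesis using N3(1) A'(2) by (auto simp: infinite_subsets_def beyond_def intro!: exI[of _ N3])
  next
    case False
    then show ?thesis using N unfolding Q_def by blast
  qed
  obtain L where L: "infinite L" "L \<subseteq> M" "\<And>s. finite s \<Longrightarrow> s \<subseteq> L \<Longrightarrow> Q s (beyond s L)"
    by (rule fusion_beyond[where Q = Q, OF M(1)]) (erule (2) Q_ex, erule (2) Q_her, blast)
  \<comment> \<open>The cut is made at an unspecified \<open>s\<close>, because a trace embeds its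
    link only beyond the whole first support from which it comes. A smaller set can use the same
    \<open>s\<close>, so the family is hereditary.\<close>
  define \<G>1 where "\<G>1 = {A. finite A \<and> (\<exists>s. finite s \<and> embeds ?U (beyond s L) {H. A \<union> H \<in> \<G>})}"
  have "hereditary \<G>1" unfolding hereditary_def
  proof (intro ballI conjI allI impI)
    fix G H assume "G \<in> \<G>1" "H \<subseteq> G"
    then obtain s where s: "finite s" "embeds ?U (beyond s L) {K. G \<union> K \<in> \<G>}" "finite H"
      unfolding \<G>1_def using finite_subset by blast
    have "H \<union> K \<in> \<G>" if "G \<union> K \<in> \<G>" for K
      using that Suc.prems(1) \<open>H \<subseteq> G\<close> unfolding hereditary_def by (meson Un_mono order_refl)
    then show "H \<in> \<G>1" using s unfolding \<G>1_def embeds_def by blast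
  qed (simp add: \<G>1_def)
  moreover have LM: "L \<in> infinite_subsets {1..}" using L M by (auto simp: infinite_subsets_def)
  moreover have "large a \<delta> 1 \<G>1 P" if P: "P \<in> infinite_subsets L" for P
  proof -
    have P': "P \<in> infinite_subsets {1..}" using infinite_subsets_trans[OF P LM] .
    have A: "finite (front a P)" "front a P \<subseteq> L"
      using RA_front(1)[OF P'] front_subset[OF P', of a] P by (auto simp: infinite_subsets_def)
    have "P \<in> infinite_subsets M" using P L by (auto simp: infinite_subsets_def)
    then obtain A' where A': "A' \<subseteq> front a P" "\<delta> \<le> (\<Sum>i\<in>A'. RA a P 1 i)"
      "embeds ?U (beyond (front a P) L) {H. A' \<union> H \<in> \<G>}"
      using L(3)[OF A] unfolding Q_def by blast
    then have "A' \<in> \<G>1" using A finite_subset unfolding \<G>1_def by blast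
    then show ?thesis using A'(2) by (auto simp: large_def)
  qed
  ultimately obtain N where N: "N \<in> infinite_subsets L" "embeds (schreier a) N \<G>1"
    using a \<delta> unfolding large_embeds_def by blast
  \<comment> \<open>The tail on which a link embeds still varies with the member of
    \<open>\<G>1\<close>. A second fusion handles the finitely many members inside each
    \<open>s\<close>, so that beyond \<open>s\<close> the new set embeds all their links, again with
    control of positions.\<close>
  define Q' where "Q' s K \<longleftrightarrow> (\<forall>G\<in>{G. G \<subseteq> s \<and> G \<in> \<G>1}. embeds ?U K {H. G \<union> H \<in> \<G>})" for s K
  have N': "infinite N" "N \<subseteq> L" using N(1) by (auto simp: infinite_subsets_def)
  have Q'_her: "Q' s K'" if "Q' s K" "K' \<subseteq> K" "infinite K'" for s K K'
    using that(1) embeds_subset[OF _ spreading_blocks that(2,3)] unfolding Q'_def by metis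
  have Q'_ex: "\<exists>K'\<subseteq>K. infinite K' \<and> Q' s K'" if s: "finite s" and K: "infinite K" "K \<subseteq> N" for s K
    unfolding Q'_def
  proof (rule finite_refine[OF _ _ _ K])
    show "finite {G. G \<subseteq> s \<and> G \<in> \<G>1}" using s by simp
    fix G K1 assume G: "G \<in> {G. G \<subseteq> s \<and> G \<in> \<G>1}" and K1: "infinite K1" "K1 \<subseteq> N"
    then obtain t where t: "finite t" "embeds ?U (beyond t L) {H. G \<union> H \<in> \<G>}"
      unfolding \<G>1_def by blast
    have "beyond t K1 \<subseteq> beyond t L" using K1 N' by (auto simp: beyond_def)
    then show "\<exists>K'\<subseteq>K1. infinite K' \<and> embeds ?U K' {H. G \<union> H \<in> \<G>}"
      using embeds_subset[OF t(2) spreading_blocks] infinite_beyond[OF t(1) K1(1)] beyond_subset by blast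
  qed (use embeds_subset[OF _ spreading_blocks] in blast)
  obtain L' where L': "infinite L'" "L' \<subseteq> N"
    "\<And>s. finite s \<Longrightarrow> s \<subseteq> L' \<Longrightarrow> \<exists>K\<subseteq>N. infinite K \<and> Q' s K \<and>
       (\<forall>n\<in>beyond s L'. n \<in> K \<and> card (L' \<inter> {..<n}) \<le> card (K \<inter> {..<n}))"
    by (rule fusion[where Q = Q', OF N'(1)]) (erule (2) Q'_ex, erule (2) Q'_her, blast)
  have emb: "embeds (schreier a) L' \<G>1"
    using embeds_subset[OF N(2) spreading_schreier L'(2,1)] .
  have "embeds (blocks (schreier a) (Suc k)) L' \<G>" unfolding embeds_def
  proof
    fix F assume "F \<in> blocks (schreier a) (Suc k)"
    then obtain A B where AB: "F = A \<union> B" "A \<in> schreier a" "B \<in> ?U" "\<forall>x\<in>A. \<forall>y\<in>B. x < y" by auto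
    let ?G = "elt L' ` A"
    have G: "?G \<in> \<G>1" "finite ?G" "?G \<subseteq> L'"
      using emb AB(2) schreier_finite[OF AB(2)] elt_in[OF L'(1)] by (auto simp: embeds_def)
    then obtain K where K: "infinite K" "Q' ?G K"
      "\<forall>n\<in>beyond ?G L'. n \<in> K \<and> card (L' \<inter> {..<n}) \<le> card (K \<inter> {..<n})"
      using L'(3) by blast
    have B: "B \<subseteq> {1..}" using spreading_blocks AB(3) by (auto simp: spreading_def)
    have "elt L' i \<in> beyond ?G L'" if "i \<in> B" for i
      using that AB(4) elt_in[OF L'(1)] elt_less[OF L'(1), of _ i] schreier_finite[OF AB(2)]
      by (fastforce simp: beyond_def)
    then obtain B' where B': "spread B B'" "elt L' ` B = elt K ` B'"
      using elt_image_spread[OF K(1) L'(1) B] K(3) by blast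
    then have "B' \<in> ?U" using spreading_blocks AB(3) by (auto simp: spreading_def)
    then have "?G \<union> elt K ` B' \<in> \<G>" using K(2) G(1) by (auto simp: Q'_def embeds_def)
    then show "elt L' ` F \<in> \<G>" unfolding AB(1) image_Un B'(2) .
  qed
  moreover have "L' \<in> infinite_subsets M" using L' N' L by (auto simp: infinite_subsets_def)
  ultimately show ?case by blast
qed

text \<open>An average of order 0 is the point mass at the minimum, and every element of
  \<open>M\<close> is the minimum of some infinite subset.\<close>

lemma large_embeds_0: "large_embeds 0"
  unfolding large_embeds_def
proof (intro allI impI)
  fix \<delta> :: real and \<G> M
  assume \<delta>: "0 < \<delta>" and \<G>: "hereditary \<G>" and M: "M \<in> infinite_subsets {1..}"
    and lg: "\<forall>P\<in>infinite_subsets M. large 0 \<delta> 1 \<G> P"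
  have inf: "infinite M" using M by (simp add: infinite_subsets_def)
  have single: "{m} \<in> \<G>" if m: "m \<in> M" for m
  proof -
    define P where "P = insert m (beyond {m} M)"
    have P: "P \<in> infinite_subsets M"
      using inf m infinite_beyond[of "{m}" M] by (auto simp: P_def infinite_subsets_def beyond_def)
    then obtain G where G: "G \<in> \<G>" "\<delta> \<le> (\<Sum>i\<in>G. RA 0 P 1 i)"
      using lg by (auto simp: large_def)
    have "Inf P = m" by (intro cInf_eq_minimum) (auto simp: P_def beyond_def)
    then have "elt P 1 = m" by (simp add: elt_def enumerate_0 Inf_nat_def)
    then have "(\<Sum>i\<in>G. RA 0 P 1 i) = 0" if "m \<notin> G"
      using that by (intro sum.neutral) (auto simp: RA_0)
    then have "m \<in> G" using G(2) \<delta> by fastforce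
    then show ?thesis using \<G> G(1) by (auto simp: hereditary_def)
  qed
  obtain m where "m \<in> M" using inf by (metis ex_in_conv finite.emptyI)
  then have "{} \<in> \<G>" using single \<G> unfolding hereditary_def by blast
  then have "embeds (schreier 0) M \<G>"
    using single elt_in[OF inf] by (auto simp: embeds_def schreier_0)
  then show "\<exists>N\<in>infinite_subsets M. embeds (schreier 0) N \<G>"
    using inf by (auto simp: infinite_subsets_def)
qed

text \<open>Sets with minimum at least \<open>2 * k / \<delta>\<close> have subsets that are large
  for k averages of order \<open>b\<close>. This excludes the negative side of the dichotomy, so
  blocks of every length k embed, and diagonalizing over k gives the family of order
  \<open>osuc b\<close>.\<close>

lemma large_embeds_osuc:
  assumes "large_embeds b"
  shows "large_embeds (osuc b)"
  unfolding large_embeds_def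
proof (intro allI impI)
  fix \<delta> :: real and \<G> M
  assume \<delta>: "0 < \<delta>" and \<G>: "hereditary \<G>" and M: "M \<in> infinite_subsets {1..}"
    and lg: "\<forall>P\<in>infinite_subsets M. large (osuc b) \<delta> 1 \<G> P"
  have inf: "infinite M" using M by (simp add: infinite_subsets_def)
  have ex: "\<exists>N'\<subseteq>N. infinite N' \<and> embeds (blocks (schreier b) k) N' \<G>"
    if N: "infinite N" "N \<subseteq> M" for k N
  proof -
    have N': "N \<in> infinite_subsets {1..}" using N M by (auto simp: infinite_subsets_def)
    show ?thesis
    proof (cases "\<exists>K\<in>infinite_subsets N. \<forall>P\<in>infinite_subsets K. large b (\<delta> / 2) k \<G> P")
      case True
      then obtain K where 4: "K \<in> infinite_subsets N" "\<forall>P\<in>infinite_subsets K. large b (\<delta> / 2) k \<G> P"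
        by blast
      have "K \<in> infinite_subsets {1..}" using infinite_subsets_trans[OF 4(1) N'] .
      then obtain K' where "K' \<in> infinite_subsets K" "embeds (blocks (schreier b) k) K' \<G>"
        using large_embeds_blocks[OF assms _ \<G> _ 4(2)] \<delta> by auto
      then show ?thesis using 4(1) by (auto simp: infinite_subsets_def)
    next
      case False
      then obtain K where 5: "K \<in> infinite_subsets N" "\<forall>P\<in>infinite_subsets K. \<not> large b (\<delta> / 2) k \<G> P"
        using large_dichotomy[OF N', of b "\<delta> / 2" k \<G>] by blast
      obtain n :: nat where n: "2 * real k / \<delta> < real n" using reals_Archimedean2 by blast
      define P where "P = beyond {n} K"
      have K: "infinite K" using 5 by (simp add: infinite_subsets_def)
      have P: "P \<in> infinite_subsets K"
        using infinite_beyond[of "{n}" K] K by (auto simp: P_def infinite_subsets_def beyond_def)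
      have P': "P \<in> infinite_subsets {1..}" and PM: "P \<in> infinite_subsets M"
        using P 5(1) N M by (auto simp: infinite_subsets_def)
      have "n < Inf P" using Inf_ge_1[OF P'] by (auto simp: P_def beyond_def)
      then have "2 * real k / \<delta> \<le> real (Inf P)" using n by linarith
      then have "real k \<le> real (Inf P) * \<delta> / 2" using \<delta> by (simp add: field_simps)
      then obtain P1 where P1: "P1 \<in> infinite_subsets P" "large b (\<delta> / 2) k \<G> P1"
        using large_osuc_blocks[OF P' _ \<G> \<delta>] lg PM by blast
      then show ?thesis using 5(2) infinite_subsets_trans[OF P1(1) P] by blast
    qed
  qed
  obtain L where L: "infinite L" "L \<subseteq> M"
    "\<And>n F. 1 \<le> n \<Longrightarrow> F \<in> blocks (schreier b) n \<Longrightarrow> \<forall>i\<in>F. n \<le> i \<Longrightarrow> elt L ` F \<in> \<G>"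
    using embeds_fusion[where \<S> = "blocks (schreier b)" and \<G> = \<G>, OF inf spreading_blocks ex]
    by blast
  have "{} \<in> \<G>" using L(3)[of 1 "{}"] empty_in_schreier[of b] by auto
  then have "embeds (schreier (osuc b)) L \<G>"
    using L(3) by (auto simp: embeds_def schreier_osuc_blocks)
  then show "\<exists>N\<in>infinite_subsets M. embeds (schreier (osuc b)) N \<G>"
    using L by (auto simp: infinite_subsets_def)
qed

text \<open>The hypothesis at a limit only concerns averages of order \<open>c a m\<close> of sets with minimum \<open>m\<close>. Such an
  average is a mean of \<open>m\<close> blocks of order \<open>\<eta>\<close>, and only the first block involves \<open>m\<close>, so for large \<open>m\<close>
  it may be dropped.\<close>

lemma large_embeds_limit:
  assumes a: "is_limit a" and IH: "\<And>b. b < a \<Longrightarrow> large_embeds b"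
  shows "large_embeds a"
  unfolding large_embeds_def
proof (intro allI impI)
  fix \<delta> :: real and \<G> M
  assume \<delta>: "0 < \<delta>" and \<G>: "hereditary \<G>" and M: "M \<in> infinite_subsets {1..}"
    and lg: "\<forall>P\<in>infinite_subsets M. large a \<delta> 1 \<G> P"
  have inf: "infinite M" using M by (simp add: infinite_subsets_def)
  have ex: "\<exists>N'\<subseteq>N. infinite N' \<and> embeds (schreier (c a n)) N' \<G>"
    if n: "1 \<le> n" and N: "infinite N" "N \<subseteq> M" for n N
  proof -
    \<comment> \<open>The bound \<open>4 / \<delta>\<close> provides two averages of order \<eta>
      with mass at least \<open>\<delta> / 2\<close>, so that one can be given up. From
      \<open>m > n\<close> follows \<open>c a n < c a m = osuc \<eta>\<close>, hence
      \<open>c a n \<le> \<eta>\<close>.\<close>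
    obtain t :: nat where t: "4 / \<delta> < real t" using reals_Archimedean2 by blast
    obtain m where m: "m \<in> N" "m > max n t" using N(1) by (meson infinite_nat_iff_unbounded)
    have m2: "2 \<le> real m * \<delta> / 2"
    proof -
      have "4 / \<delta> < real m" using t m(2) by linarith
      then show ?thesis using \<delta> by (simp add: pos_divide_less_eq)
    qed
    obtain \<eta> where \<eta>: "c a m = osuc \<eta>"
      using ladder_succ[OF a, of m] m n by (auto simp: is_succ_def)
    have "\<eta> < a" using ladder_less[OF a, of m] less_osuc[of \<eta>] unfolding \<eta> by order
    have le: "c a n \<le> \<eta>"
      using ladder_strict[OF a n, of m] m osuc_leI[of \<eta> "c a n"] unfolding \<eta> by (metis leD max_less_iff_conj not_le_imp_less)
    define N1 where "N1 = beyond {m} N"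
    have N1: "N1 \<in> infinite_subsets {1..}" "N1 \<subseteq> N"
      using infinite_beyond[of "{m}" N] N M by (auto simp: N1_def infinite_subsets_def beyond_def)
    show ?thesis
    proof (cases "\<exists>K\<in>infinite_subsets N1. \<forall>P\<in>infinite_subsets K. large \<eta> (\<delta> / 2) 1 \<G> P")
      case True
      then obtain K where 4: "K \<in> infinite_subsets N1" "\<forall>P\<in>infinite_subsets K. large \<eta> (\<delta> / 2) 1 \<G> P"
        by blast
      have "K \<in> infinite_subsets {1..}" using infinite_subsets_trans[OF 4(1) N1(1)] .
      moreover have "0 < \<delta> / 2" using \<delta> by simp
      ultimately obtain K' where K': "K' \<in> infinite_subsets K" "embeds (schreier \<eta>) K' \<G>"
        using IH[OF \<open>\<eta> < a\<close>] \<G> 4(2) unfolding large_embeds_def by blast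
      obtain r where "\<forall>F\<in>schreier (c a n). (\<forall>i\<in>F. r \<le> i) \<longrightarrow> F \<in> schreier \<eta>"
        using schreier_eventually_subset[OF le] by blast
      moreover have "infinite K'" using K'(1) by (simp add: infinite_subsets_def)
      ultimately obtain N' where "N' \<subseteq> K'" "infinite N'" "embeds (schreier (c a n)) N' \<G>"
        using embeds_beyond[OF K'(2) _ spreading_schreier] by blast
      moreover have "K' \<subseteq> N" using K' 4(1) N1(2) by (auto simp: infinite_subsets_def)
      ultimately show ?thesis by blast
    next
      case False
      then obtain K where 5: "K \<in> infinite_subsets N1" "\<forall>P\<in>infinite_subsets K. \<not> large \<eta> (\<delta> / 2) 1 \<G> P"
        using large_dichotomy[OF N1(1), of \<eta> "\<delta> / 2" 1 \<G>] by blast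
      \<comment> \<open>Since \<open>m\<close> is the minimum of \<open>P\<close>, the limit rule
        selects the order \<open>c a m\<close>, that is \<open>osuc \<eta>\<close>.\<close>
      define P where "P = insert m K"
      have K: "infinite K" "K \<subseteq> N1" using 5 by (auto simp: infinite_subsets_def)
      have PM: "P \<in> infinite_subsets M" and P': "P \<in> infinite_subsets {1..}"
        using K m N M N1 by (auto simp: P_def infinite_subsets_def)
      have Pm: "Inf P = m" using K(2)
        by (intro cInf_eq_minimum) (auto simp: P_def N1_def beyond_def intro: less_imp_le)
      have "RA a P 1 = RA (osuc \<eta>) P 1"
        unfolding \<eta>[symmetric] by (simp add: RA_limit[OF a] avg_limit_def Pm)
      moreover have "large a \<delta> 1 \<G> P" using lg PM by blast
      ultimately have "large (osuc \<eta>) \<delta> 1 \<G> P" by (simp add: large_def)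
      then obtain P1 where P1: "P1 \<in> infinite_subsets P" "large \<eta> (\<delta> / 2) 2 \<G> P1"
        using large_osuc_blocks[OF P' _ \<G> \<delta>, of \<eta> 2] m2 Pm by auto
      have P1': "P1 \<in> infinite_subsets {1..}" using infinite_subsets_trans[OF P1(1) P'] .
      \<comment> \<open>Only the first support of \<open>P1\<close> can contain \<open>m\<close>.
        Without it the set lies in \<open>K\<close>, and the second heavy average becomes the first
        one.\<close>
      let ?P2 = "P1 - front \<eta> P1"
      have "large \<eta> (\<delta> / 2) 1 \<G> ?P2"
        using P1(2) unfolding large_def
      proof (elim bexE, intro bexI)
        fix G assume "\<forall>j\<in>{1..2}. \<delta> / 2 \<le> (\<Sum>i\<in>G. RA \<eta> P1 j i)"
        then have "\<delta> / 2 \<le> (\<Sum>i\<in>G. RA \<eta> P1 (Suc 1) i)" by (rule bspec) simp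
        then show "\<forall>j\<in>{1..1}. \<delta> / 2 \<le> (\<Sum>i\<in>G. RA \<eta> ?P2 j i)"
          unfolding RA_front(8)[OF P1' order_refl] by simp
      qed
      moreover have "m \<notin> ?P2"
      proof
        assume "m \<in> ?P2"
        then have m: "m \<in> P1" "\<forall>x\<in>front \<eta> P1. x < m"
          using RA_front(3)[OF P1', of \<eta>] by (auto simp: initial_def)
        obtain x where "x \<in> front \<eta> P1" using RA_front(2)[OF P1'] by blast
        then have "x \<in> P" "x < m" using m front_subset[OF P1'] P1(1) by (auto simp: infinite_subsets_def)
        then show False using Pm cInf_lower[of x P] by simp
      qed
      then have "?P2 \<in> infinite_subsets K"
        using P1 P1' RA_front(1)[OF P1', of \<eta>] by (auto simp: infinite_subsets_def P_def)
      ultimately show ?thesis using 5(2) by blast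
    qed
  qed
  obtain L where L: "infinite L" "L \<subseteq> M"
    "\<And>n F. 1 \<le> n \<Longrightarrow> F \<in> schreier (c a n) \<Longrightarrow> \<forall>i\<in>F. n \<le> i \<Longrightarrow> elt L ` F \<in> \<G>"
    using embeds_fusion[where \<S> = "\<lambda>n. schreier (c a n)" and \<G> = \<G>, OF inf spreading_schreier ex]
    by blast
  have "{} \<in> \<G>" using L(3)[of 1 "{}"] empty_in_schreier by auto
  then have "embeds (schreier a) L \<G>"
    using L(3) by (auto simp: embeds_def schreier_limit_iff[OF a])
  then show "\<exists>N\<in>infinite_subsets M. embeds (schreier a) N \<G>"
    using L by (auto simp: infinite_subsets_def)
qed

lemma large_embeds: "large_embeds a"
proof (induction a rule: less_induct)
  case (less a)
  then show ?case
    by (cases a rule: omega1_cases)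
      (auto intro: large_embeds_0 large_embeds_osuc large_embeds_limit less_osuc)
qed

end

section \<open>Functionals on weakly null sequences\<close>

definition dual_ball :: "('a::real_normed_vector \<Rightarrow> real) set" where
  "dual_ball = {f. bounded_linear f \<and> (\<forall>v. \<bar>f v\<bar> \<le> norm v)}"

text \<open>The graph of a linear functional of norm at most 1 on a subspace. It is single-valued
  because \<open>(0, r)\<close> and \<open>(0, - r)\<close> in \<open>S\<close> force
  \<open>r = 0\<close>. Graphs suit both unions of chains and pointwise limits, which arise as
  relations.\<close>

definition dominated :: "('a::real_normed_vector \<times> real) set \<Rightarrow> bool" where
  "dominated S \<longleftrightarrow> subspace S \<and> (\<forall>(v, r)\<in>S. r \<le> norm v)"

text \<open>The value at \<open>v0\<close> has to lie between all \<open>r - norm (v - v0)\<close>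
  and all \<open>norm (u + v0) - s\<close>; the triangle inequality separates the two sets, and the
  supremum of the first is taken.\<close>

lemma dominated_extend:
  fixes T :: "('a::real_normed_vector \<times> real) set"
  assumes T: "dominated T"
  obtains r0 where "dominated (span (insert (v0, r0) T))"
proof -
  have sub: "subspace T" and dom: "\<And>v r. (v, r) \<in> T \<Longrightarrow> r \<le> norm v"
    using T by (auto simp: dominated_def)
  have 0: "(0, 0) \<in> T" using subspace_0[OF sub] by (simp add: zero_prod_def)
  have lu: "r - norm (v - v0) \<le> norm (u + v0) - s" if "(v, r) \<in> T" "(u, s) \<in> T" for v r u s
  proof -
    have "r + s \<le> norm (v + u)" using subspace_add[OF sub that] dom by simp
    also have "\<dots> \<le> norm (v - v0) + norm (u + v0)" using norm_triangle_ineq[of "v - v0" "u + v0"] by simp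
    finally show ?thesis by simp
  qed
  define R where "R = (\<lambda>(v, r). r - norm (v - v0)) ` T"
  have R: "R \<noteq> {}" "bdd_above R"
    using 0 lu[OF _ 0] unfolding R_def by (auto intro!: bdd_aboveI[of _ "norm v0"])
  define r0 where "r0 = Sup R"
  have lo: "r - norm (v - v0) \<le> r0" if "(v, r) \<in> T" for v r
    unfolding r0_def using that by (intro cSup_upper R) (force simp: R_def)
  have up: "r0 \<le> norm (u + v0) - s" if "(u, s) \<in> T" for u s
    unfolding r0_def using lu[OF _ that] by (intro cSup_least R) (auto simp: R_def)
  have "r \<le> norm v" if "(v, r) \<in> span (insert (v0, r0) T)" for v r
  proof -
    have "\<exists>k. (v, r) - k *\<^sub>R (v0, r0) \<in> span T"
      using that by (simp only: span_insert mem_Collect_eq)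
    then obtain k where "(v, r) - k *\<^sub>R (v0, r0) \<in> span T" ..
    then have T': "(v - k *\<^sub>R v0, r - k * r0) \<in> T"
      unfolding iffD2[OF span_eq_iff sub] by simp
    consider "k = 0" | "k > 0" | "k < 0" by linarith
    then show ?thesis
    proof cases
      case 1
      then show ?thesis using T' dom by simp
    next
      case 2
      have "((1 / k) *\<^sub>R (v - k *\<^sub>R v0), (1 / k) * (r - k * r0)) \<in> T"
        using subspace_scale[OF sub T', of "1 / k"] by simp
      from up[OF this] have "r0 + (1 / k) * (r - k * r0) \<le> norm ((1 / k) *\<^sub>R (v - k *\<^sub>R v0) + v0)" by simp
      also have "(1 / k) *\<^sub>R (v - k *\<^sub>R v0) + v0 = (1 / k) *\<^sub>R v" using 2 by (simp add: algebra_simps)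
      finally show ?thesis using 2 by (simp add: field_simps)
    next
      case 3
      have "((- 1 / k) *\<^sub>R (v - k *\<^sub>R v0), (- 1 / k) * (r - k * r0)) \<in> T"
        using subspace_scale[OF sub T', of "- 1 / k"] by simp
      from lo[OF this] have "(- 1 / k) * (r - k * r0) - r0 \<le> norm ((- 1 / k) *\<^sub>R (v - k *\<^sub>R v0) - v0)" by simp
      also have "(- 1 / k) *\<^sub>R (v - k *\<^sub>R v0) - v0 = (- 1 / k) *\<^sub>R v" using 3 by (simp add: algebra_simps)
      finally show ?thesis using 3 by (simp add: field_simps)
    qed
  qed
  then have "dominated (span (insert (v0, r0) T))" by (auto simp: dominated_def)
  then show ?thesis using that by blast
qed

text \<open>A maximal dominated graph is defined everywhere, by the extension to one more
  vector.\<close>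

lemma hahn_banach_dominated:
  fixes S :: "('a::real_normed_vector \<times> real) set"
  assumes S: "dominated S"
  obtains f where "f \<in> dual_ball" "\<And>v r. (v, r) \<in> S \<Longrightarrow> f v = r"
proof -
  define \<A> where "\<A> = {T. dominated T \<and> S \<subseteq> T}"
  have "\<exists>T\<in>\<A>. \<forall>X\<in>\<A>. T \<subseteq> X \<longrightarrow> X = T"
  proof (rule subset_Zorn_nonempty)
    show "\<A> \<noteq> {}" using S by (auto simp: \<A>_def)
    fix C assume C: "C \<noteq> {}" "subset.chain \<A> C"
    have "subspace (\<Union>C)"
    proof (rule subspaceI)
      have CA: "\<And>T. T \<in> C \<Longrightarrow> subspace T" using C by (auto simp: subset.chain_def \<A>_def dominated_def)
      show "0 \<in> \<Union>C" using C(1) CA subspace_0 by blast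
      show "x + y \<in> \<Union>C" if xy: "x \<in> \<Union>C" "y \<in> \<Union>C" for x y
      proof -
        obtain X Y where XY: "X \<in> C" "Y \<in> C" "x \<in> X" "y \<in> Y" using xy by blast
        have "X \<subseteq> Y \<or> Y \<subseteq> X" using C(2) XY by (auto simp: subset.chain_def)
        then show ?thesis using XY CA subspace_add by blast
      qed
      show "k *\<^sub>R x \<in> \<Union>C" if "x \<in> \<Union>C" for k x using that CA subspace_scale by blast
    qed
    moreover have "\<forall>T\<in>C. S \<subseteq> T \<and> (\<forall>(v, r)\<in>T. r \<le> norm v)"
      using C(2) by (auto simp: subset.chain_def \<A>_def dominated_def)
    ultimately show "\<Union>C \<in> \<A>" using C(1) unfolding \<A>_def dominated_def by blast
  qed
  then obtain T where TA: "T \<in> \<A>" "\<forall>X\<in>\<A>. T \<subseteq> X \<longrightarrow> X = T" by blast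
  then have T: "dominated T" "S \<subseteq> T" by (auto simp: \<A>_def)
  have max: "X = T" if "dominated X" "T \<subseteq> X" for X
    using TA(2) T(2) that by (auto simp: \<A>_def)
  have sub: "subspace T" and dom: "\<And>v r. (v, r) \<in> T \<Longrightarrow> r \<le> norm v"
    using T by (auto simp: dominated_def)
  have total: "\<exists>r. (v, r) \<in> T" for v
  proof -
    obtain r0 where r0: "dominated (span (insert (v, r0) T))" using dominated_extend[OF T(1)] .
    have "T \<subseteq> span (insert (v, r0) T)"
      using subset_insertI span_superset by (rule subset_trans)
    then have "span (insert (v, r0) T) = T" by (rule max[OF r0])
    then show ?thesis using span_superset[of "insert (v, r0) T"] by blast
  qed
  have single: "r = s" if "(v, r) \<in> T" "(v, s) \<in> T" for v r s
    using dom[of 0 "r - s"] dom[of 0 "s - r"] subspace_diff[OF sub that] subspace_diff[OF sub that(2,1)]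
    by simp
  obtain f where f: "\<And>v. (v, f v) \<in> T" using total by metis
  have fv: "(v, r) \<in> T \<longleftrightarrow> f v = r" for v r using f single by blast
  have bound: "\<bar>f v\<bar> \<le> norm v" for v
    using dom[OF f[of v]] dom[of "- v" "- f v"] subspace_neg[OF sub f[of v]] by simp
  have "bounded_linear f"
  proof (rule bounded_linear_intro[where K = 1])
    show "f (u + v) = f u + f v" for u v
      using subspace_add[OF sub f f, of u v] by (simp add: fv)
    show "f (k *\<^sub>R v) = k *\<^sub>R f v" for k v
      using subspace_scale[OF sub f, of k v] by (simp add: fv)
    show "norm (f v) \<le> norm v * 1" for v using bound by simp
  qed
  then have "f \<in> dual_ball" using bound by (simp add: dual_ball_def)
  then show ?thesis using that[of f] fv T(2) by blast
qed

lemma norming_functional: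
  fixes v :: "'a::real_normed_vector"
  obtains f where "f \<in> dual_ball" "f v = norm v"
proof -
  have "dominated (range (\<lambda>k. k *\<^sub>R (v, norm v)))"
    unfolding dominated_def
  proof
    show "subspace (range (\<lambda>k. k *\<^sub>R (v, norm v)))"
      using subspace_span[of "{(v, norm v)}"] by (simp add: span_singleton)
  qed (auto simp: mult_right_mono)
  then obtain f where f: "f \<in> dual_ball" "\<And>u r. (u, r) \<in> range (\<lambda>k. k *\<^sub>R (v, norm v)) \<Longrightarrow> f u = r"
    using hahn_banach_dominated by blast
  have "(v, norm v) \<in> range (\<lambda>k. k *\<^sub>R (v, norm v))" by (auto intro: image_eqI[of _ _ 1])
  then show ?thesis using f that by blast
qed

text \<open>The functional \<open>f\<close> is the limit of partial sums of \<open>\<Sum>k. \<plusminus>g k / 3 ^ k\<close>, with \<open>g k\<close> norming for a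
  vector \<open>v k\<close> of the sequence of norm at least \<open>4 ^ k\<close> and the sign chosen such that the \<open>k\<close>-th
  partial sum is large at \<open>v k\<close>; the remaining terms are too small to cancel this value.\<close>

lemma weakly_null_bounded:
  fixes x :: "nat \<Rightarrow> 'a::real_normed_vector"
  assumes wn: "weakly_null x"
  obtains K where "K > 0" "\<And>n. norm (x n) \<le> K"
proof (rule ccontr)
  assume neg: "\<not> thesis"
  have "\<exists>n. norm (x n) \<ge> 4 ^ k" for k :: nat
  proof (rule ccontr)
    assume "\<nexists>n. norm (x n) \<ge> 4 ^ k"
    then have "\<And>n. norm (x n) \<le> 4 ^ k" by (simp add: not_le less_imp_le)
    then show False using neg that[of "4 ^ k"] by simp
  qed
  then obtain n where n: "\<And>k. norm (x (n k)) \<ge> 4 ^ k" by metis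
  define v where "v k = x (n k)" for k
  have "\<exists>g. norm g \<le> 1 \<and> blinfun_apply g (v k) = norm (v k)" for k
  proof -
    obtain f where f: "f \<in> dual_ball" "f (v k) = norm (v k)" using norming_functional by blast
    then have bl: "bounded_linear f" "\<And>w. \<bar>f w\<bar> \<le> norm w" by (auto simp: dual_ball_def)
    have "norm (Blinfun f) \<le> 1"
      by (rule norm_blinfun_bound) (use bl in \<open>simp_all add: bounded_linear_Blinfun_apply\<close>)
    then show ?thesis using f bl by (intro exI[of _ "Blinfun f"]) (simp add: bounded_linear_Blinfun_apply)
  qed
  then obtain g where g: "\<And>k. norm (g k) \<le> 1" "\<And>k. blinfun_apply (g k) (v k) = norm (v k)" by metis
  define h where "h k F = (if F (v k) \<ge> 0 then (1/3)^k *\<^sub>R g k else - ((1/3)^k *\<^sub>R g k))"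
    for k and F :: "'a \<Rightarrow>\<^sub>L real"
  define F where "F = rec_nat (0 :: 'a \<Rightarrow>\<^sub>L real) (\<lambda>k F. F + h k F)"
  have FS: "F (Suc k) = F k + h k (F k)" for k by (simp add: F_def)
  have hn: "norm (h k G) \<le> (1/3)^k" for k G
    using g(1)[of k] by (simp add: h_def mult_left_le)
  have big: "(1/3)^k * norm (v k) \<le> \<bar>F (Suc k) (v k)\<bar>" for k
  proof (cases "0 \<le> F k (v k)")
    case False
    moreover have "0 \<le> (1/3)^k * norm (v k)" by simp
    ultimately show ?thesis unfolding FS h_def by (simp add: blinfun.bilinear_simps g(2))
  qed (simp add: FS h_def blinfun.bilinear_simps g(2))
  \<comment> \<open>The bound is the geometric sum of \<open>(1/3)^j\<close> over
    \<open>k \<le> j < k + m\<close>.\<close>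
  have diff: "norm (F (k + m) - F k) \<le> 3/2 * ((1/3)^k - (1/3)^(k + m))" for k m
  proof (induction m)
    case (Suc m)
    have "norm (F (k + Suc m) - F k) \<le> norm (F (k + m) - F k) + norm (h (k + m) (F (k + m)))"
      using norm_triangle_ineq[of "F (k + m) - F k" "h (k + m) (F (k + m))"] FS[of "k + m"]
      by (simp add: algebra_simps)
    also have "\<dots> \<le> 3/2 * ((1/3)^k - (1/3)^(k + m)) + (1/3)^(k + m)"
      by (intro add_mono Suc hn)
    also have "\<dots> = 3/2 * ((1/3)^k - (1/3)^(k + m) / 3)" by (simp add: right_diff_distrib)
    also have "(1/3)^(k + m) / 3 = (1/3 :: real)^(k + Suc m)" by simp
    finally show ?case .
  qed simp
  have diff': "norm (F m - F k) \<le> 3/2 * (1/3)^k" if "k \<le> m" for k m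
  proof -
    have "norm (F m - F k) \<le> 3/2 * ((1/3)^k - (1/3)^m)" using diff[of k "m - k"] that by simp
    also have "\<dots> \<le> 3/2 * (1/3)^k" by simp
    finally show ?thesis .
  qed
  have "Cauchy F"
  proof (rule CauchyI')
    fix e :: real assume "0 < e"
    have "(\<lambda>k. 3/2 * (1/3)^k :: real) \<longlonglongrightarrow> 3/2 * 0"
      by (intro tendsto_mult tendsto_const LIMSEQ_power_zero) simp
    then obtain M where M: "3/2 * (1/3)^M < e"
      using \<open>0 < e\<close> by (metis (mono_tags, lifting) eventually_sequentially mult_zero_right order_tendstoD(2) order_refl)
    have "norm (F m - F k) < e" if "M \<le> m" "m < k" for m k
    proof -
      have "norm (F k - F m) \<le> 3/2 * (1/3)^m" using diff' that by simp
      also have "\<dots> \<le> 3/2 * (1/3)^M" using that by (intro mult_left_mono power_decreasing) auto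
      finally show ?thesis using M by (simp add: norm_minus_commute)
    qed
    then show "\<exists>M. \<forall>m\<ge>M. \<forall>n>m. dist (F m) (F n) < e" unfolding dist_norm by blast
  qed
  then obtain f where f: "F \<longlonglongrightarrow> f" using Cauchy_convergent convergent_def by blast
  have near: "norm (f - F k) \<le> 3/2 * (1/3)^k" for k
  proof (rule Lim_bounded)
    show "(\<lambda>m. norm (F m - F k)) \<longlonglongrightarrow> norm (f - F k)" by (intro tendsto_intros f)
  qed (use diff' in blast)
  \<comment> \<open>The terms after the k-th have total norm at most
    \<open>3/2 * (1/3)^Suc k\<close>, half of \<open>(1/3)^k\<close>, so half of the value at
    \<open>v k\<close> survives. With \<open>norm (v k) \<ge> 4^k\<close> this gives
    \<open>(1/2) * (4/3)^k\<close>.\<close>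
  have low: "(1/2) * (4/3)^k \<le> \<bar>f (v k)\<bar>" for k
  proof -
    have "\<bar>f (v k) - F (Suc k) (v k)\<bar> \<le> norm (f - F (Suc k)) * norm (v k)"
      using norm_blinfun[of "f - F (Suc k)" "v k"] by (simp add: blinfun.diff_left)
    also have "\<dots> \<le> 3/2 * (1/3)^Suc k * norm (v k)" by (intro mult_right_mono near) simp
    finally have "(1/2) * ((1/3)^k * norm (v k)) \<le> \<bar>f (v k)\<bar>"
      using big[of k] by (simp add: abs_if split: if_splits)
    moreover have "(4/3)^k \<le> (1/3)^k * norm (v k)"
      using n[of k] by (simp add: v_def power_divide divide_right_mono)
    ultimately show ?thesis by linarith
  qed
  have "(\<lambda>m. f (x m)) \<longlonglongrightarrow> 0"
    using wn blinfun.bounded_linear_right[of f] by (simp add: weakly_null_def)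
  then have "Bseq (\<lambda>m. f (x m))" using convergentI convergent_imp_Bseq by blast
  then obtain B where B: "\<And>m. \<bar>f (x m)\<bar> \<le> B" by (auto simp: Bseq_def)
  obtain k where k: "2 * B < (4/3)^k" using real_arch_pow[of "4/3" "2 * B"] by auto
  show False using low[of k] B[of "n k"] k unfolding v_def by linarith
qed

text \<open>A diagonal subsequence converges at all the countably many \<open>x n\<close>. The
  relation between vectors and the limits at them is a dominated graph, and Hahn-Banach extends it
  to a functional on the whole space.\<close>

lemma dual_ball_limit:
  fixes x :: "nat \<Rightarrow> 'a::real_normed_vector"
  assumes wn: "weakly_null x" and F: "\<And>l::nat. F l \<in> dual_ball"
  obtains f r where "f \<in> dual_ball" "strict_mono r" "\<And>n. (\<lambda>l. F (r l) (x n)) \<longlonglongrightarrow> f (x n)"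
proof -
  obtain K where K: "\<And>n. norm (x n) \<le> K" using weakly_null_bounded[OF wn] by blast
  have FB: "bounded_linear (F l)" "\<bar>F l v\<bar> \<le> norm v" for l v using F by (auto simp: dual_ball_def)
  have FK: "norm (F l v) \<le> K" if "v \<in> range x" for l v
    using that FB(2)[of l v] K by (auto intro: order_trans)
  obtain r where r: "strict_mono r" "\<And>v. v \<in> range x \<Longrightarrow> \<exists>t. (\<lambda>l. F (r l) v) \<longlonglongrightarrow> t"
    by (rule function_convergent_subsequence[of "range x" F K]) (use FK in auto)
  define S where "S = {(v, t). (\<lambda>l. F (r l) v) \<longlonglongrightarrow> t}"
  have "dominated S" unfolding dominated_def
  proof
    show "subspace S"
      by (rule subspaceI)
        (auto simp: S_def zero_prod_def linear_simps[OF FB(1)] intro!: tendsto_add tendsto_mult_left)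
    have "t \<le> norm v" if "(\<lambda>l. F (r l) v) \<longlonglongrightarrow> t" for v t
      using that FB(2) by (intro LIMSEQ_le_const2[OF that]) (meson abs_le_D1)
    then show "\<forall>(v, r)\<in>S. r \<le> norm v" by (auto simp: S_def)
  qed
  then obtain f where f: "f \<in> dual_ball" "\<And>v t. (v, t) \<in> S \<Longrightarrow> f v = t"
    using hahn_banach_dominated by blast
  have "(\<lambda>l. F (r l) (x n)) \<longlonglongrightarrow> f (x n)" for n
    using r(2)[of "x n"] f(2) by (auto simp: S_def)
  then show ?thesis using that f(1) r(1) by blast
qed

text \<open>Otherwise there are functionals that are at least e on the first l points for every l,
  and a limit of them is at least e on all points of \<open>T\<close>.\<close>

lemma weakly_null_not_uniformly_large:
  fixes x :: "nat \<Rightarrow> 'a::real_normed_vector"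
  assumes wn: "weakly_null x" and T: "infinite T" and e: "0 < e"
  obtains l where "\<And>f. f \<in> dual_ball \<Longrightarrow> \<exists>i<l. f (x (enumerate T i)) < e"
proof (rule ccontr)
  assume "\<not> thesis"
  then have "\<forall>l. \<exists>f\<in>dual_ball. \<forall>i<l. e \<le> f (x (enumerate T i))"
    using that by (metis not_le)
  then obtain F where F: "\<And>l. F l \<in> dual_ball" "\<And>l i. i < l \<Longrightarrow> e \<le> F l (x (enumerate T i))" by metis
  obtain f r where f: "f \<in> dual_ball" "strict_mono r" "\<And>n. (\<lambda>l. F (r l) (x n)) \<longlonglongrightarrow> f (x n)"
    using dual_ball_limit[where F = F, OF wn F(1)] by blast
  have "e \<le> f (x (enumerate T i))" for i
  proof (rule LIMSEQ_le_const[OF f(3)])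
    have "i < r l" if "Suc i \<le> l" for l using seq_suble[OF f(2), of l] that by linarith
    then show "\<exists>N. \<forall>l\<ge>N. e \<le> F (r l) (x (enumerate T i))" using F(2) by blast
  qed
  moreover have "(\<lambda>i. f (x (enumerate T i))) \<longlonglongrightarrow> 0"
  proof -
    have "(\<lambda>n. f (x n)) \<longlonglongrightarrow> 0" using wn f(1) by (simp add: weakly_null_def dual_ball_def)
    then show ?thesis using LIMSEQ_subseq_LIMSEQ[OF _ strict_mono_enumerate[OF T]] by (simp add: o_def)
  qed
  ultimately have "e \<le> 0" by (intro LIMSEQ_le_const[of _ 0]) auto
  then show False using e by simp
qed

text \<open>Given a functional that is large on \<open>G\<close>, the points of \<open>s - G\<close> are handled one at a time in
  increasing order: among the candidates for the next point of \<open>L\<close>, many would have to be bad for one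
  and the same functional, against weak nullity.\<close>

lemma weakly_null_separation:
  fixes x :: "nat \<Rightarrow> 'a::real_normed_vector"
  assumes wn: "weakly_null x" and e: "0 < e" and M: "infinite M"
  obtains L where "infinite L" "L \<subseteq> M"
    "\<And>s G f. finite s \<Longrightarrow> s \<subseteq> L \<Longrightarrow> G \<subseteq> s \<Longrightarrow> f \<in> dual_ball \<Longrightarrow> \<forall>i\<in>G. e \<le> f (x i) \<Longrightarrow>
      \<exists>g\<in>dual_ball. (\<forall>i\<in>G. e \<le> g (x i)) \<and> (\<forall>i\<in>s - G. g (x i) \<le> e / 2)"
proof -
  \<comment> \<open>\<open>A\<close> consists of the points handled so far, \<open>G0\<close> is the
    part of \<open>G\<close> among them, and \<open>G1\<close> is the part of \<open>G\<close> still
    to come.\<close>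
  define good where "good A G0 G1 \<longleftrightarrow> (\<exists>f\<in>dual_ball. (\<forall>i\<in>G0 \<union> G1. e \<le> f (x i)) \<and>
      (\<forall>i\<in>A - G0. f (x i) \<le> e / 2))" for A G0 G1
  define step where "step A G0 N \<longleftrightarrow> (\<forall>q\<in>N. \<forall>G1. finite G1 \<and> G1 \<subseteq> N \<and> (\<forall>g\<in>G1. q < g) \<and> good A G0 G1 \<longrightarrow>
      good (insert q A) G0 G1)" for A G0 N
  have step_ex: "\<exists>N'\<subseteq>N. infinite N' \<and> step A G0 N'" if N: "infinite N" for A G0 N
  proof -
    \<comment> \<open>A failure of \<open>step\<close> is coded by a single finite set, with the new
      point as its minimum and \<open>G1\<close> as the remainder, so that \<open>galvin\<close>
      applies.\<close>
    define B where "B s \<longleftrightarrow> s \<noteq> {} \<and> good A G0 (s - {Min s}) \<and> \<not> good (insert (Min s) A) G0 (s - {Min s})"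
      for s
    show ?thesis
    proof (rule galvin[OF N, of B])
      fix N' assume N': "infinite N'" "N' \<subseteq> N" "\<And>s. finite s \<Longrightarrow> s \<subseteq> N' \<Longrightarrow> \<not> B s"
      have "good (insert q A) G0 G1"
        if q: "q \<in> N'" and G1: "finite G1" "G1 \<subseteq> N'" "\<forall>g\<in>G1. q < g" "good A G0 G1" for q G1
      proof -
        have "Min (insert q G1) = q" using G1 by (intro Min_eqI) (auto simp: less_imp_le)
        moreover have "insert q G1 - {q} = G1" using G1 by auto
        ultimately show ?thesis using N'(3)[of "insert q G1"] q G1 by (auto simp: B_def)
      qed
      then show ?thesis using N' unfolding step_def by blast
    next
      fix N' assume N': "infinite N'" "N' \<subseteq> N" "\<And>P. infinite P \<Longrightarrow> P \<subseteq> N' \<Longrightarrow> \<exists>n. B (P \<inter> {..<n})"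
      obtain l where l: "\<And>f. f \<in> dual_ball \<Longrightarrow> \<exists>i<l. f (x (enumerate N' i)) < e / 2"
        using weakly_null_not_uniformly_large[OF wn N'(1), of "e / 2"] e by auto
      have l0: "l > 0"
      proof -
        obtain f :: "'a \<Rightarrow> real" where "f \<in> dual_ball" using norming_functional by blast
        then show ?thesis using l by fastforce
      qed
      define R where "R = N' \<inter> {enumerate N' l..}"
      define q where "q i = enumerate N' i" for i
      have "infinite R"
        using infinite_beyond[of "{..<enumerate N' l}" N'] N'(1) unfolding R_def
        by (rule_tac infinite_super) (auto simp: beyond_def)
      have qR: "\<forall>g\<in>R. q i < g" if "i < l" for i
        using enumerate_mono[OF that N'(1)] unfolding q_def R_def by auto
      have "\<exists>n. good A G0 (R \<inter> {..<n}) \<and> \<not> good (insert (q i) A) G0 (R \<inter> {..<n})" if i: "i < l" for i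
      proof -
        have "infinite (insert (q i) R)" "insert (q i) R \<subseteq> N'"
          using \<open>infinite R\<close> N'(1) by (auto simp: R_def q_def enumerate_in_set)
        from N'(3)[OF this] obtain n where n: "B (insert (q i) R \<inter> {..<n})" ..
        then have "insert (q i) R \<inter> {..<n} \<noteq> {}" by (simp add: B_def)
        then obtain g where "g \<in> insert (q i) R" "g < n" by blast
        then have "q i < n" using qR[OF i] by (metis insertE less_trans)
        then have s: "insert (q i) R \<inter> {..<n} = insert (q i) (R \<inter> {..<n})" by auto
        have "Min (insert (q i) (R \<inter> {..<n})) = q i"
          using qR[OF i] by (intro Min_eqI) (auto simp: less_imp_le)
        moreover have "insert (q i) (R \<inter> {..<n}) - {q i} = R \<inter> {..<n}" using qR[OF i] by auto
        ultimately show ?thesis using n unfolding s B_def by metis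
      qed
      then obtain n where n: "\<And>i. i < l \<Longrightarrow> good A G0 (R \<inter> {..<n i})"
        "\<And>i. i < l \<Longrightarrow> \<not> good (insert (q i) A) G0 (R \<inter> {..<n i})" by metis
      \<comment> \<open>The longest of the segments \<open>R \<inter> {..<n i}\<close> contains all
        others. Its functional is large on each of them, so it must be at least \<open>e / 2\<close>
        at every candidate \<open>q i\<close>, since otherwise it would witness \<open>good\<close>
        there; this contradicts the choice of \<open>l\<close>.\<close>
      obtain i0 where i0: "i0 < l" "\<And>i. i < l \<Longrightarrow> n i \<le> n i0"
      proof -
        have "finite (n ` {..<l})" "n ` {..<l} \<noteq> {}" using l0 by auto
        then have "Max (n ` {..<l}) \<in> n ` {..<l}" by (rule Max_in)
        then obtain i0 where "i0 < l" "Max (n ` {..<l}) = n i0" by blast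
        then show ?thesis using that[of i0] Max_ge[of "n ` {..<l}"] by simp
      qed
      obtain f where f: "f \<in> dual_ball" "\<forall>i\<in>G0 \<union> (R \<inter> {..<n i0}). e \<le> f (x i)"
        "\<forall>i\<in>A - G0. f (x i) \<le> e / 2"
        using n(1)[OF i0(1)] unfolding good_def by blast
      have "\<not> f (x (q i)) < e / 2" if i: "i < l" for i
      proof
        assume "f (x (q i)) < e / 2"
        moreover have "\<forall>j\<in>G0 \<union> (R \<inter> {..<n i}). e \<le> f (x j)" using f(2) i0(2)[OF i] by auto
        ultimately have "good (insert (q i) A) G0 (R \<inter> {..<n i})"
          unfolding good_def using f(1,3) by (intro bexI[of _ f]) auto
        then show False using n(2)[OF i] by blast
      qed
      then show ?thesis using l[OF f(1)] by (auto simp: q_def)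
    qed
  qed
  have step_her: "step A G0 N'" if "step A G0 N" "N' \<subseteq> N" for A G0 N N'
    using that unfolding step_def by blast
  define Q where "Q A N \<longleftrightarrow> (\<forall>G0\<in>Pow A. step A G0 N)" for A N
  have Q_ex: "\<exists>N'\<subseteq>N. infinite N' \<and> Q A N'" if "finite A" "infinite N" for A N
    unfolding Q_def
  proof (rule finite_refine[OF _ _ _ that(2) order_refl])
    show "finite (Pow A)" using that by simp
    show "\<exists>N'\<subseteq>K. infinite N' \<and> step A G N'" if "infinite K" for G K using step_ex[OF that] .
    show "step A G N'" if "step A G K" "N' \<subseteq> K" for G K N' using step_her[OF that] .
  qed
  have Q_her: "Q A N'" if "Q A N" "N' \<subseteq> N" for A N N' using that step_her unfolding Q_def by blast
  obtain L where L: "infinite L" "L \<subseteq> M" "\<And>s. finite s \<Longrightarrow> s \<subseteq> L \<Longrightarrow> Q s (beyond s L)"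
    by (rule fusion_beyond[where Q = Q, OF M]) (erule (1) Q_ex, erule (1) Q_her, blast)
  show ?thesis
  proof
    fix s G f assume s: "finite s" "s \<subseteq> L" "G \<subseteq> s" and f: "f \<in> dual_ball" "\<forall>i\<in>G. e \<le> f (x i)"
    have "good (s \<inter> {..<n}) (G \<inter> {..<n}) (G \<inter> {n..})" for n
    proof (induction n)
      case 0
      then show ?case using f unfolding good_def by auto
    next
      case (Suc n)
      consider "n \<notin> s" | "n \<in> G" | "n \<in> s - G" by blast
      then show ?case
      proof cases
        case 1
        then have "s \<inter> {..<Suc n} = s \<inter> {..<n}" "G \<inter> {..<Suc n} = G \<inter> {..<n}" "G \<inter> {Suc n..} = G \<inter> {n..}"
          using s(3) by (auto simp: less_Suc_eq Suc_le_eq le_less)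
        then show ?thesis using Suc by simp
      next
        case 2
        have eq: "G \<inter> {..<Suc n} \<union> G \<inter> {Suc n..} = G \<inter> {..<n} \<union> G \<inter> {n..}" by auto
        have sub: "s \<inter> {..<Suc n} - G \<inter> {..<Suc n} \<subseteq> s \<inter> {..<n} - G \<inter> {..<n}"
          using 2 by (auto simp: less_Suc_eq)
        obtain h where "h \<in> dual_ball" "\<forall>i\<in>G \<inter> {..<n} \<union> G \<inter> {n..}. e \<le> h (x i)"
          "\<forall>i\<in>s \<inter> {..<n} - G \<inter> {..<n}. h (x i) \<le> e / 2"
          using Suc unfolding good_def by blast
        then show ?thesis using sub unfolding good_def eq by (intro bexI[of _ h]) blast+
      next
        case 3
        let ?A = "s \<inter> {..<n}"
        have eq: "G \<inter> {Suc n..} = G \<inter> {n..}" "G \<inter> {..<Suc n} = G \<inter> {..<n}" "s \<inter> {..<Suc n} = insert n ?A"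
          using 3 by (auto simp: less_Suc_eq Suc_le_eq le_less)
        have "Q ?A (beyond ?A L)" using L(3) s by auto
        then have "step ?A (G \<inter> {..<n}) (beyond ?A L)" using s(3) by (auto simp: Q_def)
        moreover have "n \<in> beyond ?A L" using 3 s by (auto simp: beyond_def)
        moreover have "G \<inter> {Suc n..} \<subseteq> beyond ?A L" "finite (G \<inter> {Suc n..})"
          using s finite_subset[of G s] by (auto simp: beyond_def)
        moreover have "\<forall>g\<in>G \<inter> {Suc n..}. n < g" by auto
        ultimately show ?thesis using Suc unfolding step_def eq(2,3) unfolding eq(1)[symmetric] by blast
      qed
    qed
    then have "good (s \<inter> {..<Suc (Max s)}) (G \<inter> {..<Suc (Max s)}) (G \<inter> {Suc (Max s)..})" .
    moreover have "s \<inter> {..<Suc (Max s)} = s" using s by (auto simp: less_Suc_eq_le)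
    moreover have "G \<inter> {..<Suc (Max s)} = G" using s by (auto simp: less_Suc_eq_le)
    ultimately show "\<exists>g\<in>dual_ball. (\<forall>i\<in>G. e \<le> g (x i)) \<and> (\<forall>i\<in>s - G. g (x i) \<le> e / 2)"
      unfolding good_def by auto
  qed (use L in auto)
qed

section \<open>The dichotomy\<close>

lemma sum_lessThan_add:
  fixes y :: "nat \<Rightarrow> 'a::comm_monoid_add"
  shows "(\<Sum>j<k + w. y j) = (\<Sum>j<k. y j) + (\<Sum>i<w. y (k + i))"
  by (induction w) (simp_all add: add.assoc)

text \<open>Windows of length \<open>w\<close> are stripped from the end until fewer than
  \<open>m + w\<close> terms are left, and only these are estimated by \<open>K\<close>.\<close>

lemma cesaro_window_bound:
  fixes y :: "nat \<Rightarrow> 'a::real_normed_vector"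
  assumes K: "\<And>j. norm (y j) \<le> K" and w: "1 \<le> w"
    and win: "\<And>k. m \<le> k \<Longrightarrow> norm (\<Sum>i<w. y (k + i)) \<le> real w * \<eta>" and \<eta>: "0 \<le> \<eta>"
  shows "norm (\<Sum>j<n. y j) \<le> real (m + w) * K + real n * \<eta>"
proof (induction n rule: less_induct)
  case (less n)
  have K0: "0 \<le> K" using K[of 0] norm_ge_zero order_trans by blast
  show ?case
  proof (cases "n < m + w")
    case True
    have "norm (\<Sum>j<n. y j) \<le> real n * K" using sum_norm_bound[of "{..<n}" y K] K by simp
    also have "\<dots> \<le> real (m + w) * K" using True K0 by (intro mult_right_mono) auto
    also have "\<dots> \<le> real (m + w) * K + real n * \<eta>" using \<eta> by simp
    finally show ?thesis .
  next
    case False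
    define k where "k = n - w"
    have n: "n = k + w" "m \<le> k" "k < n" using False w by (auto simp: k_def)
    have "(\<Sum>j<n. y j) = (\<Sum>j<k. y j) + (\<Sum>i<w. y (k + i))"
      unfolding n(1) by (rule sum_lessThan_add)
    then have "norm (\<Sum>j<n. y j) \<le> norm (\<Sum>j<k. y j) + norm (\<Sum>i<w. y (k + i))"
      using norm_triangle_ineq by metis
    also have "\<dots> \<le> (real (m + w) * K + real k * \<eta>) + real w * \<eta>"
      by (intro add_mono less win n)
    also have "\<dots> = real (m + w) * K + real n * \<eta>" unfolding n(1) by (simp add: algebra_simps)
    finally show ?thesis .
  qed
qed

context ladder_system
begin

definition RA_sum :: "(nat \<Rightarrow> 'a::real_normed_vector) \<Rightarrow> omega1 \<Rightarrow> nat set \<Rightarrow> nat \<Rightarrow> 'a" where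
  "RA_sum x a M j = (\<Sum>i. RA a M j i *\<^sub>R x i)"

lemma supp_RA:
  assumes "M \<in> infinite_subsets {1..}" "1 \<le> j"
  shows "finite (supp (RA a M j))" "supp (RA a M j) \<subseteq> rest a M (j - 1)"
    "(\<Sum>i\<in>supp (RA a M j). RA a M j i) = 1"
proof -
  have R: "rest a M (j - 1) \<in> infinite_subsets {1..}" using rest_infinite[OF assms(1)] .
  have "RA a M j = RA a (rest a M (j - 1)) 1"
    using RA_rest[OF assms(1), of a "j - 1"] assms(2) by simp
  then show "finite (supp (RA a M j))" "supp (RA a M j) \<subseteq> rest a M (j - 1)"
    "(\<Sum>i\<in>supp (RA a M j). RA a M j i) = 1"
    using RA_front(1,6)[OF R, of a] front_subset[OF R, of a] by simp_all
qed

lemma RA_sum_eq: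
  assumes "M \<in> infinite_subsets {1..}" "1 \<le> j" "finite S" "supp (RA a M j) \<subseteq> S"
  shows "RA_sum x a M j = (\<Sum>i\<in>S. RA a M j i *\<^sub>R x i)"
  unfolding RA_sum_def using assms(3,4) by (intro suminf_finite) (auto simp: supp_def)

lemma RA_sum_le:
  fixes f :: "'a::real_normed_vector \<Rightarrow> real"
  assumes M: "M \<in> infinite_subsets {1..}" and j: "1 \<le> j" and f: "bounded_linear f"
    and b: "\<And>i. i \<in> supp (RA a M j) \<Longrightarrow> \<bar>f (x i)\<bar> \<le> B"
  shows "\<bar>f (RA_sum x a M j)\<bar> \<le> B"
proof -
  let ?S = "supp (RA a M j)"
  have "f (RA_sum x a M j) = (\<Sum>i\<in>?S. RA a M j i * f (x i))"
    unfolding RA_sum_eq[OF M j supp_RA(1)[OF M j] order_refl]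
    by (simp add: linear_sum[OF bounded_linear.linear[OF f]] linear_simps(5)[OF f])
  also have "\<bar>\<dots>\<bar> \<le> (\<Sum>i\<in>?S. RA a M j i * B)"
    using b RA_nonneg[OF M j, of a]
    by (intro order_trans[OF sum_abs] sum_mono) (simp add: abs_mult mult_left_mono)
  also have "\<dots> = B" using supp_RA(3)[OF M j, of a] by (simp flip: sum_distrib_right)
  finally show ?thesis .
qed

lemma norm_RA_sum_le:
  assumes M: "M \<in> infinite_subsets {1..}" and j: "1 \<le> j" and K: "\<And>i. norm (x i) \<le> K"
  shows "norm (RA_sum x a M j) \<le> K"
proof -
  obtain f where f: "f \<in> dual_ball" "f (RA_sum x a M j) = norm (RA_sum x a M j)"
    using norming_functional by blast
  then have fl: "bounded_linear f" "\<And>v. \<bar>f v\<bar> \<le> norm v" by (auto simp: dual_ball_def)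
  have "\<bar>f (RA_sum x a M j)\<bar> \<le> K"
    by (rule RA_sum_le[OF M j fl(1)]) (rule order_trans[OF fl(2) K])
  then show ?thesis using f(2) by simp
qed

lemma summable_RA_iff:
  "summable_RA M a x \<longleftrightarrow> convergent (\<lambda>n. (1 / real n) *\<^sub>R (\<Sum>j<n. RA_sum x a M (Suc j)))"
  unfolding summable_RA_def RA_sum_def
  using sum.atLeast1_atMost_eq[of "\<lambda>k. \<Sum>i. RA a M k i *\<^sub>R x i"] by simp

text \<open>Each of the k removed supports contains at least one positive integer.\<close>

lemma rest_ge:
  assumes "M \<in> infinite_subsets {1..}"
  shows "n \<in> rest a M k \<Longrightarrow> Suc k \<le> n"
proof (induction k arbitrary: n)
  case 0
  then show ?case using assms by (auto simp: infinite_subsets_def)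
next
  case (Suc k)
  have R: "rest a M k \<in> infinite_subsets {1..}" using rest_infinite[OF assms] .
  obtain m where m: "m \<in> front a (rest a M k)" using RA_front(2)[OF R] by blast
  then have "Suc k \<le> m" using Suc.IH front_subset[OF R] by blast
  moreover have "m < n" using RA_front(3)[OF R, of a] m Suc.prems by (auto simp: initial_def)
  ultimately show ?case by simp
qed

lemma large_averages_imp_spreading_model:
  fixes x :: "nat \<Rightarrow> 'a::real_normed_vector"
  assumes wn: "weakly_null x" and L: "L \<in> infinite_subsets {1..}" and \<epsilon>: "0 < \<epsilon>"
    and big: "\<forall>P\<in>infinite_subsets L. \<epsilon> < norm (RA_sum x a P 1)"
  shows "\<exists>N\<in>infinite_subsets L. l1_spreading_model a N x"
proof -
  obtain K where K: "0 < K" "\<And>n. norm (x n) \<le> K" using weakly_null_bounded[OF wn] by blast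
  define e where "e = \<epsilon> / 2"
  have e: "0 < e" using \<epsilon> by (simp add: e_def)
  have "infinite L" using L by (simp add: infinite_subsets_def)
  then obtain L' where L': "infinite L'" "L' \<subseteq> L"
    "\<And>s G f. finite s \<Longrightarrow> s \<subseteq> L' \<Longrightarrow> G \<subseteq> s \<Longrightarrow> f \<in> dual_ball \<Longrightarrow> \<forall>i\<in>G. e \<le> f (x i) \<Longrightarrow>
      \<exists>g\<in>dual_ball. (\<forall>i\<in>G. e \<le> g (x i)) \<and> (\<forall>i\<in>s - G. g (x i) \<le> e / 2)"
    using weakly_null_separation[OF wn e] by blast
  define \<G> where "\<G> = {G. finite G \<and> (\<exists>f\<in>dual_ball. \<forall>i\<in>G. e \<le> f (x i))}"
  have "hereditary \<G>" unfolding hereditary_def \<G>_def using finite_subset by blast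
  moreover have L'': "L' \<in> infinite_subsets {1..}" using L L' by (auto simp: infinite_subsets_def)
  \<comment> \<open>A norming functional exceeds 2 e at the average. Points with value below e
    contribute at most e in total, those in \<open>G\<close> at most \<open>K\<close> times their
    mass, so this mass is at least \<open>e / K\<close>.\<close>
  moreover have "large a (e / K) 1 \<G> P" if P: "P \<in> infinite_subsets L'" for P
  proof -
    have P': "P \<in> infinite_subsets {1..}" using infinite_subsets_trans[OF P L''] .
    have PL: "P \<in> infinite_subsets L" using P L' by (auto simp: infinite_subsets_def)
    let ?S = "front a P"
    have S: "finite ?S" using RA_front(1)[OF P'] .
    obtain f where f: "f \<in> dual_ball" "f (RA_sum x a P 1) = norm (RA_sum x a P 1)"
      using norming_functional by blast
    have fl: "bounded_linear f" "\<And>v. \<bar>f v\<bar> \<le> norm v" using f by (auto simp: dual_ball_def)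
    have nn: "0 \<le> RA a P 1 i" for i using RA_front(5)[OF P'] .
    define G where "G = {i \<in> ?S. e \<le> f (x i)}"
    have "f (RA_sum x a P 1) = (\<Sum>i\<in>?S. RA a P 1 i * f (x i))"
      unfolding RA_sum_eq[OF P' order_refl S order_refl]
      by (simp add: linear_sum[OF bounded_linear.linear[OF fl(1)]] linear_simps(5)[OF fl(1)])
    also have "\<dots> \<le> (\<Sum>i\<in>?S. (if i \<in> G then RA a P 1 i * K else 0) + RA a P 1 i * e)"
    proof (rule sum_mono)
      fix i assume "i \<in> ?S"
      have "f (x i) \<le> K" using fl(2)[of "x i"] K(2)[of i] by linarith
      then have "RA a P 1 i * f (x i) \<le> RA a P 1 i * K" using nn by (simp add: mult_left_mono)
      moreover have "0 \<le> RA a P 1 i * e" using nn e by simp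
      moreover have "RA a P 1 i * f (x i) \<le> RA a P 1 i * e" if "i \<notin> G"
        using that \<open>i \<in> ?S\<close> nn by (intro mult_left_mono) (auto simp: G_def)
      ultimately show "RA a P 1 i * f (x i) \<le> (if i \<in> G then RA a P 1 i * K else 0) + RA a P 1 i * e"
        by (cases "i \<in> G") simp_all
    qed
    also have "\<dots> = (\<Sum>i\<in>?S \<inter> {i. i \<in> G}. RA a P 1 i * K) + (\<Sum>i\<in>?S. RA a P 1 i) * e"
      using S by (simp add: sum.distrib sum.If_cases sum_distrib_right)
    also have "?S \<inter> {i. i \<in> G} = G" by (auto simp: G_def)
    finally have "f (RA_sum x a P 1) \<le> (\<Sum>i\<in>G. RA a P 1 i) * K + e"
      unfolding RA_front(6)[OF P', of a] by (simp add: sum_distrib_right)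
    moreover have "2 * e < f (RA_sum x a P 1)" unfolding f(2) using big PL by (simp add: e_def)
    ultimately have "2 * e < (\<Sum>i\<in>G. RA a P 1 i) * K + e" by simp
    then have "e / K \<le> (\<Sum>i\<in>G. RA a P 1 i)" using K(1) by (simp add: field_simps)
    moreover have "G \<in> \<G>" using f(1) S unfolding \<G>_def G_def by auto
    ultimately show ?thesis unfolding large_def by auto
  qed
  ultimately obtain N where N: "N \<in> infinite_subsets L'" "embeds (schreier a) N \<G>"
    using large_embeds[of a] e K(1) unfolding large_embeds_def by (metis divide_pos_pos)
  have infN: "infinite N" "N \<subseteq> L'" using N by (auto simp: infinite_subsets_def)
  text \<open>It suffices to consider coefficients whose positive part dominates.\<close>
  have main: "e / 4 * (\<Sum>i\<in>F. \<bar>t i\<bar>) \<le> norm (\<Sum>i\<in>F. t i *\<^sub>R x (elt N i))"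
    if F: "F \<in> schreier a" and pos: "(\<Sum>i\<in>F. \<bar>t i\<bar>) \<le> 2 * (\<Sum>i\<in>{i\<in>F. 0 \<le> t i}. \<bar>t i\<bar>)"
    for F and t :: "nat \<Rightarrow> real"
  proof -
    define A B where "A = {i\<in>F. 0 \<le> t i}" and "B = F - A"
    have F1: "finite F" "F \<subseteq> {1..}" using schreier_finite[OF F] by auto
    have "A \<in> schreier a" using schreier_subset[OF F] by (auto simp: A_def)
    then have "elt N ` A \<in> \<G>" using N(2) by (auto simp: embeds_def)
    then obtain f where f: "f \<in> dual_ball" "\<forall>i\<in>elt N ` A. e \<le> f (x i)" unfolding \<G>_def by blast
    have sub: "elt N ` F \<subseteq> L'" "elt N ` A \<subseteq> elt N ` F"
      using elt_in[OF infN(1)] infN(2) by (auto simp: A_def)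
    obtain g where g: "g \<in> dual_ball" "\<forall>i\<in>elt N ` A. e \<le> g (x i)"
      "\<forall>i\<in>elt N ` F - elt N ` A. g (x i) \<le> e / 2"
      using L'(3)[OF finite_imageI[OF F1(1)] sub f] by blast
    have gl: "bounded_linear g" "\<And>v. \<bar>g v\<bar> \<le> norm v" using g by (auto simp: dual_ball_def)
    have gB: "g (x (elt N i)) \<le> e / 2" if "i \<in> B" for i
      using that g(3) inj_on_elt[OF infN(1) F1(2)] by (auto simp: B_def A_def inj_on_def)
    have "(\<Sum>i\<in>A. \<bar>t i\<bar> * e) \<le> (\<Sum>i\<in>A. t i * g (x (elt N i)))"
      using g(2) by (intro sum_mono) (auto simp: A_def mult_left_mono)
    moreover have "(\<Sum>i\<in>B. - \<bar>t i\<bar> * (e / 2)) \<le> (\<Sum>i\<in>B. t i * g (x (elt N i)))"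
      using gB by (intro sum_mono) (auto simp: A_def B_def intro: mult_left_mono_neg)
    moreover have split: "sum h F = sum h A + sum h B" for h :: "nat \<Rightarrow> real"
      using F1(1) sum.subset_diff[of A F h] by (simp add: A_def B_def add.commute)
    moreover have "(\<Sum>i\<in>B. - \<bar>t i\<bar> * (e / 2)) = - ((\<Sum>i\<in>B. \<bar>t i\<bar>) * (e / 2))"
      by (simp only: sum_distrib_right[symmetric] sum_negf mult_minus_left)
    ultimately have "(\<Sum>i\<in>A. \<bar>t i\<bar>) * e - (\<Sum>i\<in>B. \<bar>t i\<bar>) * (e / 2) \<le> (\<Sum>i\<in>F. t i * g (x (elt N i)))"
      unfolding sum_distrib_right[of _ A e] split[of "\<lambda>i. t i * g (x (elt N i))"] by linarith
    also have "\<dots> = g (\<Sum>i\<in>F. t i *\<^sub>R x (elt N i))"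
      by (simp add: linear_sum[OF bounded_linear.linear[OF gl(1)]] linear_simps(5)[OF gl(1)])
    also have "\<dots> \<le> norm (\<Sum>i\<in>F. t i *\<^sub>R x (elt N i))" using gl(2) abs_le_D1 by blast
    finally have low: "(\<Sum>i\<in>A. \<bar>t i\<bar>) * e - (\<Sum>i\<in>B. \<bar>t i\<bar>) * (e / 2) \<le> norm (\<Sum>i\<in>F. t i *\<^sub>R x (elt N i))" .
    \<comment> \<open>If q \<le> p are the sums over \<open>B\<close> and \<open>A\<close>, then p e
      - q e / 2 is at least (p + q) e / 4; this is the origin of the constant
      \<open>e / 4\<close>.\<close>
    have "(\<Sum>i\<in>B. \<bar>t i\<bar>) * e \<le> (\<Sum>i\<in>A. \<bar>t i\<bar>) * e"
      using pos e unfolding split A_def[symmetric] by (intro mult_right_mono) auto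
    then have "e / 4 * ((\<Sum>i\<in>A. \<bar>t i\<bar>) + (\<Sum>i\<in>B. \<bar>t i\<bar>)) \<le>
        (\<Sum>i\<in>A. \<bar>t i\<bar>) * e - (\<Sum>i\<in>B. \<bar>t i\<bar>) * (e / 2)"
      by (simp add: algebra_simps)
    then show ?thesis using low unfolding split by linarith
  qed
  have "e / 4 * (\<Sum>i\<in>F. \<bar>t i\<bar>) \<le> norm (\<Sum>i\<in>F. t i *\<^sub>R x (elt N i))"
    if F: "F \<in> schreier a" for F and t :: "nat \<Rightarrow> real"
  proof (cases "(\<Sum>i\<in>F. \<bar>t i\<bar>) \<le> 2 * (\<Sum>i\<in>{i\<in>F. 0 \<le> t i}. \<bar>t i\<bar>)")
    case True
    then show ?thesis using main[OF F] by blast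
  next
    case False
    have fin: "finite F" using schreier_finite[OF F] by blast
    have "(\<Sum>i\<in>F. \<bar>t i\<bar>) \<le> (\<Sum>i\<in>{i\<in>F. 0 \<le> t i} \<union> {i\<in>F. 0 \<le> - t i}. \<bar>t i\<bar>)"
      using fin by (intro sum_mono2) auto
    also have "\<dots> \<le> (\<Sum>i\<in>{i\<in>F. 0 \<le> t i}. \<bar>t i\<bar>) + (\<Sum>i\<in>{i\<in>F. 0 \<le> - t i}. \<bar>t i\<bar>)"
    proof -
      have "0 \<le> (\<Sum>i\<in>{i\<in>F. 0 \<le> t i} \<inter> {i\<in>F. 0 \<le> - t i}. \<bar>t i\<bar>)" by (rule sum_nonneg) simp
      moreover have "finite {i\<in>F. 0 \<le> t i}" "finite {i\<in>F. 0 \<le> - t i}" using fin by simp_all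
      ultimately show ?thesis using sum_Un[of "{i\<in>F. 0 \<le> t i}" "{i\<in>F. 0 \<le> - t i}" "\<lambda>i. \<bar>t i\<bar>"]
        by linarith
    qed
    finally have "(\<Sum>i\<in>F. \<bar>- t i\<bar>) \<le> 2 * (\<Sum>i\<in>{i\<in>F. 0 \<le> - t i}. \<bar>- t i\<bar>)"
      using False by simp
    from main[OF F this] show ?thesis by (simp add: sum_negf)
  qed
  then have "l1_spreading_model a N x"
    unfolding l1_spreading_model_def using e by (intro exI[of _ "e / 4"]) auto
  then show ?thesis using infN L' by (auto simp: infinite_subsets_def)
qed

lemma small_averages_imp_summable:
  fixes x :: "nat \<Rightarrow> 'a::real_normed_vector"
  assumes K: "\<And>n. norm (x n) \<le> K" and P: "P \<in> infinite_subsets {1..}"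
    and small: "\<And>\<epsilon>. 0 < \<epsilon> \<Longrightarrow> \<exists>m. \<forall>N\<in>infinite_subsets P. m \<le> Inf N \<longrightarrow> norm (RA_sum x (osuc a) N 1) \<le> \<epsilon>"
  shows "summable_RA P a x"
proof -
  define y where "y j = RA_sum x a P (Suc j)" for j
  have yK: "norm (y j) \<le> K" for j unfolding y_def using norm_RA_sum_le[OF P _ K] by simp
  have K0: "0 \<le> K" using K[of 0] norm_ge_zero order_trans by blast
  have bound: "\<exists>C. \<forall>n. norm (\<Sum>j<n. y j) \<le> C + real n * \<eta>" if \<eta>: "0 < \<eta>" for \<eta>
  proof -
    \<comment> \<open>A window is bounded by p \<epsilon> from the average of order
      \<open>osuc a\<close> plus \<open>K \<le> real p * \<epsilon>\<close> from the extra early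
      term. The total 2 p \<epsilon> = p \<eta> / 2 is at most (p - 1) \<eta> because p is at least
      2.\<close>
    define \<epsilon> where "\<epsilon> = \<eta> / 4"
    have \<epsilon>: "0 < \<epsilon>" using \<eta> by (simp add: \<epsilon>_def)
    obtain m where m: "\<And>N. N \<in> infinite_subsets P \<Longrightarrow> m \<le> Inf N \<Longrightarrow> norm (RA_sum x (osuc a) N 1) \<le> \<epsilon>"
      using small[OF \<epsilon>] by blast
    obtain k0 :: nat where k0: "K / \<epsilon> < real k0" using reals_Archimedean2 by blast
    define k where "k = max (max m k0) 2"
    have R: "rest a P k \<in> infinite_subsets {1..}" using rest_infinite[OF P] .
    define p where "p = Inf (rest a P k)"
    have p: "k \<le> p" using rest_ge[OF P] Inf_ge_1[OF R] unfolding p_def by fastforce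
    then have p2: "2 \<le> p" "m \<le> p" by (auto simp: k_def)
    have Kp: "K \<le> real p * \<epsilon>"
    proof -
      have "K / \<epsilon> \<le> real p" using k0 p by (simp add: k_def)
      then show ?thesis using \<epsilon> by (simp add: divide_le_eq)
    qed
    define w where "w = p - 1"
    text \<open>Average a fixed early term with an arbitrary late window: this is the first average of order
      \<open>osuc a\<close> of a subset of \<open>P\<close> with minimum \<open>p\<close>.\<close>
    have win: "norm (\<Sum>i<w. y (l + i)) \<le> real w * \<eta>" if l: "Suc k \<le> l" for l
    proof -
      define r where "r i = (case i of 0 \<Rightarrow> k | Suc i \<Rightarrow> l + i)" for i
      have "strict_mono r" unfolding strict_mono_Suc_iff r_def using l by (auto split: nat.split)
      then obtain N where N: "N \<in> infinite_subsets P" "\<And>j. RA a N (Suc j) = RA a P (Suc (r j))"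
        using RA_subselect[OF P] by blast
      have N': "N \<in> infinite_subsets {1..}" using infinite_subsets_trans[OF N(1) P] .
      have "RA a N 1 = RA a (rest a P k) 1"
        using N(2)[of 0] RA_rest[OF P, of a k] by (simp add: r_def)
      then have InfN: "Inf N = p"
        using good_Min_front[OF RA_good N', of a] good_Min_front[OF RA_good R, of a] by (simp add: p_def)
      have yr: "RA_sum x a N (Suc j) = y (r j)" for j using N(2) by (simp add: RA_sum_def y_def)
      define S where "S = front (osuc a) N"
      have S: "finite S" using RA_front(1)[OF N'] by (simp add: S_def)
      have supS: "supp (RA a N j) \<subseteq> S" if j: "j \<in> {1..p}" for j
      proof
        fix i assume i: "i \<in> supp (RA a N j)"
        have "0 < (\<Sum>j = 1..p. RA a N j i)"
          using i j RA_nonneg[OF N', of _ a i] by (intro sum_pos2[of _ j]) (auto simp: supp_def less_le)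
        then show "i \<in> S" unfolding S_def supp_def using RA_osuc_first[OF RA_good N', of a i] InfN p2 by simp
      qed
      have "real p *\<^sub>R RA_sum x (osuc a) N 1 = (\<Sum>i\<in>S. (\<Sum>j = 1..p. RA a N j i) *\<^sub>R x i)"
        using p2 InfN unfolding RA_sum_eq[OF N' order_refl S[unfolded S_def] order_refl] S_def
        by (simp add: scaleR_sum_right RA_osuc_first[OF RA_good N', simplified])
      also have "\<dots> = (\<Sum>j = 1..p. \<Sum>i\<in>S. RA a N j i *\<^sub>R x i)"
        by (simp add: scaleR_sum_left sum.swap[of _ S])
      also have "\<dots> = (\<Sum>j = 1..p. RA_sum x a N j)"
        using RA_sum_eq[OF N' _ S supS, symmetric] by (intro sum.cong) auto
      also have "\<dots> = (\<Sum>j<Suc w. y (r j))"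
        using sum.atLeast1_atMost_eq[of "RA_sum x a N" p] p2 by (simp add: yr w_def)
      also have "\<dots> = y k + (\<Sum>i<w. y (l + i))" unfolding sum.lessThan_Suc_shift by (simp add: r_def)
      finally have "(\<Sum>i<w. y (l + i)) = real p *\<^sub>R RA_sum x (osuc a) N 1 - y k" by simp
      then have "norm (\<Sum>i<w. y (l + i)) \<le> norm (real p *\<^sub>R RA_sum x (osuc a) N 1) + norm (y k)"
        using norm_triangle_ineq4 by metis
      also have "\<dots> \<le> real p * \<epsilon> + real p * \<epsilon>"
        using m[OF N(1)] InfN p2 yK[of k] Kp by (intro add_mono) (auto simp: mult_left_mono)
      also have "\<dots> \<le> real w * \<eta>"
      proof -
        have "real p * \<eta> \<le> 2 * real w * \<eta>" using p2 \<eta> by (intro mult_right_mono) (auto simp: w_def)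
        then show ?thesis unfolding \<epsilon>_def by linarith
      qed
      finally show ?thesis .
    qed
    have "1 \<le> w" using p2 by (simp add: w_def)
    from cesaro_window_bound[OF yK this win] show ?thesis using \<eta> by fastforce
  qed
  have "(\<lambda>n. (1 / real n) *\<^sub>R (\<Sum>j<n. y j)) \<longlonglongrightarrow> 0"
  proof (rule LIMSEQ_I)
    fix \<delta> :: real assume \<delta>: "0 < \<delta>"
    obtain C where C: "\<And>n. norm (\<Sum>j<n. y j) \<le> C + real n * (\<delta> / 2)" using bound[of "\<delta> / 2"] \<delta> by auto
    obtain n0 :: nat where n0: "2 * \<bar>C\<bar> / \<delta> < real n0" using reals_Archimedean2 by blast
    have "norm ((1 / real n) *\<^sub>R (\<Sum>j<n. y j) - 0) < \<delta>" if n: "n \<ge> max n0 1" for n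
    proof -
      have "2 * \<bar>C\<bar> / \<delta> < real n" using n0 n by linarith
      then have "2 * \<bar>C\<bar> < real n * \<delta>" using \<delta> by (simp add: divide_less_eq)
      then have "norm (\<Sum>j<n. y j) < real n * \<delta>" using C[of n] by simp
      then show ?thesis using n by (simp add: divide_less_eq mult.commute)
    qed
    then show "\<exists>no. \<forall>n\<ge>no. norm ((1 / real n) *\<^sub>R (\<Sum>j<n. y j) - 0) < \<delta>" by blast
  qed
  then show ?thesis unfolding summable_RA_iff y_def by (rule convergentI)
qed

text \<open>By the dichotomy each single tolerance holds on all subsets of some set, as its failure
  would give a spreading model. To reach all tolerances on one \<open>L\<close>, the tolerance is
  tied to \<open>card s\<close> and required beyond \<open>s\<close>; sets with large minimum lie
  beyond any given \<open>s\<close>.\<close>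

lemma summable_or_spreading_model:
  fixes x :: "nat \<Rightarrow> 'a::real_normed_vector"
  assumes wn: "weakly_null x" and M: "M \<in> infinite_subsets {1..}"
    and none: "\<And>N. N \<in> infinite_subsets {1..} \<Longrightarrow> \<not> l1_spreading_model (osuc a) N x"
  shows "\<exists>L\<in>infinite_subsets M. \<forall>P\<in>infinite_subsets L. summable_RA P a x"
proof -
  obtain K where K: "\<And>n. norm (x n) \<le> K" using weakly_null_bounded[OF wn] by blast
  define Q where "Q s N \<longleftrightarrow> (\<forall>P\<in>infinite_subsets N.
      norm (RA_sum x (osuc a) P 1) \<le> 1 / real (Suc (card s)))" for s :: "nat set" and N
  have inf: "infinite M" using M by (simp add: infinite_subsets_def)
  have Q_ex: "\<exists>N'\<subseteq>N. infinite N' \<and> Q s N'" if N: "infinite N" "N \<subseteq> M" for s N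
  proof -
    have N': "N \<in> infinite_subsets {1..}" using N M by (auto simp: infinite_subsets_def)
    let ?\<phi> = "\<lambda>P. 1 / real (Suc (card s)) < norm (RA_sum x (osuc a) P 1)"
    have "\<exists>K\<in>infinite_subsets N. (\<forall>P\<in>infinite_subsets K. ?\<phi> P) \<or> (\<forall>P\<in>infinite_subsets K. \<not> ?\<phi> P)"
      by (rule RA_dichotomy[OF N', of 1 "osuc a"]) (simp add: RA_sum_def)
    then obtain K where K: "K \<in> infinite_subsets N"
      "(\<forall>P\<in>infinite_subsets K. ?\<phi> P) \<or> (\<forall>P\<in>infinite_subsets K. \<not> ?\<phi> P)" by blast
    have K': "K \<in> infinite_subsets {1..}" using infinite_subsets_trans[OF K(1) N'] .
    have "\<not> (\<forall>P\<in>infinite_subsets K. ?\<phi> P)"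
      using large_averages_imp_spreading_model[OF wn K', of "1 / real (Suc (card s))" "osuc a"] none
        infinite_subsets_trans[OF _ K'] by auto
    then have "Q s K" using K(2) by (auto simp: Q_def not_less)
    then show ?thesis using K(1) by (auto simp: infinite_subsets_def)
  qed
  have Q_her: "Q s N'" if "Q s N" "N' \<subseteq> N" for s N N'
    using that unfolding Q_def infinite_subsets_def by blast
  obtain L where L: "infinite L" "L \<subseteq> M" "\<And>s. finite s \<Longrightarrow> s \<subseteq> L \<Longrightarrow> Q s (beyond s L)"
    by (rule fusion_beyond[where Q = Q, OF inf]) (erule (1) Q_ex, erule (1) Q_her, blast)
  have "summable_RA P a x" if P: "P \<in> infinite_subsets L" for P
  proof (rule small_averages_imp_summable[OF K])
    show "P \<in> infinite_subsets {1..}" using P L M by (auto simp: infinite_subsets_def)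
    fix \<epsilon> :: real assume "0 < \<epsilon>"
    then obtain k where k: "1 / real (Suc k) < \<epsilon>" using nat_approx_posE by metis
    obtain s where s: "finite s" "s \<subseteq> L" "card s = k" using infinite_arbitrarily_large[OF L(1)] by blast
    have "norm (RA_sum x (osuc a) N 1) \<le> \<epsilon>"
      if N: "N \<in> infinite_subsets P" "Suc (Max (insert 0 s)) \<le> Inf N" for N
    proof -
      have "i < n" if "n \<in> N" "i \<in> s" for n i
      proof -
        have "i \<le> Max (insert 0 s)" using that(2) s(1) by (intro Max_ge) auto
        moreover have "Inf N \<le> n" using that(1) by (intro cInf_lower) auto
        ultimately show ?thesis using N(2) by linarith
      qed
      then have "N \<in> infinite_subsets (beyond s L)"
        using N P by (auto simp: infinite_subsets_def beyond_def)
      then show ?thesis using L(3)[OF s(1,2)] k s(3) unfolding Q_def by fastforce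
    qed
    then show "\<exists>m. \<forall>N\<in>infinite_subsets P. m \<le> Inf N \<longrightarrow> norm (RA_sum x (osuc a) N 1) \<le> \<epsilon>" by blast
  qed
  then show ?thesis using L by (auto simp: infinite_subsets_def)
qed

text \<open>For a set \<open>P\<close> whose gaps are large compared to the positions in \<open>M\<close>, the position of the successor
  of an element of \<open>G\<close> is at least this element. Hence the positions of all of \<open>G\<close> but its minimum form
  a spread of a subset of \<open>G\<close>.\<close>

lemma spreading_model_sparse:
  assumes M: "M \<in> infinite_subsets {1..}" and P: "P \<subseteq> M"
    and sparse: "\<And>a n. a \<in> P \<Longrightarrow> n \<in> P \<Longrightarrow> a < n \<Longrightarrow> a \<le> card (M \<inter> {..<n})"
    and l1: "\<And>F t. F \<in> schreier b \<Longrightarrow>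
      \<epsilon> * (\<Sum>i\<in>F. \<bar>t i\<bar>) \<le> norm (\<Sum>i\<in>F. t i *\<^sub>R x (elt M i))"
    and G: "G \<subseteq> P" "G \<in> schreier b"
  shows "\<epsilon> * (\<Sum>n\<in>G - {Min G}. \<bar>t n\<bar>) \<le> norm (\<Sum>n\<in>G - {Min G}. t n *\<^sub>R x n)"
proof -
  have inf: "infinite M" using M by (simp add: infinite_subsets_def)
  have fin: "finite G" using schreier_finite[OF G(2)] by blast
  define pos where "pos n = Suc (card (M \<inter> {..<n}))" for n
  define nxt where "nxt a = Min {n \<in> G. a < n}" for a
  have nx: "nxt a \<in> G" "a < nxt a" "\<And>n. n \<in> G \<Longrightarrow> a < n \<Longrightarrow> nxt a \<le> n"
    if "a \<in> G - {Max G}" for a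
  proof -
    have "G \<noteq> {}" using that by auto
    then have "Max G \<in> {n \<in> G. a < n}" using that fin Max_ge[of G a] Max_in[of G] by (auto simp: le_less)
    then have "nxt a \<in> {n \<in> G. a < n}" unfolding nxt_def using fin by (intro Min_in) auto
    then show "nxt a \<in> G" "a < nxt a" by auto
    show "\<And>n. n \<in> G \<Longrightarrow> a < n \<Longrightarrow> nxt a \<le> n" unfolding nxt_def using fin by auto
  qed
  have pos_less: "pos m < pos n" if "m \<in> M" "m < n" for m n
  proof -
    have "M \<inter> {..<m} \<subset> M \<inter> {..<n}" using that by auto
    then show ?thesis unfolding pos_def by (simp add: psubset_card_mono)
  qed
  have next_img: "nxt ` (G - {Max G}) = G - {Min G}"
  proof
    show "nxt ` (G - {Max G}) \<subseteq> G - {Min G}"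
    proof
      fix n assume "n \<in> nxt ` (G - {Max G})"
      then obtain a where a: "a \<in> G - {Max G}" "n = nxt a" by blast
      then have "Min G \<le> a" using fin by (intro Min_le) auto
      then have "Min G < n" using nx(2)[OF a(1)] a(2) by simp
      then show "n \<in> G - {Min G}" using a nx(1) by auto
    qed
    show "G - {Min G} \<subseteq> nxt ` (G - {Max G})"
    proof
      fix n assume n: "n \<in> G - {Min G}"
      let ?A = "{a \<in> G. a < n}"
      have "G \<noteq> {}" using n by auto
      then have "Min G \<in> ?A" using n fin Min_le[of G n] Min_in[of G] by (auto simp: le_less)
      then have A: "finite ?A" "?A \<noteq> {}" using fin by auto
      define a where "a = Max ?A"
      have a: "a \<in> G" "a < n" using Max_in[OF A] by (auto simp: a_def)
      have "n \<le> Max G" using n fin by (intro Max_ge) auto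
      then have aG: "a \<in> G - {Max G}" using a by auto
      have "nxt a = n"
      proof (rule antisym)
        show "nxt a \<le> n" using nx(3)[OF aG] n a by blast
        show "n \<le> nxt a"
        proof (rule ccontr)
          assume "\<not> n \<le> nxt a"
          then have "nxt a \<le> a" using nx(1)[OF aG] A by (auto simp: a_def)
          then show False using nx(2)[OF aG] by simp
        qed
      qed
      then show "n \<in> nxt ` (G - {Max G})" using aG by blast
    qed
  qed
  have GM: "G \<subseteq> M" using G P by blast
  define I where "I = pos ` (G - {Min G})"
  have "spread (G - {Max G}) I" unfolding spread_def
  proof (intro exI[of _ "\<lambda>a. pos (nxt a)"] conjI ballI)
    show "strict_mono_on (G - {Max G}) (\<lambda>a. pos (nxt a))"
    proof (rule strict_mono_onI)
      fix a a' assume a: "a \<in> G - {Max G}" "a' \<in> G - {Max G}" "a < a'"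
      have "nxt a < nxt a'" using nx(3)[OF a(1), of a'] nx(2)[OF a(2)] a by simp
      then show "pos (nxt a) < pos (nxt a')" using pos_less nx(1)[OF a(1)] GM by blast
    qed
    show "a \<le> pos (nxt a)" if "a \<in> G - {Max G}" for a
    proof -
      have "a \<in> P" "nxt a \<in> P" using nx(1)[OF that] that G(1) by auto
      then show ?thesis using sparse nx(2)[OF that] by (simp add: pos_def le_SucI)
    qed
    show "I = (\<lambda>a. pos (nxt a)) ` (G - {Max G})" unfolding I_def next_img[symmetric] by (simp add: image_image)
  qed
  then have I: "I \<in> schreier b" using schreier_spread schreier_subset[OF G(2)] by blast
  have elt_pos: "elt M (pos n) = n" if "n \<in> M" for n
    unfolding pos_def using elt_Suc_card[OF inf that] .
  have inj: "inj_on pos (G - {Min G})" using elt_pos GM by (intro inj_on_inverseI[of _ "elt M"]) auto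
  have e: "elt M (pos n) = n" if "n \<in> G - {Min G}" for n using elt_pos that GM by auto
  have "(\<Sum>n\<in>G - {Min G}. \<bar>t (elt M (pos n))\<bar>) = (\<Sum>n\<in>G - {Min G}. \<bar>t n\<bar>)"
    "(\<Sum>n\<in>G - {Min G}. t (elt M (pos n)) *\<^sub>R x (elt M (pos n))) = (\<Sum>n\<in>G - {Min G}. t n *\<^sub>R x n)"
    by (rule sum.cong[OF refl], simp only: e)+
  then show ?thesis
    using l1[OF I, of "\<lambda>i. t (elt M i)"] unfolding I_def sum.reindex[OF inj] o_def by simp
qed

lemma not_summable_and_spreading_model:
  fixes x :: "nat \<Rightarrow> 'a::real_normed_vector"
  assumes wn: "weakly_null x" and M: "M \<in> infinite_subsets {1..}"
    and l1: "l1_spreading_model (osuc a) M x" and L: "L \<in> infinite_subsets M"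
  shows "\<exists>P\<in>infinite_subsets L. \<not> summable_RA P a x"
proof -
  obtain K where K: "0 < K" "\<And>n. norm (x n) \<le> K" using weakly_null_bounded[OF wn] by blast
  obtain \<epsilon> where \<epsilon>: "0 < \<epsilon>" "\<And>F t. F \<in> schreier (osuc a) \<Longrightarrow>
      \<epsilon> * (\<Sum>i\<in>F. \<bar>t i\<bar>) \<le> norm (\<Sum>i\<in>F. t i *\<^sub>R x (elt M i))"
    using l1 unfolding l1_spreading_model_def by blast
  have inf: "infinite M" "infinite L" "L \<subseteq> M" using M L by (auto simp: infinite_subsets_def)
  define Q where "Q s N \<longleftrightarrow> (\<forall>n\<in>N. \<forall>a\<in>s. a \<le> card (M \<inter> {..<n}))" for s N
  have Q_ex: "\<exists>N'\<subseteq>N. infinite N' \<and> Q s N'" if s: "finite s" and N: "infinite N" for s N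
  proof (intro exI conjI)
    \<comment> \<open>\<open>enumerate M a\<close> has exactly a elements of \<open>M\<close> below
      it, because the enumeration starts at index 0.\<close>
    let ?N' = "beyond (enumerate M ` s) N"
    show "?N' \<subseteq> N" "infinite ?N'" using infinite_beyond[OF _ N] s by (auto simp: beyond_subset)
    show "Q s ?N'" unfolding Q_def
    proof (intro ballI)
      fix n a assume "n \<in> ?N'" "a \<in> s"
      then have "enumerate M a < n" by (auto simp: beyond_def)
      then have "card (M \<inter> {..<enumerate M a}) \<le> card (M \<inter> {..<n})" by (intro card_mono) auto
      then show "a \<le> card (M \<inter> {..<n})" using card_initial_enumerate[OF inf(1)] by simp
    qed
  qed
  have Q_her: "Q s N'" if "Q s N" "N' \<subseteq> N" for s N N' using that unfolding Q_def by blast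
  obtain P where P: "infinite P" "P \<subseteq> L" "\<And>s. finite s \<Longrightarrow> s \<subseteq> P \<Longrightarrow> Q s (beyond s P)"
    by (rule fusion_beyond[where Q = Q, OF inf(2)]) (erule (1) Q_ex, erule (1) Q_her, blast)
  have PL: "P \<in> infinite_subsets L" using P by (auto simp: infinite_subsets_def)
  have P': "P \<in> infinite_subsets {1..}" using P inf M by (auto simp: infinite_subsets_def)
  have PM: "P \<subseteq> M" using P inf by blast
  have sparse: "b \<le> card (M \<inter> {..<n})" if "b \<in> P" "n \<in> P" "b < n" for b n
    using P(3)[of "{b}"] that by (auto simp: Q_def beyond_def)
  define y where "y j = RA_sum x a P (Suc j)" for j
  \<comment> \<open>The lower estimate misses the minimum of the joint support. The coefficient
    there is at most 1, which turns n into n - 1 and costs at most \<open>K\<close> in norm.\<close>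
  have window: "\<epsilon> * (real n - 1) - K \<le> norm (\<Sum>j<n. y (n + j))" if n: "1 \<le> n" for n
  proof -
    define R where "R = rest a P n"
    have R: "R \<in> infinite_subsets {1..}" using rest_infinite[OF P'] by (simp add: R_def)
    define G where "G = R - rest a R n"
    have G: "finite G" using good_finite_diff_rest[OF RA_good R] by (simp add: G_def)
    have Geq: "G = (\<Union>j\<in>{1..n}. supp (RA a R j))"
      using good_diff_rest[OF RA_good R] by (simp add: G_def)
    have "\<forall>i\<in>G. n \<le> i" using rest_ge[OF P', of _ a n] by (fastforce simp: G_def R_def)
    then have GS: "G \<in> schreier (osuc a)"
      unfolding schreier_osuc_blocks using good_diff_rest_blocks[OF RA_good R] n by (auto simp: G_def)
    have GP: "G \<subseteq> P" using rest_subset by (auto simp: G_def R_def)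
    define T where "T i = (\<Sum>j = 1..n. RA a R j i)" for i
    have T0: "0 \<le> T i" for i unfolding T_def using RA_nonneg[OF R] by (intro sum_nonneg) auto
    have sumT: "(\<Sum>i\<in>G. T i) = real n"
    proof -
      have "(\<Sum>i\<in>G. RA a R j i) = 1" if j: "j \<in> {1..n}" for j
      proof -
        have "(\<Sum>i\<in>G. RA a R j i) = (\<Sum>i\<in>supp (RA a R j). RA a R j i)"
          using G j unfolding Geq by (intro sum.mono_neutral_right) (auto simp: supp_def)
        then show ?thesis using supp_RA(3)[OF R, of j a] j by simp
      qed
      then show ?thesis unfolding T_def by (subst sum.swap) simp
    qed
    have Gne: "G \<noteq> {}" using sumT n by auto
    \<comment> \<open>Only the first of the n averages charges the minimum, since the later supports
      lie in \<open>rest a R 1\<close>.\<close>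
    have Tmin: "T (Min G) \<le> 1"
    proof -
      have fG: "front a R \<subseteq> G" unfolding Geq using n by auto
      obtain i where i: "i \<in> front a R" using RA_front(2)[OF R] by blast
      have "Min G \<in> front a R"
      proof (rule ccontr)
        assume "Min G \<notin> front a R"
        then have "i < Min G" using RA_front(3)[OF R, of a] i Min_in[OF G Gne] by (auto simp: initial_def G_def)
        then show False using Min_le[OF G, of i] i fG by auto
      qed
      then have "Min G \<notin> rest a R (j - 1)" if "2 \<le> j" for j
        using rest_mono[of 1 "j - 1" a R] that by fastforce
      then have z: "RA a R j (Min G) = 0" if "2 \<le> j" for j
        using supp_RA(2)[OF R, of j a] that by (auto simp: supp_def)
      have "T (Min G) = (\<Sum>j\<in>{1}. RA a R j (Min G))"
        unfolding T_def using n z by (intro sum.mono_neutral_right) auto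
      also have "\<dots> \<le> 1" using RA_mass_le_1[OF R, of 1 "{Min G}" a] by simp
      finally show ?thesis .
    qed
    have "(\<Sum>j<n. y (n + j)) = (\<Sum>j = 1..n. RA_sum x a R j)"
    proof -
      have "y (n + j) = RA_sum x a R (Suc j)" for j
        using good_RA_add[OF RA_good P', of "Suc j" a n] by (simp add: y_def RA_sum_def R_def)
      then show ?thesis using sum.atLeast1_atMost_eq[of "RA_sum x a R" n] by simp
    qed
    also have "\<dots> = (\<Sum>j = 1..n. \<Sum>i\<in>G. RA a R j i *\<^sub>R x i)"
    proof (intro sum.cong refl RA_sum_eq[OF R _ G])
      show "supp (RA a R j) \<subseteq> G" if "j \<in> {1..n}" for j using that unfolding Geq by blast
    qed simp
    also have "\<dots> = (\<Sum>i\<in>G. T i *\<^sub>R x i)"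
      by (subst sum.swap) (simp add: T_def scaleR_sum_left)
    also have "\<dots> = T (Min G) *\<^sub>R x (Min G) + (\<Sum>i\<in>G - {Min G}. T i *\<^sub>R x i)"
      using G Gne by (intro sum.remove) auto
    finally have eq: "(\<Sum>j<n. y (n + j)) = T (Min G) *\<^sub>R x (Min G) + (\<Sum>i\<in>G - {Min G}. T i *\<^sub>R x i)" .
    have "(\<Sum>i\<in>G - {Min G}. \<bar>T i\<bar>) = real n - T (Min G)"
      using sum.remove[OF G Min_in[OF G Gne], of T] sumT T0 by simp
    then have "\<epsilon> * (real n - 1) \<le> \<epsilon> * (\<Sum>i\<in>G - {Min G}. \<bar>T i\<bar>)"
      using Tmin \<epsilon>(1) by (intro mult_left_mono) auto
    also have "\<dots> \<le> norm (\<Sum>i\<in>G - {Min G}. T i *\<^sub>R x i)"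
      using spreading_model_sparse[OF M PM sparse \<epsilon>(2) GP GS] .
    finally have "\<epsilon> * (real n - 1) \<le> norm (\<Sum>i\<in>G - {Min G}. T i *\<^sub>R x i)" .
    moreover have "norm (T (Min G) *\<^sub>R x (Min G)) \<le> 1 * K"
      unfolding norm_scaleR using Tmin T0 K by (intro mult_mono) auto
    moreover have "norm (\<Sum>i\<in>G - {Min G}. T i *\<^sub>R x i) \<le>
        norm (\<Sum>j<n. y (n + j)) + norm (T (Min G) *\<^sub>R x (Min G))"
      unfolding eq using norm_triangle_ineq4[of "T (Min G) *\<^sub>R x (Min G) + (\<Sum>i\<in>G - {Min G}. T i *\<^sub>R x i)"
          "T (Min G) *\<^sub>R x (Min G)"] by simp
    ultimately show ?thesis by linarith
  qed
  have "\<not> summable_RA P a x"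
  proof
    assume "summable_RA P a x"
    then obtain v where v: "(\<lambda>n. (1 / real n) *\<^sub>R (\<Sum>j<n. y j)) \<longlonglongrightarrow> v"
      unfolding summable_RA_iff y_def convergent_def by blast
    \<comment> \<open>The mean of the terms with numbers n + 1 to 2 n is twice the mean up to 2 n
      minus the mean up to n, so it has the same limit \<open>v\<close>.\<close>
    define D where "D n = (1 / real n) *\<^sub>R (\<Sum>j<n. y (n + j))" for n
    have "(\<lambda>n. 2 *\<^sub>R ((1 / real (2 * n)) *\<^sub>R (\<Sum>j<2 * n. y j)) - (1 / real n) *\<^sub>R (\<Sum>j<n. y j))
        \<longlonglongrightarrow> 2 *\<^sub>R v - v"
    proof (intro tendsto_diff tendsto_scaleR tendsto_const v)
      have "strict_mono (\<lambda>n::nat. 2 * n)" by (simp add: strict_mono_def)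
      from LIMSEQ_subseq_LIMSEQ[OF v this]
      show "(\<lambda>n. (1 / real (2 * n)) *\<^sub>R (\<Sum>j<2 * n. y j)) \<longlonglongrightarrow> v" by (simp add: o_def)
    qed
    moreover have "2 *\<^sub>R ((1 / real (2 * n)) *\<^sub>R (\<Sum>j<2 * n. y j)) - (1 / real n) *\<^sub>R (\<Sum>j<n. y j) = D n" for n
    proof -
      have "(\<Sum>j<2 * n. y j) = (\<Sum>j<n. y j) + (\<Sum>j<n. y (n + j))"
        unfolding mult_2 by (rule sum_lessThan_add)
      then show ?thesis by (simp add: D_def algebra_simps)
    qed
    moreover have "2 *\<^sub>R v - v = v" by (simp add: scaleR_2)
    ultimately have D: "D \<longlonglongrightarrow> v" by simp
    have "\<epsilon> \<le> norm v"
    proof (rule LIMSEQ_le)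
      show "(\<lambda>n. norm (D n)) \<longlonglongrightarrow> norm v" by (intro tendsto_norm D)
      have "(\<lambda>n. \<epsilon> - (\<epsilon> + K) * (1 / real n)) \<longlonglongrightarrow> \<epsilon> - (\<epsilon> + K) * 0"
        by (intro tendsto_intros lim_1_over_n)
      then show "(\<lambda>n. \<epsilon> - (\<epsilon> + K) * (1 / real n)) \<longlonglongrightarrow> \<epsilon>" by simp
      have "\<epsilon> - (\<epsilon> + K) * (1 / real n) \<le> norm (D n)" if n: "1 \<le> n" for n
      proof -
        have "(\<epsilon> * (real n - 1) - K) / real n \<le> norm (\<Sum>j<n. y (n + j)) / real n"
          using window[OF n] by (simp add: divide_right_mono)
        then show ?thesis using n by (simp add: D_def field_simps)
      qed
      then show "\<exists>N. \<forall>n\<ge>N. \<epsilon> - (\<epsilon> + K) * (1 / real n) \<le> norm (D n)" by blast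
    qed
    \<comment> \<open>The averages entering \<open>D n\<close> have supports beyond n, where
      \<open>f\<close> is small along the sequence. This bounds the norm of the limit by
      \<open>\<epsilon> / 2\<close>, whereas it is at least \<epsilon>.\<close>
    obtain f where f: "f \<in> dual_ball" "f v = norm v" using norming_functional by blast
    have fl: "bounded_linear f" using f by (simp add: dual_ball_def)
    have "norm v \<le> \<epsilon> / 2"
    proof (rule LIMSEQ_le_const2)
      show "(\<lambda>n. f (D n)) \<longlonglongrightarrow> norm v" unfolding f(2)[symmetric] by (rule bounded_linear.tendsto[OF fl D])
      have "(\<lambda>n. f (x n)) \<longlonglongrightarrow> 0" using wn fl by (simp add: weakly_null_def)
      then obtain n0 where n0: "\<And>n. n0 \<le> n \<Longrightarrow> \<bar>f (x n)\<bar> \<le> \<epsilon> / 2"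
        using LIMSEQ_D[of _ 0 "\<epsilon> / 2"] \<epsilon>(1) by (metis diff_zero half_gt_zero less_imp_le real_norm_def)
      have "f (D n) \<le> \<epsilon> / 2" if n: "max n0 1 \<le> n" for n
      proof -
        have "\<bar>f (y (n + j))\<bar> \<le> \<epsilon> / 2" for j
          unfolding y_def
        proof (rule RA_sum_le[OF P' _ fl])
          fix i assume "i \<in> supp (RA a P (Suc (n + j)))"
          then have "i \<in> rest a P (n + j)" using supp_RA(2)[OF P', of "Suc (n + j)" a] by auto
          then have "n0 \<le> i" using rest_ge[OF P'] n by fastforce
          then show "\<bar>f (x i)\<bar> \<le> \<epsilon> / 2" using n0 by blast
        qed simp
        then have "(\<Sum>j<n. f (y (n + j))) \<le> (\<Sum>j<n. \<epsilon> / 2)" by (intro sum_mono) (meson abs_le_D1)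
        then show ?thesis using n
          by (simp add: D_def linear_sum[OF bounded_linear.linear[OF fl]] linear_simps(5)[OF fl] field_simps)
      qed
      then show "\<exists>N. \<forall>n\<ge>N. f (D n) \<le> \<epsilon> / 2" by blast
    qed
    then show False using \<open>\<epsilon> \<le> norm v\<close> \<epsilon>(1) by simp
  qed
  then show ?thesis using PL by blast
qed

end

theorem theoremB:
  fixes x :: "nat \<Rightarrow> 'a::banach" and c :: "omega1 \<Rightarrow> nat \<Rightarrow> omega1" and \<xi> :: omega1
  assumes "ladder_system c" and "weakly_null x"
  shows "(\<forall>M\<in>infinite_subsets {1..}. \<exists>L\<in>infinite_subsets M. \<forall>P\<in>infinite_subsets L.
            ladder_system.summable_RA c P \<xi> x)
     \<longleftrightarrow> \<not> (\<exists>M\<in>infinite_subsets {1..}.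
            ladder_system.l1_spreading_model c (osuc \<xi>) M x)"
proof -
  interpret ladder_system c by fact
  \<comment> \<open>For exclusivity, (a) is applied to the very set that (b) provides: every
    infinite subset of that set has a subset without summability.\<close>
  show ?thesis
    using summable_or_spreading_model[OF assms(2)] not_summable_and_spreading_model[OF assms(2)]
    by meson
qed

end
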